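(* Let $M$ be a closed orientable 3-manifold and let $\xi$ be a transversally orientable contact structure on $M$. For any smooth strictly negative function $f : M \to \mathbb{R}$ there is a Riemannian metric on $M$ such that $f$ is the Gaussian curvature of $\xi$, i.e. $K_G(\xi) = f$ on $M$.
   Context: A (plane) distribution on a 3-manifold $M$ is a rank-two smooth subbundle $\xi$ of $TM$. It is a contact structure if for any linearly independent (local) sections $S, T$ of $\xi$ and any point $p$ the Lie bracket $[S,T]$ at $p$ does not belong to $\xi_p$. It is transversally orientable (transversally oriented) if there is a globally defined 1-form $\alpha$ with $\xi = \ker \alpha$; equivalently, if there is a globally defined vector field transverse to $\xi$. Let $\langle\cdot,\cdot\rangle$ be a Riemannian metric on $M$ with Levi-Civita connection $\nabla$, and let $n$ be a local unit vector field orthogonal to $\xi$. The second fundamental form of $\xi$ is the symmetric bilinear form $B(S,T) = \frac12\langle \nabla_S T + \nabla_T S, n\rangle$ for sections $S,T$ of $\xi$. The extrinsic curvature of $\xi$ is $$K_e(\xi) = \frac{B(S,S)B(T,T) - B(S,T)^2}{\langle S,S\rangle\langle T,T\rangle - \langle S,T\rangle^2}$$ for linearly independent local sections $S,T$ of $\xi$ (this does not depend on the choice of $S,T,n$). The sectional curvature $K(\xi)$ of $\xi$ is the function assigning to $p\in M$ the sectional curvature of the plane $\xi_p\subset T_pM$. The Gaussian curvature of $\xi$ is $K_G(\xi) = K(\xi) + K_e(\xi)$. *)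

theory Defs
  imports "HOL-Analysis.Analysis" "HOL-Library.Function_Algebras"
begin

text \<open>Pointwise real vector space structure on functions, complementing \<open>Function_Algebras\<close>.\<close>

instantiation "fun" :: (type, real_vector) real_vector
begin

definition scaleR_fun :: "real \<Rightarrow> ('a \<Rightarrow> 'b) \<Rightarrow> 'a \<Rightarrow> 'b" where
  "scaleR_fun c f = (\<lambda>x. c *\<^sub>R f x)"

instance
  by standard (auto simp: scaleR_fun_def fun_eq_iff algebra_simps)

end

text \<open>Smooth maps on an open set: all iterated directional derivatives exist and are
  (Frechet) differentiable.\<close>

primrec times_diff :: "nat \<Rightarrow> 'a::real_normed_vector set \<Rightarrow> ('a \<Rightarrow> 'b::real_normed_vector) \<Rightarrow> bool" where
  "times_diff 0 S f \<longleftrightarrow> continuous_on S f"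
| "times_diff (Suc k) S f \<longleftrightarrow> (\<forall>x\<in>S. f differentiable (at x)) \<and>
     (\<forall>v. times_diff k S (\<lambda>x. frechet_derivative f (at x) v))"

definition smooth_on :: "'a::real_normed_vector set \<Rightarrow> ('a \<Rightarrow> 'b::real_normed_vector) \<Rightarrow> bool" where
  "smooth_on S f \<longleftrightarrow> (\<forall>k. times_diff k S f)"


text \<open>A 3-manifold is a whole type carrying a smooth atlas; a chart is a pair of an open domain
  and a coordinate map, whose values outside the domain are irrelevant.\<close>

type_synonym 'm chart = "'m set \<times> ('m \<Rightarrow> real^3)"

definition is_chart :: "'m::topological_space chart \<Rightarrow> bool" where
  "is_chart c \<longleftrightarrow> (case c of (U, \<phi>) \<Rightarrow>
     open U \<and> open (\<phi> ` U) \<and> (\<exists>\<psi>. homeomorphism U (\<phi> ` U) \<phi> \<psi>))"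

definition smooth_atlas :: "'m::topological_space chart set \<Rightarrow> bool" where
  "smooth_atlas A \<longleftrightarrow> (\<forall>c\<in>A. is_chart c) \<and> (\<Union>c\<in>A. fst c) = UNIV \<and>
     (\<forall>(U, \<phi>)\<in>A. \<forall>(V, \<psi>)\<in>A. smooth_on (\<phi> ` (U \<inter> V)) (\<psi> \<circ> inv_into U \<phi>))"

definition oriented_atlas :: "'m::topological_space chart set \<Rightarrow> bool" where
  "oriented_atlas A \<longleftrightarrow> smooth_atlas A \<and>
     (\<forall>(U, \<phi>)\<in>A. \<forall>(V, \<psi>)\<in>A. \<forall>x\<in>\<phi> ` (U \<inter> V).
        det (matrix (frechet_derivative (\<psi> \<circ> inv_into U \<phi>) (at x))) > 0)"

definition orientable :: "'m::topological_space chart set \<Rightarrow> bool" where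
  "orientable A \<longleftrightarrow> (\<exists>B. oriented_atlas B \<and> smooth_atlas (A \<union> B))"

text \<open>Smooth functions on an open subset \<open>W\<close> of the manifold.\<close>

definition smooth_fun :: "'m::topological_space chart set \<Rightarrow> 'm set \<Rightarrow> ('m \<Rightarrow> real) \<Rightarrow> bool" where
  "smooth_fun A W h \<longleftrightarrow> (\<forall>(U, \<phi>)\<in>A. smooth_on (\<phi> ` (U \<inter> W)) (h \<circ> inv_into U \<phi>))"

definition smooth_near :: "'m::topological_space chart set \<Rightarrow> 'm \<Rightarrow> ('m \<Rightarrow> real) \<Rightarrow> bool" where
  "smooth_near A p h \<longleftrightarrow> (\<exists>W. open W \<and> p \<in> W \<and> smooth_fun A W h)"


text \<open>Tangent vectors at \<open>p\<close> are the operators \<open>v\<^sup>1 \<partial>\<^sub>1 + v\<^sup>2 \<partial>\<^sub>2 + v\<^sup>3 \<partial>\<^sub>3\<close> in a chart around \<open>p\<close>,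
  acting on functions that are smooth near \<open>p\<close>. They are set to 0 on all other functions, so
  that equality of tangent vectors is equality of operators.\<close>

type_synonym 'm tvec = "('m \<Rightarrow> real) \<Rightarrow> real"
type_synonym 'm vfield = "'m \<Rightarrow> 'm tvec"

definition coord_vector :: "'m::topological_space chart set \<Rightarrow> 'm chart \<Rightarrow> 'm \<Rightarrow> real^3 \<Rightarrow> 'm tvec" where
  "coord_vector A c p v = (case c of (U, \<phi>) \<Rightarrow> (\<lambda>h. if smooth_near A p h
     then frechet_derivative (h \<circ> inv_into U \<phi>) (at (\<phi> p)) v else 0))"

definition tangent_space :: "'m::topological_space chart set \<Rightarrow> 'm \<Rightarrow> 'm tvec set" where
  "tangent_space A p = {coord_vector A c p v | c v. c \<in> A \<and> p \<in> fst c}"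

definition smooth_vfield :: "'m::topological_space chart set \<Rightarrow> 'm set \<Rightarrow> 'm vfield \<Rightarrow> bool" where
  "smooth_vfield A U X \<longleftrightarrow> (\<forall>p\<in>U. X p \<in> tangent_space A p) \<and>
     (\<forall>W h. open W \<and> smooth_fun A W h \<longrightarrow> smooth_fun A (U \<inter> W) (\<lambda>p. X p h))"

definition lie_bracket :: "'m::topological_space chart set \<Rightarrow> 'm vfield \<Rightarrow> 'm vfield \<Rightarrow> 'm vfield" where
  "lie_bracket A X Y = (\<lambda>p h. if smooth_near A p h
     then X p (\<lambda>q. Y q h) - Y p (\<lambda>q. X q h) else 0)"

text \<open>The inequality is needed because \<open>independent\<close> is a property of sets.\<close>

definition indep_pair :: "'m tvec \<Rightarrow> 'm tvec \<Rightarrow> bool" where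
  "indep_pair u v \<longleftrightarrow> u \<noteq> v \<and> independent {u, v}"


type_synonym 'm distribution = "'m \<Rightarrow> 'm tvec set"

definition plane_distribution :: "'m::topological_space chart set \<Rightarrow> 'm distribution \<Rightarrow> bool" where
  "plane_distribution A \<xi> \<longleftrightarrow>
     (\<forall>p. subspace (\<xi> p) \<and> \<xi> p \<subseteq> tangent_space A p \<and> dim (\<xi> p) = 2) \<and>
     (\<forall>p. \<exists>U S T. open U \<and> p \<in> U \<and> smooth_vfield A U S \<and> smooth_vfield A U T \<and>
        (\<forall>q\<in>U. \<xi> q = span {S q, T q}))"

definition local_section :: "'m::topological_space chart set \<Rightarrow> 'm distribution \<Rightarrow> 'm set \<Rightarrow> 'm vfield \<Rightarrow> bool" where
  "local_section A \<xi> U S \<longleftrightarrow> smooth_vfield A U S \<and> (\<forall>p\<in>U. S p \<in> \<xi> p)"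

definition contact_structure :: "'m::topological_space chart set \<Rightarrow> 'm distribution \<Rightarrow> bool" where
  "contact_structure A \<xi> \<longleftrightarrow> plane_distribution A \<xi> \<and>
     (\<forall>U S T. open U \<and> local_section A \<xi> U S \<and> local_section A \<xi> U T \<and>
        (\<forall>p\<in>U. indep_pair (S p) (T p)) \<longrightarrow>
        (\<forall>p\<in>U. lie_bracket A S T p \<notin> \<xi> p))"

definition one_form :: "'m::topological_space chart set \<Rightarrow> ('m \<Rightarrow> 'm tvec \<Rightarrow> real) \<Rightarrow> bool" where
  "one_form A \<alpha> \<longleftrightarrow>
     (\<forall>p. \<forall>u\<in>tangent_space A p. \<forall>v\<in>tangent_space A p. \<forall>a b.
        \<alpha> p (a *\<^sub>R u + b *\<^sub>R v) = a * \<alpha> p u + b * \<alpha> p v) \<and>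
     (\<forall>U X. open U \<and> smooth_vfield A U X \<longrightarrow> smooth_fun A U (\<lambda>p. \<alpha> p (X p)))"

definition transversally_orientable :: "'m::topological_space chart set \<Rightarrow> 'm distribution \<Rightarrow> bool" where
  "transversally_orientable A \<xi> \<longleftrightarrow>
     (\<exists>\<alpha>. one_form A \<alpha> \<and> (\<forall>p. \<xi> p = {v \<in> tangent_space A p. \<alpha> p v = 0}))"


type_synonym 'm metric = "'m \<Rightarrow> 'm tvec \<Rightarrow> 'm tvec \<Rightarrow> real"

definition riemannian_metric :: "'m::topological_space chart set \<Rightarrow> 'm metric \<Rightarrow> bool" where
  "riemannian_metric A g \<longleftrightarrow>
     (\<forall>p. \<forall>u\<in>tangent_space A p. \<forall>v\<in>tangent_space A p. \<forall>w\<in>tangent_space A p. \<forall>a b.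
        g p u v = g p v u \<and> g p (a *\<^sub>R u + b *\<^sub>R v) w = a * g p u w + b * g p v w \<and>
        (u \<noteq> 0 \<longrightarrow> g p u u > 0)) \<and>
     (\<forall>U X Y. open U \<and> smooth_vfield A U X \<and> smooth_vfield A U Y \<longrightarrow>
        smooth_fun A U (\<lambda>p. g p (X p) (Y p)))"

text \<open>\<open>D X Y\<close> is the covariant derivative of \<open>Y\<close> along \<open>X\<close>. The axioms are required for local fields
  on every open set; linearity over functions makes \<open>D X Y p\<close> depend only on the germs of \<open>X\<close>
  and \<open>Y\<close> at \<open>p\<close>: apply it on a neighbourhood \<open>V\<close> of \<open>p\<close> with \<open>h\<close> the indicator of \<open>V\<close>.\<close>

type_synonym 'm connection = "'m vfield \<Rightarrow> 'm vfield \<Rightarrow> 'm vfield"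

definition affine_connection :: "'m::topological_space chart set \<Rightarrow> 'm connection \<Rightarrow> bool" where
  "affine_connection A D \<longleftrightarrow>
     (\<forall>U X Y Z h. open U \<and> smooth_vfield A U X \<and> smooth_vfield A U Y \<and> smooth_vfield A U Z \<and>
          smooth_fun A U h \<longrightarrow>
        smooth_vfield A U (D X Y) \<and>
        (\<forall>p\<in>U. D (X + Y) Z p = D X Z p + D Y Z p \<and>
           D (\<lambda>q. h q *\<^sub>R X q) Y p = h p *\<^sub>R D X Y p \<and>
           D X (Y + Z) p = D X Y p + D X Z p \<and>
           D X (\<lambda>q. h q *\<^sub>R Y q) p = X p h *\<^sub>R Y p + h p *\<^sub>R D X Y p))"

definition levi_civita :: "'m::topological_space chart set \<Rightarrow> 'm metric \<Rightarrow> 'm connection \<Rightarrow> bool" where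
  "levi_civita A g D \<longleftrightarrow> affine_connection A D \<and>
     (\<forall>U X Y Z. open U \<and> smooth_vfield A U X \<and> smooth_vfield A U Y \<and> smooth_vfield A U Z \<longrightarrow>
        (\<forall>p\<in>U. X p (\<lambda>q. g q (Y q) (Z q)) = g p (D X Y p) (Z p) + g p (Y p) (D X Z p) \<and>
           D X Y p - D Y X p = lie_bracket A X Y p))"

definition curvature :: "'m::topological_space chart set \<Rightarrow> 'm connection \<Rightarrow>
    'm vfield \<Rightarrow> 'm vfield \<Rightarrow> 'm vfield \<Rightarrow> 'm vfield" where
  "curvature A D X Y Z = D X (D Y Z) - D Y (D X Z) - D (lie_bracket A X Y) Z"

definition gram :: "'m metric \<Rightarrow> 'm \<Rightarrow> 'm tvec \<Rightarrow> 'm tvec \<Rightarrow> real" where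
  "gram g p u v = g p u u * g p v v - (g p u v)\<^sup>2"

text \<open>In the next definitions \<open>D\<close> is the Levi-Civita connection of \<open>g\<close>. The curvatures are the common
  value of an expression over all admissible choices of local fields.\<close>

definition sectional_curvature ::
  "'m::topological_space chart set \<Rightarrow> 'm metric \<Rightarrow> 'm connection \<Rightarrow> 'm \<Rightarrow> 'm tvec set \<Rightarrow> real" where
  "sectional_curvature A g D p \<sigma> = (THE k. \<exists>U X Y. open U \<and> p \<in> U \<and>
     smooth_vfield A U X \<and> smooth_vfield A U Y \<and>
     indep_pair (X p) (Y p) \<and> span {X p, Y p} = \<sigma> \<and>
     k = g p (curvature A D X Y Y p) (X p) / gram g p (X p) (Y p))"

definition unit_normal ::
  "'m::topological_space chart set \<Rightarrow> 'm metric \<Rightarrow> 'm distribution \<Rightarrow> 'm set \<Rightarrow> 'm vfield \<Rightarrow> bool" where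
  "unit_normal A g \<xi> U n \<longleftrightarrow> smooth_vfield A U n \<and>
     (\<forall>p\<in>U. g p (n p) (n p) = 1 \<and> (\<forall>v\<in>\<xi> p. g p v (n p) = 0))"

definition second_fundamental_form ::
  "'m metric \<Rightarrow> 'm connection \<Rightarrow> 'm vfield \<Rightarrow> 'm vfield \<Rightarrow> 'm vfield \<Rightarrow> 'm \<Rightarrow> real" where
  "second_fundamental_form g D n S T p = 1/2 * g p (D S T p + D T S p) (n p)"

definition extrinsic_curvature ::
  "'m::topological_space chart set \<Rightarrow> 'm metric \<Rightarrow> 'm connection \<Rightarrow> 'm distribution \<Rightarrow> 'm \<Rightarrow> real" where
  "extrinsic_curvature A g D \<xi> p = (THE k. \<exists>U S T n. open U \<and> p \<in> U \<and>
     local_section A \<xi> U S \<and> local_section A \<xi> U T \<and> (\<forall>q\<in>U. indep_pair (S q) (T q)) \<and>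
     unit_normal A g \<xi> U n \<and>
     k = (let B = second_fundamental_form g D n
          in (B S S p * B T T p - (B S T p)\<^sup>2) / gram g p (S p) (T p)))"

definition gaussian_curvature ::
  "'m::topological_space chart set \<Rightarrow> 'm metric \<Rightarrow> 'm connection \<Rightarrow> 'm distribution \<Rightarrow> 'm \<Rightarrow> real" where
  "gaussian_curvature A g D \<xi> p =
     sectional_curvature A g D p (\<xi> p) + extrinsic_curvature A g D \<xi> p"

end

theory Submission
  imports Defs
begin

text \<open>Fix a background metric on \<open>\<xi> = ker \<alpha>\<close>, a vector field \<open>R\<close> with \<open>\<alpha>(R) = 1\<close>, a constant \<open>\<mu> > 0\<close>
  and a function \<open>h > 0\<close>, and consider the metric that scales lengths on \<open>\<xi>\<close> by \<open>\<mu>\<close>, makes \<open>R\<close>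
  orthogonal to \<open>\<xi>\<close> and gives it length \<open>h\<close>. In an orthonormal frame \<open>S, T\<close> of \<open>\<xi>\<close> for \<open>\<mu> = 1\<close>,
  with unit normal \<open>n = R/h\<close>, the second fundamental form cancels from the sum of the sectional and the
  extrinsic curvature except for its antisymmetric part, which is a component of \<open>[S,T]\<close>. What remains is
  \<open>K\<^sub>G = F / \<mu>\<^sup>2 - 3/4 h\<^sup>2 C / \<mu>\<^sup>4\<close>, where \<open>F\<close> and \<open>C = \<alpha>([S,T])\<^sup>2\<close> depend neither on \<open>\<mu>\<close> nor
  on \<open>h\<close>, and \<open>C > 0\<close> since \<open>\<xi>\<close> is contact. By compactness \<open>F / \<mu>\<^sup>2 > f\<close> for large \<open>\<mu>\<close>, and then
  the equation \<open>K\<^sub>G = f\<close> can be solved for \<open>h\<close>.\<close>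

section \<open>Calculus of smooth maps\<close>

text \<open>Prescribing a curvature is in general a differential equation for the metric; here it is
  an algebraic one. The normal part of \<open>[S,T]\<close> is proportional to \<open>h\<close>, the
  in-plane parts of the brackets of \<open>R/h\<close> with \<open>S\<close> and \<open>T\<close>
  are proportional to \<open>1/h\<close>, and only products of the two occur besides the square of
  the former. Negativity of \<open>f\<close> enters through the choice of \<mu>: nothing is known
  about the sign of \<open>F\<close>, but \<open>F / \<mu>\<^sup>2\<close> tends to 0 uniformly
  while \<open>f\<close> stays below a negative constant. The main cost lies in the definitions.
  Sectional and extrinsic curvature are \<open>THE\<close> values over all admissible local fields,
  so a computation in one frame counts only after all other choices are shown to give the same
  number. For this the curvature has to be tensorial, and the connection is known only through its
  axioms on local fields.\<close>

lemma times_diff_cong: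
  assumes "open S" "\<And>x. x \<in> S \<Longrightarrow> f x = g x"
  shows "times_diff k S f \<longleftrightarrow> times_diff k S g"
  using assms
proof (induction k arbitrary: f g)
  case 0
  then show ?case by (auto intro: continuous_on_cong)
next
  case (Suc k)
  have D: "(f has_derivative D) (at x) \<longleftrightarrow> (g has_derivative D) (at x)" if "x \<in> S" for x D
    using has_derivative_transform_within_open[OF _ \<open>open S\<close> that, of f D UNIV g, OF _ Suc.prems(2)]
      has_derivative_transform_within_open[OF _ \<open>open S\<close> that, of g D UNIV f, OF _ Suc.prems(2)[symmetric]]
    by iprover
  have d: "f differentiable (at x) \<longleftrightarrow> g differentiable (at x)" if "x \<in> S" for x
    using D[OF that] by (simp add: differentiable_def)
  have e: "frechet_derivative f (at x) = frechet_derivative g (at x)" if "x \<in> S" for x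
    using D[OF that] by (simp add: frechet_derivative_def)
  have "times_diff k S (\<lambda>x. frechet_derivative f (at x) v) \<longleftrightarrow> times_diff k S (\<lambda>x. frechet_derivative g (at x) v)" for v
    by (rule Suc.IH[OF \<open>open S\<close>]) (simp add: e)
  then show ?case unfolding times_diff.simps using d by blast
qed

lemma times_diff_subset:
  "times_diff k S f \<Longrightarrow> T \<subseteq> S \<Longrightarrow> times_diff k T f"
proof (induction k arbitrary: f)
  case 0
  then show ?case by (simp add: continuous_on_subset)
next
  case (Suc k)
  have "times_diff k T (\<lambda>x. frechet_derivative f (at x) v)" for v
    using Suc by simp
  then show ?case using Suc.prems by auto
qed

lemma times_diff_SucD: "times_diff (Suc k) S f \<Longrightarrow> times_diff k S f"
proof (induction k arbitrary: f)
  case 0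
  then have "continuous_on S f"
    unfolding times_diff.simps(2) by (blast intro: continuous_at_imp_continuous_on differentiable_imp_continuous_within)
  then show ?case by simp
next
  case (Suc k)
  have *: "(\<forall>x\<in>S. f differentiable (at x)) \<and> (\<forall>v. times_diff (Suc k) S (\<lambda>x. frechet_derivative f (at x) v))"
    using Suc.prems unfolding times_diff.simps(2)[of "Suc k"] .
  have "times_diff k S (\<lambda>x. frechet_derivative f (at x) v)" for v
    by (rule Suc.IH) (use * in blast)
  with * show ?case unfolding times_diff.simps(2)[of k] by blast
qed

lemma times_diff_local:
  assumes "\<And>x. x \<in> S \<Longrightarrow> \<exists>T. open T \<and> x \<in> T \<and> times_diff k T f"
  shows "times_diff k S f"
  using assms
proof (induction k arbitrary: f)
  case 0
  have "continuous (at x) f" if x: "x \<in> S" for x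
    using 0[OF x] by (auto simp: continuous_on_eq_continuous_at)
  then show ?case by (auto simp: continuous_at_imp_continuous_on)
next
  case (Suc k)
  have "f differentiable (at x)" if "x \<in> S" for x
    using Suc.prems[OF that] by auto
  moreover have "times_diff k S (\<lambda>x. frechet_derivative f (at x) v)" for v
  proof (rule Suc.IH)
    fix x assume "x \<in> S"
    from Suc.prems[OF this] show "\<exists>T. open T \<and> x \<in> T \<and> times_diff k T (\<lambda>x. frechet_derivative f (at x) v)"
      by auto
  qed
  ultimately show ?case by simp
qed

lemma frechet_derivative_eqI: "(f has_derivative f') (at x) \<Longrightarrow> frechet_derivative f (at x) = f'"
  by (metis frechet_derivative_at)

lemma has_frechet_derivative:
  "f differentiable (at x) \<Longrightarrow> (f has_derivative frechet_derivative f (at x)) (at x)"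
  by (simp add: frechet_derivative_works)

text \<open>Uniqueness of the derivative lets an explicit formula replace the choice operator behind
  \<open>frechet_derivative\<close>. The later inductions on \<open>k\<close> rest on this
  form.\<close>

lemma times_diff_SucI:
  assumes "open S" "\<And>x. x \<in> S \<Longrightarrow> (f has_derivative f' x) (at x)"
    and "\<And>v. times_diff k S (\<lambda>x. f' x v)"
  shows "times_diff (Suc k) S f"
proof -
  have "times_diff k S (\<lambda>x. frechet_derivative f (at x) v)" for v
    using assms(3)[of v] times_diff_cong[OF assms(1), of "\<lambda>x. frechet_derivative f (at x) v" "\<lambda>x. f' x v"]
    by (simp add: frechet_derivative_eqI[OF assms(2)])
  then show ?thesis using assms(2) by (auto simp: differentiable_def)
qed

lemma times_diff_const: "open S \<Longrightarrow> times_diff k S (\<lambda>x. c)"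
proof (induction k arbitrary: c)
  case (Suc k)
  show ?case by (rule times_diff_SucI[where f'="\<lambda>x v. 0", OF Suc.prems has_derivative_const Suc.IH[OF Suc.prems]])
qed simp

lemma times_diff_add:
  assumes "open S"
  shows "times_diff k S f \<Longrightarrow> times_diff k S g \<Longrightarrow> times_diff k S (\<lambda>x. f x + g x)"
proof (induction k arbitrary: f g)
  case 0
  then show ?case by (simp add: continuous_on_add)
next
  case (Suc k)
  note p = Suc.prems[unfolded times_diff.simps(2)]
  show ?case
  proof (rule times_diff_SucI[OF \<open>open S\<close>, where f'="\<lambda>x v. frechet_derivative f (at x) v + frechet_derivative g (at x) v"])
    fix x assume "x \<in> S"
    with p show "((\<lambda>x. f x + g x) has_derivative (\<lambda>v. frechet_derivative f (at x) v + frechet_derivative g (at x) v)) (at x)"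
      by (intro has_derivative_add has_frechet_derivative) blast+
  next
    fix v show "times_diff k S (\<lambda>x. frechet_derivative f (at x) v + frechet_derivative g (at x) v)"
      by (rule Suc.IH) (use p in blast)+
  qed
qed

lemma times_diff_linear:
  assumes "open S" "bounded_linear L"
  shows "times_diff k S f \<Longrightarrow> times_diff k S (\<lambda>x. L (f x))"
proof (induction k arbitrary: f)
  case 0
  then show ?case using bounded_linear.continuous_on[OF assms(2)] by simp
next
  case (Suc k)
  note p = Suc.prems[unfolded times_diff.simps(2)]
  show ?case
  proof (rule times_diff_SucI[OF \<open>open S\<close>, where f'="\<lambda>x v. L (frechet_derivative f (at x) v)"])
    fix x assume "x \<in> S"
    with p show "((\<lambda>x. L (f x)) has_derivative (\<lambda>v. L (frechet_derivative f (at x) v))) (at x)"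
      by (intro bounded_linear.has_derivative[OF assms(2)] has_frechet_derivative) blast
  next
    fix v show "times_diff k S (\<lambda>x. L (frechet_derivative f (at x) v))"
      by (rule Suc.IH) (use p in blast)
  qed
qed

text \<open>By the product rule each summand of the derivative has one factor differentiated and the
  other left alone. The induction hypothesis must therefore apply to the undifferentiated factors
  too, which is the purpose of \<open>times_diff_SucD\<close>.\<close>

lemma times_diff_bilinear:
  assumes L: "bounded_bilinear L" and "open S"
  shows "times_diff k S f \<Longrightarrow> times_diff k S g \<Longrightarrow> times_diff k S (\<lambda>x. L (f x) (g x))"
proof (induction k arbitrary: f g)
  case 0
  then show ?case by (auto intro: bounded_bilinear.continuous_on[OF L])
next
  case (Suc k)
  note fg = times_diff_SucD[OF Suc.prems(1)] times_diff_SucD[OF Suc.prems(2)]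
  show ?case
  proof (intro times_diff_SucI[where f'="\<lambda>x v. L (f x) (frechet_derivative g (at x) v) + L (frechet_derivative f (at x) v) (g x)"])
    fix x assume "x \<in> S"
    then show "((\<lambda>x. L (f x) (g x)) has_derivative
        (\<lambda>v. L (f x) (frechet_derivative g (at x) v) + L (frechet_derivative f (at x) v) (g x))) (at x)"
      using Suc.prems by (intro bounded_bilinear.FDERIV[OF L] has_frechet_derivative) auto
  next
    fix v
    show "times_diff k S (\<lambda>x. L (f x) (frechet_derivative g (at x) v) + L (frechet_derivative f (at x) v) (g x))"
      using Suc.prems fg by (intro times_diff_add Suc.IH \<open>open S\<close>) auto
  qed (rule \<open>open S\<close>)
qed

lemmas times_diff_scaleR = times_diff_bilinear[OF bounded_bilinear_scaleR]
lemmas times_diff_mult = times_diff_bilinear[OF bounded_bilinear_mult]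

lemma times_diff_sum:
  assumes "open S" "\<And>i. i \<in> I \<Longrightarrow> times_diff k S (f i)"
  shows "times_diff k S (\<lambda>x. \<Sum>i\<in>I. f i x)"
  using assms(2)
proof (induction I rule: infinite_finite_induct)
  case (insert i I)
  then show ?case by (simp add: times_diff_add \<open>open S\<close>)
qed (simp_all add: times_diff_const \<open>open S\<close>)

text \<open>The derivatives in \<open>times_diff\<close> are taken in fixed directions, whereas the
  chain rule differentiates \<open>g\<close> in the direction
  \<open>frechet_derivative f (at x) v\<close>, which moves with \<open>x\<close>. Expanding that
  direction in the basis of the middle space leaves derivatives of \<open>g\<close> along constant
  vectors, with smooth coefficients; this is where \<open>'b\<close> has to be Euclidean.\<close>

lemma times_diff_compose:
  fixes f :: "'a::real_normed_vector \<Rightarrow> 'b::euclidean_space" and g :: "'b \<Rightarrow> 'c::real_normed_vector"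
  assumes "open S" "open T" "f ` S \<subseteq> T"
  shows "times_diff k S f \<Longrightarrow> times_diff k T g \<Longrightarrow> times_diff k S (\<lambda>x. g (f x))"
proof (induction k arbitrary: g)
  case 0
  then show ?case using assms(3) by (auto intro: continuous_on_compose2)
next
  case (Suc k)
  let ?f' = "\<lambda>x v. frechet_derivative g (at (f x)) (frechet_derivative f (at x) v)"
  show ?case
  proof (intro times_diff_SucI[where f'="?f'"])
    fix x assume "x \<in> S"
    then show "((\<lambda>x. g (f x)) has_derivative ?f' x) (at x)"
      using Suc.prems assms(3)
      by (intro has_derivative_compose[of f _ x UNIV g] has_frechet_derivative) auto
  next
    fix v
    have "?f' x v = (\<Sum>i\<in>Basis. (frechet_derivative f (at x) v \<bullet> i) *\<^sub>R frechet_derivative g (at (f x)) i)"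
      if "x \<in> S" for x
    proof -
      have "linear (frechet_derivative g (at (f x)))"
        using Suc.prems(2) assms(3) that by (intro linear_frechet_derivative) auto
      then show ?thesis
        by (subst euclidean_representation[symmetric, of "frechet_derivative f (at x) v"])
          (simp only: linear_sum linear_scale o_def)
    qed
    moreover have "times_diff k S (\<lambda>x. \<Sum>i\<in>Basis. (frechet_derivative f (at x) v \<bullet> i) *\<^sub>R frechet_derivative g (at (f x)) i)"
      using Suc.prems
      by (intro times_diff_sum times_diff_scaleR times_diff_linear[where L="\<lambda>x. x \<bullet> i" for i] Suc.IH
            times_diff_SucD[of k S f] \<open>open S\<close> bounded_linear_inner_left) auto
    ultimately show "times_diff k S (\<lambda>x. ?f' x v)"
      by (subst times_diff_cong[OF \<open>open S\<close>]) auto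
  qed (rule \<open>open S\<close>)
qed

text \<open>The derivative contains \<open>inverse (f x)\<close> twice and otherwise only a
  derivative of \<open>f\<close>, so the induction feeds on itself.\<close>

lemma times_diff_inverse:
  fixes f :: "'a::real_normed_vector \<Rightarrow> real"
  assumes "open S" "\<And>x. x \<in> S \<Longrightarrow> f x \<noteq> 0"
  shows "times_diff k S f \<Longrightarrow> times_diff k S (\<lambda>x. inverse (f x))"
proof (induction k)
  case 0
  then show ?case using assms by (auto intro!: continuous_intros)
next
  case (Suc k)
  note f = times_diff_SucD[OF Suc.prems]
  show ?case
  proof (intro times_diff_SucI[where f'="\<lambda>x v. - 1 * (inverse (f x) * (frechet_derivative f (at x) v * inverse (f x)))"])
    fix x assume "x \<in> S"
    then show "((\<lambda>x. inverse (f x)) has_derivative (\<lambda>v. - 1 * (inverse (f x) * (frechet_derivative f (at x) v * inverse (f x))))) (at x)"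
      using Suc.prems assms(2)
      by (auto intro!: derivative_eq_intros has_frechet_derivative simp: mult_ac)
  next
    fix v
    show "times_diff k S (\<lambda>x. - 1 * (inverse (f x) * (frechet_derivative f (at x) v * inverse (f x))))"
      using Suc.prems f by (intro times_diff_mult times_diff_const Suc.IH \<open>open S\<close>) auto
  qed (rule \<open>open S\<close>)
qed

text \<open>The derivative is again expressed through \<open>sqrt (f x)\<close>, namely through its
  inverse, so the induction closes with \<open>times_diff_inverse\<close>. Positivity of
  \<open>f\<close> keeps the root away from its singularity.\<close>

lemma times_diff_sqrt:
  fixes f :: "'a::real_normed_vector \<Rightarrow> real"
  assumes "open S" "\<And>x. x \<in> S \<Longrightarrow> f x > 0"
  shows "times_diff k S f \<Longrightarrow> times_diff k S (\<lambda>x. sqrt (f x))"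
proof (induction k)
  case 0
  then show ?case by (auto intro!: continuous_intros)
next
  case (Suc k)
  note f = times_diff_SucD[OF Suc.prems]
  show ?case
  proof (intro times_diff_SucI[where f'="\<lambda>x v. (1/2) * (frechet_derivative f (at x) v * inverse (sqrt (f x)))"])
    fix x assume x: "x \<in> S"
    have "(f has_derivative frechet_derivative f (at x)) (at x)"
      using Suc.prems x by (auto intro: has_frechet_derivative)
    from has_derivative_real_sqrt[OF assms(2)[OF x] this]
    show "((\<lambda>x. sqrt (f x)) has_derivative (\<lambda>v. (1/2) * (frechet_derivative f (at x) v * inverse (sqrt (f x))))) (at x)"
      by (simp add: field_simps)
  next
    fix v
    show "times_diff k S (\<lambda>x. (1/2) * (frechet_derivative f (at x) v * inverse (sqrt (f x))))"
      using Suc.prems f assms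
      by (intro times_diff_mult times_diff_const times_diff_inverse Suc.IH \<open>open S\<close>) (auto dest!: assms(2))
  qed (rule \<open>open S\<close>)
qed

lemma smooth_on_cong:
  "open S \<Longrightarrow> (\<And>x. x \<in> S \<Longrightarrow> f x = g x) \<Longrightarrow> smooth_on S f \<longleftrightarrow> smooth_on S g"
  unfolding smooth_on_def using times_diff_cong[of S f g] by auto

lemma smooth_on_subset: "smooth_on S f \<Longrightarrow> T \<subseteq> S \<Longrightarrow> smooth_on T f"
  unfolding smooth_on_def using times_diff_subset[of _ S f T] by auto

lemma smooth_on_local:
  assumes "\<And>x. x \<in> S \<Longrightarrow> \<exists>T. open T \<and> x \<in> T \<and> smooth_on T f"
  shows "smooth_on S f"
  unfolding smooth_on_def
proof
  fix k show "times_diff k S f"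
    by (rule times_diff_local) (use assms in \<open>auto simp: smooth_on_def\<close>)
qed

lemma smooth_on_const: "open S \<Longrightarrow> smooth_on S (\<lambda>x. c)"
  by (simp add: smooth_on_def times_diff_const)

lemma smooth_on_add: "open S \<Longrightarrow> smooth_on S f \<Longrightarrow> smooth_on S g \<Longrightarrow> smooth_on S (\<lambda>x. f x + g x)"
  by (simp add: smooth_on_def times_diff_add)

lemma smooth_on_mult:
  fixes f g :: "'a::real_normed_vector \<Rightarrow> real"
  shows "open S \<Longrightarrow> smooth_on S f \<Longrightarrow> smooth_on S g \<Longrightarrow> smooth_on S (\<lambda>x. f x * g x)"
  by (simp add: smooth_on_def times_diff_mult)

lemma smooth_on_linear:
  "open S \<Longrightarrow> bounded_linear L \<Longrightarrow> smooth_on S f \<Longrightarrow> smooth_on S (\<lambda>x. L (f x))"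
  by (simp add: smooth_on_def times_diff_linear)

lemma smooth_on_compose:
  fixes f :: "'a::real_normed_vector \<Rightarrow> 'b::euclidean_space"
  shows "open S \<Longrightarrow> open T \<Longrightarrow> f ` S \<subseteq> T \<Longrightarrow> smooth_on S f \<Longrightarrow> smooth_on T g \<Longrightarrow> smooth_on S (\<lambda>x. g (f x))"
  unfolding smooth_on_def by (simp add: times_diff_compose)

lemma smooth_on_inverse:
  fixes f :: "'a::real_normed_vector \<Rightarrow> real"
  shows "open S \<Longrightarrow> (\<And>x. x \<in> S \<Longrightarrow> f x \<noteq> 0) \<Longrightarrow> smooth_on S f \<Longrightarrow> smooth_on S (\<lambda>x. inverse (f x))"
  by (simp add: smooth_on_def times_diff_inverse)

lemma smooth_on_sqrt:
  fixes f :: "'a::real_normed_vector \<Rightarrow> real"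
  shows "open S \<Longrightarrow> (\<And>x. x \<in> S \<Longrightarrow> f x > 0) \<Longrightarrow> smooth_on S f \<Longrightarrow> smooth_on S (\<lambda>x. sqrt (f x))"
  by (simp add: smooth_on_def times_diff_sqrt)

lemma smooth_on_id: "open S \<Longrightarrow> smooth_on S (\<lambda>x. x)"
  unfolding smooth_on_def
proof
  fix k assume S: "open S"
  show "times_diff k S (\<lambda>x. x)"
  proof (cases k)
    case (Suc j)
    show ?thesis unfolding Suc
      by (intro times_diff_SucI[where f'="\<lambda>x v. v"] times_diff_const S) auto
  qed auto
qed

lemma smooth_on_differentiable: "smooth_on S f \<Longrightarrow> x \<in> S \<Longrightarrow> f differentiable (at x)"
  using times_diff.simps(2)[of 0 S f] unfolding smooth_on_def by blast

lemma smooth_on_continuous_on: "smooth_on S f \<Longrightarrow> continuous_on S f"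
  using times_diff.simps(1)[of S f] unfolding smooth_on_def by blast

lemma smooth_on_frechet_derivative:
  "smooth_on S f \<Longrightarrow> smooth_on S (\<lambda>x. frechet_derivative f (at x) v)"
  using times_diff.simps(2)[of _ S f] unfolding smooth_on_def by blast

section \<open>A smooth function vanishing on the negative half line\<close>

definition flat_exp :: "nat \<Rightarrow> real \<Rightarrow> real" where
  "flat_exp n t = (if t > 0 then inverse t ^ n * exp (- inverse t) else 0)"

text \<open>The substitution s = 1/t turns the right-hand limit into the decay of s^n / exp s at
  infinity; on the left the function is 0.\<close>

lemma flat_exp_limit: "(flat_exp n \<longlongrightarrow> 0) (at 0)"
proof -
  have "((\<lambda>s::real. s ^ n / exp s) \<longlongrightarrow> 0) at_top"
    by (rule tendsto_power_div_exp_0)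
  then have "((\<lambda>t::real. inverse t ^ n / exp (inverse t)) \<longlongrightarrow> 0) (at_right 0)"
    by (rule filterlim_compose[OF _ filterlim_inverse_at_top_right])
  moreover have "\<forall>\<^sub>F t in at_right 0. inverse t ^ n / exp (inverse t) = flat_exp n t"
    by (auto simp: eventually_at_filter flat_exp_def exp_minus field_simps)
  ultimately have "(flat_exp n \<longlongrightarrow> 0) (at_right 0)"
    by (rule Lim_transform_eventually)
  moreover have "(flat_exp n \<longlongrightarrow> 0) (at_left 0)"
    by (rule tendsto_eventually) (auto simp: eventually_at_filter flat_exp_def)
  ultimately show ?thesis by (simp add: filterlim_at_split)
qed

lemma flat_exp_deriv:
  "(flat_exp n has_real_derivative (flat_exp (n+2) t - real n * flat_exp (n+1) t)) (at t)"
proof (cases t "0::real" rule: linorder_cases)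
  case less
  have "((\<lambda>t. 0) has_real_derivative 0) (at t)" by simp
  then have "(flat_exp n has_real_derivative 0) (at t)"
    by (rule has_field_derivative_transform_within_open[where S="{..<0}"]) (use less in \<open>auto simp: flat_exp_def\<close>)
  then show ?thesis using less by (simp add: flat_exp_def)
next
  case equal
  \<comment> \<open>For \<open>h \<noteq> 0\<close> the difference quotient at 0 is
    \<open>flat_exp (Suc n) h\<close>.\<close>
  have "((\<lambda>h. (flat_exp n (0 + h) - flat_exp n 0) / h) \<longlongrightarrow> 0) (at 0)"
    by (rule Lim_transform_eventually[OF flat_exp_limit[of "Suc n"]])
      (auto simp: eventually_at_filter flat_exp_def field_simps)
  then show ?thesis using equal unfolding DERIV_def by (simp add: flat_exp_def)
next
  case greater
  have "((\<lambda>t. inverse t ^ n * exp (- inverse t)) has_real_derivative (flat_exp (n+2) t - real n * flat_exp (n+1) t)) (at t)"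
    using greater
    by (auto intro!: derivative_eq_intros simp: flat_exp_def power2_eq_square)
      (cases n; auto simp: field_simps power2_eq_square)
  then show ?thesis
    by (rule has_field_derivative_transform_within_open[where S="{0<..}"]) (use greater in \<open>auto simp: flat_exp_def\<close>)
qed

text \<open>Differentiation raises the index by 1 or 2 and stays in the linear span of the family.
  The cutoff functions use index 0 only; the other indices are there so that the induction on
  \<open>k\<close> can run over all \<open>n\<close> at once.\<close>

lemma smooth_flat_exp: "smooth_on UNIV (flat_exp n)"
  unfolding smooth_on_def
proof
  fix k show "times_diff k UNIV (flat_exp n)"
  proof (induction k arbitrary: n)
    case 0
    then show ?case
      using DERIV_isCont[OF flat_exp_deriv] by (simp add: continuous_on_eq_continuous_at)
  next
    case (Suc k)
    show ?case
    proof (rule times_diff_SucI[where f'="\<lambda>t v. (flat_exp (n+2) t + (- real n) * flat_exp (n+1) t) * v"])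
      show "(flat_exp n has_derivative (\<lambda>v. (flat_exp (n+2) t + (- real n) * flat_exp (n+1) t) * v)) (at t)" for t
        using flat_exp_deriv[of n t] by (simp add: has_field_derivative_def)
      show "times_diff k UNIV (\<lambda>t. (flat_exp (n+2) t + (- real n) * flat_exp (n+1) t) * v)" for v
        by (intro times_diff_mult times_diff_add times_diff_const Suc open_UNIV)
    qed simp
  qed
qed

section \<open>Symmetry of mixed second derivatives\<close>

lemma DERIV_along_line:
  assumes "f differentiable (at (y + s *\<^sub>R u))"
  shows "((\<lambda>s. f (y + s *\<^sub>R u)) has_real_derivative frechet_derivative f (at (y + s *\<^sub>R u)) u) (at s)"
proof -
  have "((\<lambda>s. f (y + s *\<^sub>R u)) has_derivative (\<lambda>h. frechet_derivative f (at (y + s *\<^sub>R u)) (h *\<^sub>R u))) (at s)"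
    by (rule has_derivative_compose[where f="\<lambda>s. y + s *\<^sub>R u" and x=s and s=UNIV, OF _ has_frechet_derivative[OF assms]])
       (auto intro!: derivative_eq_intros)
  moreover have "frechet_derivative f (at (y + s *\<^sub>R u)) (h *\<^sub>R u) = frechet_derivative f (at (y + s *\<^sub>R u)) u * h" for h
    using linear_scale[OF linear_frechet_derivative[OF assms], of h u] by simp
  ultimately show ?thesis by (simp add: has_field_derivative_def)
qed

text \<open>The mean value theorem is applied twice: along \<open>u\<close> to the increment of
  \<open>f\<close> in direction \<open>r *\<^sub>R v\<close>, then along \<open>v\<close> to the
  derivative of \<open>f\<close> in direction \<open>u\<close>. The second difference is symmetric
  in \<open>u\<close> and \<open>v\<close>, the right-hand side is not, and this is what makes the
  identity useful.\<close>

lemma second_difference_eq: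
  fixes f :: "'a::real_normed_vector \<Rightarrow> real"
  assumes f: "smooth_on S f" and ball: "ball x d \<subseteq> S" and r: "r > 0" "r * (norm u + norm v) < d"
  shows "\<exists>y\<in>ball x d. norm (y - x) \<le> r * (norm u + norm v) \<and>
    f (x + r *\<^sub>R u + r *\<^sub>R v) - f (x + r *\<^sub>R u) - f (x + r *\<^sub>R v) + f x
      = r * (r * frechet_derivative (\<lambda>y. frechet_derivative f (at y) u) (at y) v)"
proof -
  let ?D = "\<lambda>y. frechet_derivative f (at y) u"
  have nrm: "norm (s *\<^sub>R u + t *\<^sub>R v) \<le> r * (norm u + norm v)" if "0 \<le> s" "s \<le> r" "0 \<le> t" "t \<le> r" for s t
  proof -
    have "norm (s *\<^sub>R u + t *\<^sub>R v) \<le> s * norm u + t * norm v"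
      using that norm_triangle_ineq[of "s *\<^sub>R u" "t *\<^sub>R v"] by simp
    also have "\<dots> \<le> r * norm u + r * norm v"
      using that by (intro add_mono mult_right_mono) auto
    finally show ?thesis by (simp add: algebra_simps)
  qed
  have inb: "x + s *\<^sub>R u + t *\<^sub>R v \<in> ball x d" if "0 \<le> s" "s \<le> r" "0 \<le> t" "t \<le> r" for s t
  proof -
    have "dist x (x + s *\<^sub>R u + t *\<^sub>R v) = norm (s *\<^sub>R u + t *\<^sub>R v)"
      by (metis add.assoc add_diff_cancel_left' dist_commute dist_norm)
    then show ?thesis using nrm[OF that] r(2) by simp
  qed
  have d1: "f differentiable (at y)" if "y \<in> ball x d" for y
    using smooth_on_differentiable[OF f] ball that by blast
  have d2: "?D differentiable (at y)" if "y \<in> ball x d" for y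
    using smooth_on_differentiable[OF smooth_on_frechet_derivative[OF f]] ball that by blast
  have "\<exists>s>0. s < r \<and> (f (x + r *\<^sub>R v + r *\<^sub>R u) - f (x + r *\<^sub>R u)) - (f (x + r *\<^sub>R v + 0 *\<^sub>R u) - f (x + 0 *\<^sub>R u))
      = (r - 0) * (?D (x + r *\<^sub>R v + s *\<^sub>R u) - ?D (x + s *\<^sub>R u))"
  proof (rule MVT2[of 0 r "\<lambda>s. f (x + r *\<^sub>R v + s *\<^sub>R u) - f (x + s *\<^sub>R u)"
        "\<lambda>s. ?D (x + r *\<^sub>R v + s *\<^sub>R u) - ?D (x + s *\<^sub>R u)", OF r(1)])
    fix s assume s: "0 \<le> s" "s \<le> r"
    have "x + r *\<^sub>R v + s *\<^sub>R u \<in> ball x d" "x + s *\<^sub>R u \<in> ball x d"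
      using inb[OF s, of r] inb[OF s, of 0] r(1) by (auto simp: add_ac)
    then show "((\<lambda>s. f (x + r *\<^sub>R v + s *\<^sub>R u) - f (x + s *\<^sub>R u)) has_real_derivative
        ?D (x + r *\<^sub>R v + s *\<^sub>R u) - ?D (x + s *\<^sub>R u)) (at s)"
      by (intro DERIV_diff DERIV_along_line d1)
  qed
  then obtain s where s: "0 < s" "s < r" "f (x + r *\<^sub>R v + r *\<^sub>R u) - f (x + r *\<^sub>R u) - (f (x + r *\<^sub>R v) - f x)
      = r * (?D (x + r *\<^sub>R v + s *\<^sub>R u) - ?D (x + s *\<^sub>R u))"
    by auto
  have "\<exists>t>0. t < r \<and> ?D (x + s *\<^sub>R u + r *\<^sub>R v) - ?D (x + s *\<^sub>R u + 0 *\<^sub>R v)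
      = (r - 0) * frechet_derivative ?D (at (x + s *\<^sub>R u + t *\<^sub>R v)) v"
  proof (rule MVT2[of 0 r "\<lambda>t. ?D (x + s *\<^sub>R u + t *\<^sub>R v)"
        "\<lambda>t. frechet_derivative ?D (at (x + s *\<^sub>R u + t *\<^sub>R v)) v", OF r(1)])
    fix t assume "0 \<le> t" "t \<le> r"
    then have "x + s *\<^sub>R u + t *\<^sub>R v \<in> ball x d" using inb[of s t] s(1,2) by simp
    then show "((\<lambda>t. ?D (x + s *\<^sub>R u + t *\<^sub>R v)) has_real_derivative
        frechet_derivative ?D (at (x + s *\<^sub>R u + t *\<^sub>R v)) v) (at t)"
      by (intro DERIV_along_line d2)
  qed
  then obtain t where t: "0 < t" "t < r" "?D (x + s *\<^sub>R u + r *\<^sub>R v) - ?D (x + s *\<^sub>R u)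
      = r * frechet_derivative ?D (at (x + s *\<^sub>R u + t *\<^sub>R v)) v"
    by auto
  have "norm (x + s *\<^sub>R u + t *\<^sub>R v - x) \<le> r * (norm u + norm v)"
    using nrm[of s t] s t by (simp add: add.assoc)
  moreover have "f (x + r *\<^sub>R u + r *\<^sub>R v) - f (x + r *\<^sub>R u) - f (x + r *\<^sub>R v) + f x
      = r * (r * frechet_derivative ?D (at (x + s *\<^sub>R u + t *\<^sub>R v)) v)"
    using s(3) t(3) by (simp add: add_ac diff_diff_eq)
  ultimately show ?thesis using inb[of s t] s t by (intro bexI[of _ "x + s *\<^sub>R u + t *\<^sub>R v"]) auto
qed

text \<open>Divided by \<open>r * r\<close>, one and the same second difference is a value of each
  of the two mixed derivatives, at points whose distance from \<open>x\<close> shrinks with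
  \<open>r\<close>. Continuity of both at \<open>x\<close> gives equality.\<close>

lemma symmetric_second_derivative:
  fixes f :: "'a::real_normed_vector \<Rightarrow> real"
  assumes f: "smooth_on S f" and S: "open S" "x \<in> S"
  shows "frechet_derivative (\<lambda>y. frechet_derivative f (at y) u) (at x) v =
         frechet_derivative (\<lambda>y. frechet_derivative f (at y) v) (at x) u"
proof -
  define G where "G = (\<lambda>y. frechet_derivative (\<lambda>y. frechet_derivative f (at y) u) (at y) v)"
  define H where "H = (\<lambda>y. frechet_derivative (\<lambda>y. frechet_derivative f (at y) v) (at y) u)"
  have "continuous_on S G" "continuous_on S H"
    unfolding G_def H_def by (intro smooth_on_continuous_on smooth_on_frechet_derivative f)+
  then have c: "isCont G x" "isCont H x" using S by (auto simp: continuous_on_eq_continuous_at)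
  have "dist (G x) (H x) < e" if e: "e > 0" for e
  proof -
    obtain d1 where d1: "d1 > 0" "\<And>y. dist y x < d1 \<Longrightarrow> dist (G y) (G x) < e/2"
      using c(1) e unfolding continuous_at_eps_delta dist_norm by (metis half_gt_zero)
    obtain d2 where d2: "d2 > 0" "\<And>y. dist y x < d2 \<Longrightarrow> dist (H y) (H x) < e/2"
      using c(2) e unfolding continuous_at_eps_delta dist_norm by (metis half_gt_zero)
    obtain d3 where d3: "d3 > 0" "ball x d3 \<subseteq> S" using S open_contains_ball by blast
    define d where "d = Min {d1, d2, d3}"
    have d: "d > 0" "d \<le> d1" "d \<le> d2" "d \<le> d3" using d1 d2 d3 by (auto simp: d_def)
    \<comment> \<open>The summand 1 keeps the denominator positive when \<open>u\<close> and
      \<open>v\<close> are both 0.\<close>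
    define r where "r = d / (2 * (norm u + norm v + 1))"
    have pos: "norm u + norm v + 1 > 0" by (simp add: add_nonneg_pos)
    have r: "r > 0" using d pos by (simp add: r_def)
    have "r * (norm u + norm v) < r * (norm u + norm v + 1) * 2" using r by (simp add: algebra_simps add_nonneg_pos)
    also have "\<dots> = d" using pos by (simp add: r_def field_simps)
    finally have rd: "r * (norm u + norm v) < d" .
    have rd': "r * (norm v + norm u) < d" using rd by (simp add: add.commute)
    have ball: "ball x d \<subseteq> S" using d d3 by (meson order_trans subset_ball)
    obtain y where y: "norm (y - x) \<le> r * (norm u + norm v)"
      "f (x + r *\<^sub>R u + r *\<^sub>R v) - f (x + r *\<^sub>R u) - f (x + r *\<^sub>R v) + f x = r * (r * G y)"
      using second_difference_eq[OF f ball r rd] unfolding G_def by blast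
    obtain z where z: "norm (z - x) \<le> r * (norm v + norm u)"
      "f (x + r *\<^sub>R v + r *\<^sub>R u) - f (x + r *\<^sub>R v) - f (x + r *\<^sub>R u) + f x = r * (r * H z)"
      using second_difference_eq[OF f ball r rd'] unfolding H_def by blast
    have "f (x + r *\<^sub>R v + r *\<^sub>R u) = f (x + r *\<^sub>R u + r *\<^sub>R v)" by (simp add: add_ac)
    then have "r * (r * G y) = r * (r * H z)" using y(2) z(2) by linarith
    then have "G y = H z" using r by simp
    moreover have "dist (G y) (G x) < e/2" using y rd d by (intro d1(2)) (simp add: dist_norm)
    moreover have "dist (H z) (H x) < e/2" using z rd' d by (intro d2(2)) (simp add: dist_norm)
    ultimately show ?thesis by (metis dist_triangle_half_l dist_commute)
  qed
  then have "G x = H x" by (metis dist_eq_0_iff less_irrefl zero_less_dist_iff)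
  then show ?thesis by (simp add: G_def H_def)
qed

section \<open>Smooth functions on a manifold\<close>

locale smooth_manifold =
  fixes A :: "'m::t2_space chart set"
  assumes atlas: "smooth_atlas A"
begin

lemma chart_covers: obtains U \<phi> where "(U, \<phi>) \<in> A" "p \<in> U"
proof -
  have "p \<in> (\<Union>c\<in>A. fst c)" using atlas by (simp add: smooth_atlas_def)
  then show ?thesis using that by fastforce
qed

context
  fixes U \<phi>
  assumes c: "(U, \<phi>) \<in> A"
begin

lemma chart_open: "open U" and chart_open_image: "open (\<phi> ` U)"
  using atlas c unfolding smooth_atlas_def is_chart_def by auto

text \<open>The chart axiom only provides some continuous inverse \<open>\<psi>\<close>. Injectivity
  forces it to agree on the image with \<open>inv_into U \<phi>\<close>, the inverse in which
  smoothness is phrased.\<close>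

lemma chart_inj: "inj_on \<phi> U" and chart_homeomorphism: "homeomorphism U (\<phi> ` U) \<phi> (inv_into U \<phi>)"
proof -
  obtain \<psi> where h: "homeomorphism U (\<phi> ` U) \<phi> \<psi>"
    using atlas c unfolding smooth_atlas_def is_chart_def by auto
  show inj: "inj_on \<phi> U"
    by (rule inj_on_inverseI[where g=\<psi>]) (rule homeomorphism_apply1[OF h])
  have "inv_into U \<phi> y = \<psi> y" if y: "y \<in> \<phi> ` U" for y
  proof -
    from y obtain x where "x \<in> U" "y = \<phi> x" by blast
    then show ?thesis using homeomorphism_apply1[OF h] inv_into_f_f[OF inj] by simp
  qed
  then show "homeomorphism U (\<phi> ` U) \<phi> (inv_into U \<phi>)"
    by (intro homeomorphism_cong[OF h]) simp_all
qed

lemma chart_inv: "p \<in> U \<Longrightarrow> inv_into U \<phi> (\<phi> p) = p"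
  by (rule inv_into_f_f[OF chart_inj])

lemma chart_image_open: "open W \<Longrightarrow> open (\<phi> ` (U \<inter> W))"
proof -
  assume "open W"
  then have "openin (top_of_set U) (U \<inter> W)" by auto
  then have "openin (top_of_set (\<phi> ` U)) (\<phi> ` (U \<inter> W))"
    using homeomorphism_imp_open_map[OF chart_homeomorphism] by blast
  then show ?thesis using chart_open_image openin_open_eq by blast
qed

lemma chart_image_open': "open W \<Longrightarrow> W \<subseteq> U \<Longrightarrow> open (\<phi> ` W)"
  using chart_image_open[of W] by (simp add: Int_absorb1)

end

lemma smooth_transition:
  "(U, \<phi>) \<in> A \<Longrightarrow> (V, \<psi>) \<in> A \<Longrightarrow> smooth_on (\<phi> ` (U \<inter> V)) (\<psi> \<circ> inv_into U \<phi>)"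
  using atlas unfolding smooth_atlas_def by fastforce

lemma smooth_funD: "smooth_fun A W h \<Longrightarrow> (U, \<phi>) \<in> A \<Longrightarrow> smooth_on (\<phi> ` (U \<inter> W)) (h \<circ> inv_into U \<phi>)"
  unfolding smooth_fun_def by auto

lemma smooth_funI: "(\<And>U \<phi>. (U, \<phi>) \<in> A \<Longrightarrow> smooth_on (\<phi> ` (U \<inter> W)) (h \<circ> inv_into U \<phi>)) \<Longrightarrow> smooth_fun A W h"
  unfolding smooth_fun_def by auto

lemma smooth_fun_subset: "smooth_fun A W h \<Longrightarrow> V \<subseteq> W \<Longrightarrow> smooth_fun A V h"
  by (rule smooth_funI, rule smooth_on_subset[OF smooth_funD]) auto

lemma smooth_fun_cong:
  assumes "open W" "\<And>p. p \<in> W \<Longrightarrow> h p = k p" "smooth_fun A W h"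
  shows "smooth_fun A W k"
proof (rule smooth_funI)
  fix U \<phi> assume c: "(U, \<phi>) \<in> A"
  show "smooth_on (\<phi> ` (U \<inter> W)) (k \<circ> inv_into U \<phi>)"
    using smooth_funD[OF assms(3) c]
    by (subst smooth_on_cong[OF chart_image_open[OF c assms(1)], of _ "h \<circ> inv_into U \<phi>"])
      (auto simp: assms(2) chart_inv[OF c])
qed

lemma smooth_fun_local:
  assumes "\<And>p. p \<in> W \<Longrightarrow> \<exists>V. open V \<and> p \<in> V \<and> smooth_fun A V h"
  shows "smooth_fun A W h"
proof (rule smooth_funI, rule smooth_on_local)
  fix U \<phi> x assume c: "(U, \<phi>) \<in> A" and "x \<in> \<phi> ` (U \<inter> W)"
  then obtain p where p: "p \<in> U" "p \<in> W" "x = \<phi> p" by auto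
  obtain V where V: "open V" "p \<in> V" "smooth_fun A V h" using assms[OF p(2)] by auto
  show "\<exists>T. open T \<and> x \<in> T \<and> smooth_on T (h \<circ> inv_into U \<phi>)"
    using chart_image_open[OF c V(1)] smooth_funD[OF V(3) c] p V by blast
qed

text \<open>Smoothness is demanded in every chart; composing with the transition map carries it over
  from a single one.\<close>

lemma smooth_fun_chartI:
  assumes c: "(U, \<phi>) \<in> A" and W: "open W" "W \<subseteq> U" and s: "smooth_on (\<phi> ` W) (h \<circ> inv_into U \<phi>)"
  shows "smooth_fun A W h"
proof (rule smooth_funI)
  fix V \<psi> assume d: "(V, \<psi>) \<in> A"
  have o: "open (\<psi> ` (V \<inter> W))" using chart_image_open[OF d W(1)] .
  have "smooth_on (\<psi> ` (V \<inter> W)) (\<lambda>x. (h \<circ> inv_into U \<phi>) ((\<phi> \<circ> inv_into V \<psi>) x))"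
  proof (rule smooth_on_compose[OF o chart_image_open'[OF c W] _ _ s])
    show "(\<phi> \<circ> inv_into V \<psi>) ` \<psi> ` (V \<inter> W) \<subseteq> \<phi> ` W" by (auto simp: chart_inv[OF d])
    show "smooth_on (\<psi> ` (V \<inter> W)) (\<phi> \<circ> inv_into V \<psi>)"
      using smooth_transition[OF d c] by (rule smooth_on_subset) (use W in auto)
  qed
  then show "smooth_on (\<psi> ` (V \<inter> W)) (h \<circ> inv_into V \<psi>)"
    by (rule iffD1[OF smooth_on_cong[OF o], rotated]) (use W in \<open>auto simp: chart_inv[OF d] chart_inv[OF c]\<close>)
qed

lemma smooth_fun_const: "open W \<Longrightarrow> smooth_fun A W (\<lambda>p. a)"
  by (rule smooth_funI) (simp add: o_def smooth_on_const chart_image_open)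

lemma smooth_fun_add: "open W \<Longrightarrow> smooth_fun A W f \<Longrightarrow> smooth_fun A W g \<Longrightarrow> smooth_fun A W (\<lambda>p. f p + g p)"
  by (rule smooth_funI) (simp add: o_def smooth_on_add chart_image_open smooth_funD[unfolded o_def])

lemma smooth_fun_mult: "open W \<Longrightarrow> smooth_fun A W f \<Longrightarrow> smooth_fun A W g \<Longrightarrow> smooth_fun A W (\<lambda>p. f p * g p)"
  by (rule smooth_funI) (simp add: o_def smooth_on_mult chart_image_open smooth_funD[unfolded o_def])

lemma smooth_fun_cmult: "open W \<Longrightarrow> smooth_fun A W f \<Longrightarrow> smooth_fun A W (\<lambda>p. a * f p)"
  by (rule smooth_fun_mult[OF _ smooth_fun_const])

lemma smooth_fun_minus: "open W \<Longrightarrow> smooth_fun A W f \<Longrightarrow> smooth_fun A W (\<lambda>p. - f p)"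
  using smooth_fun_cmult[of W f "-1"] by simp

lemma smooth_fun_diff: "open W \<Longrightarrow> smooth_fun A W f \<Longrightarrow> smooth_fun A W g \<Longrightarrow> smooth_fun A W (\<lambda>p. f p - g p)"
  using smooth_fun_add[of W f "\<lambda>p. - g p"] smooth_fun_minus[of W g] by simp

lemma smooth_fun_sum:
  assumes "open W" "\<And>i. i \<in> I \<Longrightarrow> smooth_fun A W (f i)"
  shows "smooth_fun A W (\<lambda>p. \<Sum>i\<in>I. f i p)"
  using assms(2)
proof (induction I rule: infinite_finite_induct)
  case (insert i I)
  then show ?case using smooth_fun_add[OF assms(1), of "f i"] by simp
qed (simp_all add: smooth_fun_const assms(1))

lemma smooth_fun_inverse:
  assumes "open W" "smooth_fun A W f" "\<And>p. p \<in> W \<Longrightarrow> f p \<noteq> 0"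
  shows "smooth_fun A W (\<lambda>p. inverse (f p))"
proof (rule smooth_funI)
  fix U \<phi> assume c: "(U, \<phi>) \<in> A"
  show "smooth_on (\<phi> ` (U \<inter> W)) ((\<lambda>p. inverse (f p)) \<circ> inv_into U \<phi>)"
    unfolding o_def
    by (rule smooth_on_inverse[OF chart_image_open[OF c assms(1)] _ smooth_funD[OF assms(2) c, unfolded o_def]])
      (auto simp: chart_inv[OF c] assms(3))
qed

lemma smooth_fun_divide:
  "open W \<Longrightarrow> smooth_fun A W f \<Longrightarrow> smooth_fun A W g \<Longrightarrow> (\<And>p. p \<in> W \<Longrightarrow> g p \<noteq> 0) \<Longrightarrow> smooth_fun A W (\<lambda>p. f p / g p)"
  by (simp add: divide_inverse smooth_fun_mult smooth_fun_inverse)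

lemma smooth_fun_sqrt:
  assumes "open W" "smooth_fun A W f" "\<And>p. p \<in> W \<Longrightarrow> f p > 0"
  shows "smooth_fun A W (\<lambda>p. sqrt (f p))"
proof (rule smooth_funI)
  fix U \<phi> assume c: "(U, \<phi>) \<in> A"
  show "smooth_on (\<phi> ` (U \<inter> W)) ((\<lambda>p. sqrt (f p)) \<circ> inv_into U \<phi>)"
    unfolding o_def
    by (rule smooth_on_sqrt[OF chart_image_open[OF c assms(1)] _ smooth_funD[OF assms(2) c, unfolded o_def]])
      (auto simp: chart_inv[OF c] assms(3))
qed

lemma smooth_fun_continuous_on:
  assumes "open W" "smooth_fun A W f"
  shows "continuous_on W f"
proof -
  have "continuous (at p) f" if p: "p \<in> W" for p
  proof -
    obtain U \<phi> where c: "(U, \<phi>) \<in> A" "p \<in> U" by (rule chart_covers)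
    have "continuous_on (\<phi> ` (U \<inter> W)) (f \<circ> inv_into U \<phi>)"
      using smooth_on_continuous_on[OF smooth_funD[OF assms(2) c(1)]] .
    moreover have "continuous_on (U \<inter> W) \<phi>"
      by (rule continuous_on_subset[OF homeomorphism_cont1[OF chart_homeomorphism[OF c(1)]]]) simp
    ultimately have "continuous_on (U \<inter> W) (f \<circ> inv_into U \<phi> \<circ> \<phi>)"
      by (rule continuous_on_compose[rotated])
    then have "continuous_on (U \<inter> W) f"
      by (rule continuous_on_eq) (simp add: chart_inv[OF c(1)])
    moreover have "open (U \<inter> W)" "p \<in> U \<inter> W"
      using p c(2) open_Int[OF chart_open[OF c(1)] assms(1)] by auto
    ultimately show ?thesis by (simp only: continuous_on_eq_continuous_at)
  qed
  then show ?thesis by (intro continuous_at_imp_continuous_on ballI)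
qed

lemma smooth_fun_coord:
  assumes c: "(U, \<phi>) \<in> A"
  shows "smooth_fun A U (\<lambda>q. \<phi> q $ k)"
proof (rule smooth_fun_chartI[OF c chart_open[OF c]])
  have o: "open (\<phi> ` U)" using chart_open_image[OF c] .
  have "smooth_on (\<phi> ` U) (\<lambda>x. x $ k)"
    by (rule smooth_on_linear[OF o bounded_linear_vec_nth smooth_on_id[OF o]])
  then show "smooth_on (\<phi> ` U) ((\<lambda>q. \<phi> q $ k) \<circ> inv_into U \<phi>)"
    by (rule iffD1[OF smooth_on_cong[OF o], rotated]) (auto simp: chart_inv[OF c])
qed simp

lemma smooth_nearI: "open W \<Longrightarrow> p \<in> W \<Longrightarrow> smooth_fun A W h \<Longrightarrow> smooth_near A p h"
  unfolding smooth_near_def by auto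

lemma smooth_near_cong:
  assumes "open W" "p \<in> W" "\<And>q. q \<in> W \<Longrightarrow> h q = k q" "smooth_near A p h"
  shows "smooth_near A p k"
proof -
  obtain V where V: "open V" "p \<in> V" "smooth_fun A V h" using assms(4) unfolding smooth_near_def by auto
  have "smooth_fun A (V \<inter> W) k"
    by (rule smooth_fun_cong[OF _ _ smooth_fun_subset[OF V(3)], of _ k]) (use assms V in auto)
  then show ?thesis using smooth_nearI[of "V \<inter> W" p k] assms V by auto
qed

lemma smooth_near_common:
  assumes "smooth_near A p f" "smooth_near A p g"
  obtains W where "open W" "p \<in> W" "smooth_fun A W f" "smooth_fun A W g"
proof -
  obtain V W where "open V" "p \<in> V" "smooth_fun A V f" "open W" "p \<in> W" "smooth_fun A W g"
    using assms unfolding smooth_near_def by auto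
  then show ?thesis
    using that[of "V \<inter> W", OF _ _ smooth_fun_subset[of V f] smooth_fun_subset[of W g]] by blast
qed

lemma smooth_near_add:
  assumes "smooth_near A p f" "smooth_near A p g" shows "smooth_near A p (\<lambda>q. f q + g q)"
  by (rule smooth_near_common[OF assms]) (rule smooth_nearI[OF _ _ smooth_fun_add])

lemma smooth_near_mult:
  assumes "smooth_near A p f" "smooth_near A p g" shows "smooth_near A p (\<lambda>q. f q * g q)"
  by (rule smooth_near_common[OF assms]) (rule smooth_nearI[OF _ _ smooth_fun_mult])

lemma smooth_near_const: "smooth_near A p (\<lambda>q. a)"
  by (rule smooth_nearI[of UNIV]) (auto intro: smooth_fun_const)

end

section \<open>Tangent vectors, vector fields and the Lie bracket\<close>

context smooth_manifold
begin

lemma coord_vector_apply: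
  "smooth_near A p h \<Longrightarrow> coord_vector A (U, \<phi>) p v h = frechet_derivative (h \<circ> inv_into U \<phi>) (at (\<phi> p)) v"
  by (simp add: coord_vector_def)

lemma coord_vector_outside: "\<not> smooth_near A p h \<Longrightarrow> coord_vector A c p v h = 0"
  by (cases c) (simp add: coord_vector_def)

lemma chart_differentiable:
  assumes c: "(U, \<phi>) \<in> A" "p \<in> U" and h: "smooth_near A p h"
  shows "(h \<circ> inv_into U \<phi>) differentiable (at (\<phi> p))"
proof -
  obtain W where W: "open W" "p \<in> W" "smooth_fun A W h" using h unfolding smooth_near_def by auto
  show ?thesis by (rule smooth_on_differentiable[OF smooth_funD[OF W(3) c(1)]]) (use c W in auto)
qed

lemma coord_vector_linear:
  assumes c: "(U, \<phi>) \<in> A" "p \<in> U"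
  shows "coord_vector A (U, \<phi>) p (a *\<^sub>R v + b *\<^sub>R w) =
    a *\<^sub>R coord_vector A (U, \<phi>) p v + b *\<^sub>R coord_vector A (U, \<phi>) p w"
proof
  fix h
  show "coord_vector A (U, \<phi>) p (a *\<^sub>R v + b *\<^sub>R w) h =
    (a *\<^sub>R coord_vector A (U, \<phi>) p v + b *\<^sub>R coord_vector A (U, \<phi>) p w) h"
  proof (cases "smooth_near A p h")
    case True
    have "linear (frechet_derivative (h \<circ> inv_into U \<phi>) (at (\<phi> p)))"
      by (rule linear_frechet_derivative[OF chart_differentiable[OF c True]])
    then show ?thesis
      by (simp add: coord_vector_apply[OF True] scaleR_fun_def linear_add linear_scale)
  qed (simp add: coord_vector_outside scaleR_fun_def)
qed

lemma coord_vector_expand: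
  assumes c: "(U, \<phi>) \<in> A" "p \<in> U"
  shows "coord_vector A (U, \<phi>) p v h = (\<Sum>k\<in>UNIV. v $ k * coord_vector A (U, \<phi>) p (axis k 1) h)"
proof (cases "smooth_near A p h")
  case True
  let ?D = "frechet_derivative (h \<circ> inv_into U \<phi>) (at (\<phi> p))"
  have l: "linear ?D" by (rule linear_frechet_derivative[OF chart_differentiable[OF c True]])
  have "?D v = ?D (\<Sum>k\<in>UNIV. v $ k *\<^sub>R axis k 1)" by (simp add: basis_expansion scalar_mult_eq_scaleR[symmetric])
  also have "\<dots> = (\<Sum>k\<in>UNIV. v $ k * ?D (axis k 1))" using l by (simp add: linear_sum linear_scale)
  finally show ?thesis by (simp add: coord_vector_apply[OF True])
qed (simp add: coord_vector_outside)

text \<open>This is the chain rule for the transition map. It makes the tangent space, defined as a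
  union over all charts, the range of the coordinate vectors of any one chart.\<close>

lemma coord_vector_change:
  assumes c: "(U, \<phi>) \<in> A" "p \<in> U" and d: "(V, \<psi>) \<in> A" "p \<in> V"
  shows "coord_vector A (V, \<psi>) p w =
    coord_vector A (U, \<phi>) p (frechet_derivative (\<phi> \<circ> inv_into V \<psi>) (at (\<psi> p)) w)"
proof
  fix h
  show "coord_vector A (V, \<psi>) p w h =
    coord_vector A (U, \<phi>) p (frechet_derivative (\<phi> \<circ> inv_into V \<psi>) (at (\<psi> p)) w) h"
  proof (cases "smooth_near A p h")
    case True
    let ?\<tau> = "\<phi> \<circ> inv_into V \<psi>"
    have t: "(?\<tau> has_derivative frechet_derivative ?\<tau> (at (\<psi> p))) (at (\<psi> p))"
      by (intro has_frechet_derivative smooth_on_differentiable[OF smooth_transition[OF d(1) c(1)]])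
        (use c d in auto)
    have tp: "?\<tau> (\<psi> p) = \<phi> p" using chart_inv[OF d(1,2)] by simp
    have "((h \<circ> inv_into U \<phi>) has_derivative frechet_derivative (h \<circ> inv_into U \<phi>) (at (\<phi> p))) (at (?\<tau> (\<psi> p)))"
      unfolding tp by (rule has_frechet_derivative[OF chart_differentiable[OF c True]])
    from diff_chain_at[OF t this]
    have "(((h \<circ> inv_into U \<phi>) \<circ> ?\<tau>) has_derivative
        (frechet_derivative (h \<circ> inv_into U \<phi>) (at (\<phi> p)) \<circ> frechet_derivative ?\<tau> (at (\<psi> p)))) (at (\<psi> p))" .
    then have "((h \<circ> inv_into V \<psi>) has_derivative
        (frechet_derivative (h \<circ> inv_into U \<phi>) (at (\<phi> p)) \<circ> frechet_derivative ?\<tau> (at (\<psi> p)))) (at (\<psi> p))"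
      by (rule has_derivative_transform_within_open[OF _ chart_image_open[OF d(1) chart_open[OF c(1)]]])
        (use c d in \<open>auto simp: chart_inv[OF d(1)] chart_inv[OF c(1)]\<close>)
    then show ?thesis
      using frechet_derivative_eqI by (fastforce simp: coord_vector_apply[OF True])
  qed (simp add: coord_vector_outside)
qed

lemma tangent_space_chart:
  assumes c: "(U, \<phi>) \<in> A" "p \<in> U"
  shows "tangent_space A p = range (coord_vector A (U, \<phi>) p)"
proof
  show "range (coord_vector A (U, \<phi>) p) \<subseteq> tangent_space A p"
    using c unfolding tangent_space_def by force
  show "tangent_space A p \<subseteq> range (coord_vector A (U, \<phi>) p)"
  proof
    fix u assume "u \<in> tangent_space A p"
    then obtain V \<psi> w where d: "(V, \<psi>) \<in> A" "p \<in> V" "u = coord_vector A (V, \<psi>) p w"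
      unfolding tangent_space_def by auto
    then show "u \<in> range (coord_vector A (U, \<phi>) p)" using coord_vector_change[OF c d(1,2)] by auto
  qed
qed

lemma tangent_combination:
  assumes "u \<in> tangent_space A p" "v \<in> tangent_space A p"
  shows "a *\<^sub>R u + b *\<^sub>R v \<in> tangent_space A p"
proof -
  obtain U \<phi> where c: "(U, \<phi>) \<in> A" "p \<in> U" by (rule chart_covers)
  obtain x y where "u = coord_vector A (U, \<phi>) p x" "v = coord_vector A (U, \<phi>) p y"
    using assms unfolding tangent_space_chart[OF c] by auto
  then have "a *\<^sub>R u + b *\<^sub>R v = coord_vector A (U, \<phi>) p (a *\<^sub>R x + b *\<^sub>R y)"
    using coord_vector_linear[OF c] by simp
  then show ?thesis unfolding tangent_space_chart[OF c] by simp
qed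

lemma subspace_tangent_space: "subspace (tangent_space A p)"
proof -
  obtain U \<phi> where c: "(U, \<phi>) \<in> A" "p \<in> U" by (rule chart_covers)
  then have u: "coord_vector A (U, \<phi>) p 0 \<in> tangent_space A p" unfolding tangent_space_chart[OF c] by simp
  show ?thesis
    unfolding subspace_def
  proof (intro conjI ballI allI)
    show "0 \<in> tangent_space A p" using tangent_combination[OF u u, of 0 0] by simp
    show "x + y \<in> tangent_space A p" if "x \<in> tangent_space A p" "y \<in> tangent_space A p" for x y
      using tangent_combination[OF that, of 1 1] by simp
    show "a *\<^sub>R x \<in> tangent_space A p" if "x \<in> tangent_space A p" for x a
      using tangent_combination[OF that that, of a 0] by simp
  qed
qed

lemmas tangent_zero = subspace_0[OF subspace_tangent_space]
  and tangent_add = subspace_add[OF subspace_tangent_space]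
  and tangent_scale = subspace_scale[OF subspace_tangent_space]
  and tangent_diff = subspace_diff[OF subspace_tangent_space]
  and tangent_sum = subspace_sum[OF subspace_tangent_space]

lemma tangent_outside:
  assumes "u \<in> tangent_space A p" "\<not> smooth_near A p h"
  shows "u h = 0"
  using assms coord_vector_outside unfolding tangent_space_def by auto

lemma tangent_eqI:
  assumes "u \<in> tangent_space A p" "v \<in> tangent_space A p" "\<And>h. smooth_near A p h \<Longrightarrow> u h = v h"
  shows "u = v"
proof
  fix h show "u h = v h"
    using assms tangent_outside[OF assms(1)] tangent_outside[OF assms(2)] by (cases "smooth_near A p h") simp_all
qed

lemma coord_vector_coord:
  assumes c: "(U, \<phi>) \<in> A" "p \<in> U"
  shows "coord_vector A (U, \<phi>) p v (\<lambda>q. \<phi> q $ k) = v $ k"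
proof -
  have s: "smooth_near A p (\<lambda>q. \<phi> q $ k)"
    by (rule smooth_nearI[OF chart_open[OF c(1)] c(2) smooth_fun_coord[OF c(1)]])
  have "((\<lambda>x. x $ k) has_derivative (\<lambda>x. x $ k)) (at (\<phi> p))"
    by (rule bounded_linear_imp_has_derivative[OF bounded_linear_vec_nth])
  then have "(((\<lambda>q. \<phi> q $ k) \<circ> inv_into U \<phi>) has_derivative (\<lambda>x. x $ k)) (at (\<phi> p))"
    by (rule has_derivative_transform_within_open[OF _ chart_open_image[OF c(1)]])
      (use c(2) in \<open>auto simp: chart_inv[OF c(1)]\<close>)
  then show ?thesis by (simp add: coord_vector_apply[OF s] frechet_derivative_eqI)
qed

text \<open>Evaluation on the coordinate functions reads off the components. A smooth vector field,
  defined by its action on functions, thereby acquires smooth components.\<close>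

lemma tangent_coords:
  assumes c: "(U, \<phi>) \<in> A" "p \<in> U" and u: "u \<in> tangent_space A p"
  shows "u = coord_vector A (U, \<phi>) p (\<chi> k. u (\<lambda>q. \<phi> q $ k))"
proof -
  obtain v where v: "u = coord_vector A (U, \<phi>) p v" using u unfolding tangent_space_chart[OF c] by auto
  have "(\<chi> k. u (\<lambda>q. \<phi> q $ k)) = v" by (simp add: v coord_vector_coord[OF c])
  then show ?thesis using v by simp
qed

lemma tangent_apply_mult:
  assumes u: "u \<in> tangent_space A p" and f: "smooth_near A p f" and g: "smooth_near A p g"
  shows "u (\<lambda>q. f q * g q) = u f * g p + f p * u g"
proof -
  obtain U \<phi> where c: "(U, \<phi>) \<in> A" "p \<in> U" by (rule chart_covers)
  obtain v where v: "u = coord_vector A (U, \<phi>) p v" using u unfolding tangent_space_chart[OF c] by auto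
  let ?f = "f \<circ> inv_into U \<phi>" and ?g = "g \<circ> inv_into U \<phi>"
  have "((\<lambda>x. ?f x * ?g x) has_derivative (\<lambda>v. ?f (\<phi> p) * frechet_derivative ?g (at (\<phi> p)) v
      + frechet_derivative ?f (at (\<phi> p)) v * ?g (\<phi> p))) (at (\<phi> p))"
    by (intro has_derivative_mult has_frechet_derivative chart_differentiable c f g)
  moreover have "(\<lambda>x. ?f x * ?g x) = (\<lambda>q. f q * g q) \<circ> inv_into U \<phi>" by auto
  ultimately show ?thesis
    using frechet_derivative_eqI chart_inv[OF c]
    by (fastforce simp: v coord_vector_apply[OF smooth_near_mult[OF f g]] coord_vector_apply[OF f] coord_vector_apply[OF g])
qed

lemma tangent_apply_add:
  assumes u: "u \<in> tangent_space A p" and f: "smooth_near A p f" and g: "smooth_near A p g"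
  shows "u (\<lambda>q. f q + g q) = u f + u g"
proof -
  obtain U \<phi> where c: "(U, \<phi>) \<in> A" "p \<in> U" by (rule chart_covers)
  obtain v where v: "u = coord_vector A (U, \<phi>) p v" using u unfolding tangent_space_chart[OF c] by auto
  let ?f = "f \<circ> inv_into U \<phi>" and ?g = "g \<circ> inv_into U \<phi>"
  have "((\<lambda>x. ?f x + ?g x) has_derivative (\<lambda>v. frechet_derivative ?f (at (\<phi> p)) v
      + frechet_derivative ?g (at (\<phi> p)) v)) (at (\<phi> p))"
    by (intro has_derivative_add has_frechet_derivative chart_differentiable c f g)
  moreover have "(\<lambda>x. ?f x + ?g x) = (\<lambda>q. f q + g q) \<circ> inv_into U \<phi>" by auto
  ultimately show ?thesis
    using frechet_derivative_eqI
    by (fastforce simp: v coord_vector_apply[OF smooth_near_add[OF f g]] coord_vector_apply[OF f] coord_vector_apply[OF g])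
qed

lemma tangent_apply_const:
  assumes u: "u \<in> tangent_space A p"
  shows "u (\<lambda>q. a) = 0"
proof -
  obtain U \<phi> where c: "(U, \<phi>) \<in> A" "p \<in> U" by (rule chart_covers)
  obtain v where v: "u = coord_vector A (U, \<phi>) p v" using u unfolding tangent_space_chart[OF c] by auto
  have "(\<lambda>q. a) \<circ> inv_into U \<phi> = (\<lambda>x. a)" by auto
  then show ?thesis
    by (simp add: v coord_vector_apply[OF smooth_near_const] frechet_derivative_eqI[OF has_derivative_const])
qed

lemma tangent_apply_cmult:
  assumes u: "u \<in> tangent_space A p" and f: "smooth_near A p f"
  shows "u (\<lambda>q. a * f q) = a * u f"
  using tangent_apply_mult[OF u smooth_near_const f, of a] tangent_apply_const[OF u] by simp

lemma tangent_apply_cong: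
  assumes u: "u \<in> tangent_space A p" and W: "open W" "p \<in> W" "\<And>q. q \<in> W \<Longrightarrow> f q = g q"
  shows "u f = u g"
proof (cases "smooth_near A p f")
  case f: True
  have g: "smooth_near A p g" by (rule smooth_near_cong[OF W f])
  obtain U \<phi> where c: "(U, \<phi>) \<in> A" "p \<in> U" by (rule chart_covers)
  obtain v where v: "u = coord_vector A (U, \<phi>) p v" using u unfolding tangent_space_chart[OF c] by auto
  have "((g \<circ> inv_into U \<phi>) has_derivative frechet_derivative (f \<circ> inv_into U \<phi>) (at (\<phi> p))) (at (\<phi> p))"
    by (rule has_derivative_transform_within_open[OF has_frechet_derivative[OF chart_differentiable[OF c f]]
          chart_image_open[OF c(1) W(1)]]) (use c W in \<open>auto simp: chart_inv[OF c(1)]\<close>)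
  then show ?thesis
    by (simp add: v coord_vector_apply[OF f] coord_vector_apply[OF g] frechet_derivative_eqI)
next
  \<comment> \<open>Here the default value decides: neither function is smooth near
    \<open>p\<close>, and tangent vectors send both to 0.\<close>
  case f: False
  have "\<not> smooth_near A p g"
  proof
    assume "smooth_near A p g"
    from smooth_near_cong[OF W(1,2) _ this, of f] W(3) f show False by simp
  qed
  with f show ?thesis using tangent_outside[OF u] by simp
qed

lemma smooth_near_sum:
  "(\<And>i. i \<in> I \<Longrightarrow> smooth_near A p (f i)) \<Longrightarrow> smooth_near A p (\<lambda>q. \<Sum>i\<in>I. f i q)"
proof (induction I rule: infinite_finite_induct)
  case (insert i I)
  then show ?case using smooth_near_add[of p "f i" "\<lambda>q. \<Sum>i\<in>I. f i q"] by simp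
qed (simp_all add: smooth_near_const)

lemma tangent_apply_sum:
  assumes u: "u \<in> tangent_space A p"
  shows "(\<And>i. i \<in> I \<Longrightarrow> smooth_near A p (f i)) \<Longrightarrow> u (\<lambda>q. \<Sum>i\<in>I. f i q) = (\<Sum>i\<in>I. u (f i))"
proof (induction I rule: infinite_finite_induct)
  case (insert i I)
  then show ?case using tangent_apply_add[OF u, of "f i" "\<lambda>q. \<Sum>i\<in>I. f i q"] smooth_near_sum[of I p f] by simp
qed (simp_all add: tangent_apply_const[OF u])

section \<open>Smooth vector fields\<close>

lemma smooth_vfieldD: "smooth_vfield A U X \<Longrightarrow> p \<in> U \<Longrightarrow> X p \<in> tangent_space A p"
  unfolding smooth_vfield_def by auto

lemma smooth_vfield_apply: "smooth_vfield A U X \<Longrightarrow> open W \<Longrightarrow> smooth_fun A W h \<Longrightarrow> smooth_fun A (U \<inter> W) (\<lambda>p. X p h)"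
  unfolding smooth_vfield_def by auto

lemma smooth_vfield_apply': "smooth_vfield A U X \<Longrightarrow> open U \<Longrightarrow> smooth_fun A U h \<Longrightarrow> smooth_fun A U (\<lambda>p. X p h)"
  using smooth_vfield_apply[of U X U h] by simp

lemma smooth_vfield_apply_near:
  assumes "smooth_vfield A U X" "open U" "p \<in> U" "smooth_near A p h"
  shows "smooth_near A p (\<lambda>p. X p h)"
proof -
  obtain W where "open W" "p \<in> W" "smooth_fun A W h" using assms(4) unfolding smooth_near_def by auto
  then show ?thesis using smooth_nearI[OF _ _ smooth_vfield_apply[OF assms(1)]] assms by blast
qed

lemma smooth_vfieldI:
  assumes "\<And>p. p \<in> U \<Longrightarrow> X p \<in> tangent_space A p"
    and "\<And>W h. open W \<Longrightarrow> smooth_fun A W h \<Longrightarrow> smooth_fun A (U \<inter> W) (\<lambda>p. X p h)"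
  shows "smooth_vfield A U X"
  using assms unfolding smooth_vfield_def by auto

lemma smooth_vfield_subset: "smooth_vfield A U X \<Longrightarrow> V \<subseteq> U \<Longrightarrow> smooth_vfield A V X"
proof (rule smooth_vfieldI)
  assume a: "smooth_vfield A U X" "V \<subseteq> U"
  show "X p \<in> tangent_space A p" if "p \<in> V" for p using a that by (auto dest: smooth_vfieldD)
  show "smooth_fun A (V \<inter> W) (\<lambda>p. X p h)" if "open W" "smooth_fun A W h" for W h
    by (rule smooth_fun_subset[OF smooth_vfield_apply[OF a(1) that]]) (use a in auto)
qed

lemma smooth_vfield_cong:
  assumes "open U" "\<And>p. p \<in> U \<Longrightarrow> X p = Y p" "smooth_vfield A U X"
  shows "smooth_vfield A U Y"
proof (rule smooth_vfieldI)
  show "Y p \<in> tangent_space A p" if "p \<in> U" for p using smooth_vfieldD[OF assms(3) that] assms(2)[OF that] by simp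
  show "smooth_fun A (U \<inter> W) (\<lambda>p. Y p h)" if "open W" "smooth_fun A W h" for W h
    by (rule smooth_fun_cong[OF _ _ smooth_vfield_apply[OF assms(3) that]]) (use assms that in auto)
qed

lemma smooth_vfield_local:
  assumes "\<And>p. p \<in> U \<Longrightarrow> \<exists>V. open V \<and> p \<in> V \<and> smooth_vfield A V X"
  shows "smooth_vfield A U X"
proof (rule smooth_vfieldI)
  show "X p \<in> tangent_space A p" if "p \<in> U" for p using assms[OF that] smooth_vfieldD by blast
  fix W h assume W: "open W" "smooth_fun A W h"
  show "smooth_fun A (U \<inter> W) (\<lambda>p. X p h)"
  proof (rule smooth_fun_local)
    fix p assume p: "p \<in> U \<inter> W"
    then obtain V where V: "open V" "p \<in> V" "smooth_vfield A V X" using assms by blast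
    then show "\<exists>V. open V \<and> p \<in> V \<and> smooth_fun A V (\<lambda>p. X p h)"
      using smooth_vfield_apply[OF V(3) W] p W(1) by (intro exI[of _ "V \<inter> W"]) auto
  qed
qed

lemma smooth_vfield_zero: "open U \<Longrightarrow> smooth_vfield A U (\<lambda>p. 0)"
  by (rule smooth_vfieldI) (auto simp: tangent_zero intro!: smooth_fun_const)

lemma smooth_vfield_add:
  assumes "open U" "smooth_vfield A U X" "smooth_vfield A U Y"
  shows "smooth_vfield A U (\<lambda>p. X p + Y p)"
proof (rule smooth_vfieldI)
  show "X p + Y p \<in> tangent_space A p" if "p \<in> U" for p
    by (intro tangent_add smooth_vfieldD[OF assms(2)] smooth_vfieldD[OF assms(3)] that)
  show "smooth_fun A (U \<inter> W) (\<lambda>p. (X p + Y p) h)" if "open W" "smooth_fun A W h" for W h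
    using smooth_fun_add[OF _ smooth_vfield_apply[OF assms(2) that] smooth_vfield_apply[OF assms(3) that]] assms(1) that
    by (simp add: open_Int)
qed

lemma smooth_vfield_scale:
  assumes "open U" "smooth_fun A U f" "smooth_vfield A U X"
  shows "smooth_vfield A U (\<lambda>p. f p *\<^sub>R X p)"
proof (rule smooth_vfieldI)
  show "f p *\<^sub>R X p \<in> tangent_space A p" if "p \<in> U" for p
    by (intro tangent_scale smooth_vfieldD[OF assms(3)] that)
  show "smooth_fun A (U \<inter> W) (\<lambda>p. (f p *\<^sub>R X p) h)" if "open W" "smooth_fun A W h" for W h
    using smooth_fun_mult[OF _ smooth_fun_subset[OF assms(2)] smooth_vfield_apply[OF assms(3) that]] assms(1) that
    by (simp add: scaleR_fun_def open_Int)
qed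

lemma smooth_vfield_diff:
  assumes "open U" "smooth_vfield A U X" "smooth_vfield A U Y"
  shows "smooth_vfield A U (\<lambda>p. X p - Y p)"
  using smooth_vfield_add[OF assms(1,2) smooth_vfield_scale[OF assms(1) smooth_fun_const[OF assms(1), of "-1"] assms(3)]]
  by simp

lemma smooth_vfield_sum:
  assumes "open U" "\<And>i. i \<in> I \<Longrightarrow> smooth_vfield A U (X i)"
  shows "smooth_vfield A U (\<lambda>p. \<Sum>i\<in>I. X i p)"
  using assms(2)
proof (induction I rule: infinite_finite_induct)
  case (insert i I)
  then have "smooth_vfield A U (\<lambda>p. X i p + (\<Sum>i\<in>I. X i p))"
    by (intro smooth_vfield_add[OF assms(1)]) blast+
  then show ?case by (simp only: sum.insert[OF insert.hyps(1,2)])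
qed (simp_all only: sum.infinite sum.empty not_False_eq_True smooth_vfield_zero[OF assms(1)])

lemma smooth_fun_partial:
  assumes c: "(U, \<phi>) \<in> A" and W: "open W" "smooth_fun A W h"
  shows "smooth_fun A (U \<inter> W) (\<lambda>p. coord_vector A (U, \<phi>) p v h)"
proof (rule smooth_fun_chartI[OF c])
  show o: "open (U \<inter> W)" using W chart_open[OF c] by (simp add: open_Int)
  have s: "smooth_on (\<phi> ` (U \<inter> W)) (\<lambda>x. frechet_derivative (h \<circ> inv_into U \<phi>) (at x) v)"
    by (rule smooth_on_frechet_derivative[OF smooth_funD[OF W(2) c]])
  have q: "coord_vector A (U, \<phi>) p v h = frechet_derivative (h \<circ> inv_into U \<phi>) (at (\<phi> p)) v"
    if "p \<in> W" for p using smooth_nearI[OF W(1) that W(2)] by (rule coord_vector_apply)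
  show "smooth_on (\<phi> ` (U \<inter> W)) ((\<lambda>p. coord_vector A (U, \<phi>) p v h) \<circ> inv_into U \<phi>)"
    by (rule iffD1[OF smooth_on_cong[OF chart_image_open[OF c W(1)]] s]) (auto simp: chart_inv[OF c] q)
qed simp

text \<open>Expansion in the coordinate frame reduces the action on an arbitrary function to the
  three components and the partial derivatives of that function.\<close>

lemma smooth_vfield_coordI:
  assumes c: "(U, \<phi>) \<in> A" and W: "open W" "W \<subseteq> U"
    and X: "\<And>p. p \<in> W \<Longrightarrow> X p = coord_vector A (U, \<phi>) p (v p)"
    and v: "\<And>k. smooth_fun A W (\<lambda>p. v p $ k)"
  shows "smooth_vfield A W X"
proof (rule smooth_vfieldI)
  show "X p \<in> tangent_space A p" if "p \<in> W" for p
    using that W tangent_space_chart[OF c, of p] by (auto simp: X)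
  fix V h assume V: "open V" "smooth_fun A V h"
  have o: "open (W \<inter> V)" using W V by auto
  have "smooth_fun A (W \<inter> V) (\<lambda>p. \<Sum>k\<in>UNIV. v p $ k * coord_vector A (U, \<phi>) p (axis k 1) h)"
    by (intro smooth_fun_sum smooth_fun_mult o smooth_fun_subset[OF v] smooth_fun_subset[OF smooth_fun_partial[OF c V]])
      (use W in auto)
  moreover have "(\<Sum>k\<in>UNIV. v p $ k * coord_vector A (U, \<phi>) p (axis k 1) h) = X p h" if "p \<in> W \<inter> V" for p
    unfolding X[of p, OF IntD1[OF that]] by (rule coord_vector_expand[OF c, symmetric]) (use W that in auto)
  ultimately show "smooth_fun A (W \<inter> V) (\<lambda>p. X p h)"
    by (rule smooth_fun_cong[OF o, rotated])
qed

section \<open>The Lie bracket\<close>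

lemma lie_bracket_apply:
  "smooth_near A p h \<Longrightarrow> lie_bracket A X Y p h = X p (\<lambda>q. Y q h) - Y p (\<lambda>q. X q h)"
  by (simp add: lie_bracket_def)

lemma partial_commute:
  assumes c: "(U, \<phi>) \<in> A" "p \<in> U" and h: "smooth_near A p h"
  shows "coord_vector A (U, \<phi>) p v (\<lambda>q. coord_vector A (U, \<phi>) q w h) =
    coord_vector A (U, \<phi>) p w (\<lambda>q. coord_vector A (U, \<phi>) q v h)"
proof -
  obtain W where W: "open W" "p \<in> W" "smooth_fun A W h" using h unfolding smooth_near_def by auto
  let ?f = "h \<circ> inv_into U \<phi>" and ?S = "\<phi> ` (U \<inter> W)"
  have s: "smooth_on ?S ?f" by (rule smooth_funD[OF W(3) c(1)])
  have o: "open ?S" by (rule chart_image_open[OF c(1) W(1)])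
  have pS: "\<phi> p \<in> ?S" using c W by auto
  have "coord_vector A (U, \<phi>) p v (\<lambda>q. coord_vector A (U, \<phi>) q w h) =
      frechet_derivative (\<lambda>y. frechet_derivative ?f (at y) w) (at (\<phi> p)) v" for v w
  proof -
    have n: "smooth_near A p (\<lambda>q. coord_vector A (U, \<phi>) q w h)"
      by (rule smooth_nearI[OF _ _ smooth_fun_partial[OF c(1) W(1,3)]]) (use c W chart_open[OF c(1)] in auto)
    have q: "coord_vector A (U, \<phi>) q w h = frechet_derivative ?f (at (\<phi> q)) w" if "q \<in> W" for q
      using smooth_nearI[OF W(1) that W(3)] by (rule coord_vector_apply)
    have "((\<lambda>y. frechet_derivative ?f (at y) w) has_derivative
        frechet_derivative (\<lambda>y. frechet_derivative ?f (at y) w) (at (\<phi> p))) (at (\<phi> p))"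
      by (rule has_frechet_derivative[OF smooth_on_differentiable[OF smooth_on_frechet_derivative[OF s] pS]])
    then have "(((\<lambda>q. coord_vector A (U, \<phi>) q w h) \<circ> inv_into U \<phi>) has_derivative
        frechet_derivative (\<lambda>y. frechet_derivative ?f (at y) w) (at (\<phi> p))) (at (\<phi> p))"
      by (rule has_derivative_transform_within_open[OF _ o pS]) (auto simp: chart_inv[OF c(1)] q)
    then show ?thesis by (simp add: coord_vector_apply[OF n] frechet_derivative_eqI)
  qed
  then show ?thesis using symmetric_second_derivative[OF s o pS] by simp
qed

text \<open>The product rule is applied to \<open>Y\<close> written in coordinates. It separates a
  first-order part, in which \<open>X\<close> differentiates the components of \<open>Y\<close>,
  from a second-order part, in which exchanging \<open>X\<close> and \<open>Y\<close> only exchanges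
  the two partial derivatives.\<close>

lemma iterated_vfield_apply:
  assumes c: "(U, \<phi>) \<in> A" "p \<in> U" and h: "smooth_near A p h"
    and V: "open V" "p \<in> V" "smooth_vfield A V X" "smooth_vfield A V Y"
  shows "X p (\<lambda>q. Y q h) = (\<Sum>j\<in>UNIV. X p (\<lambda>q. Y q (\<lambda>r. \<phi> r $ j)) * coord_vector A (U, \<phi>) p (axis j 1) h) +
    (\<Sum>i\<in>UNIV. \<Sum>j\<in>UNIV. X p (\<lambda>r. \<phi> r $ i) * Y p (\<lambda>r. \<phi> r $ j) *
      coord_vector A (U, \<phi>) p (axis i 1) (\<lambda>q. coord_vector A (U, \<phi>) q (axis j 1) h))"
proof -
  let ?d = "\<lambda>j q. coord_vector A (U, \<phi>) q (axis j 1)" and ?x = "\<lambda>j r. \<phi> r $ j"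
  have o: "open (U \<inter> V)" "p \<in> U \<inter> V" using c V chart_open[OF c(1)] by auto
  note TX = smooth_vfieldD[OF V(3) V(2)]
  have e: "u k = (\<Sum>j\<in>UNIV. u (?x j) * ?d j q k)" if "q \<in> U" "u \<in> tangent_space A q" for u q k
    using tangent_coords[OF c(1) that] coord_vector_expand[OF c(1) that(1), of "\<chi> j. u (?x j)" k] by simp
  obtain W where W: "open W" "p \<in> W" "smooth_fun A W h" using h unfolding smooth_near_def by auto
  have nd: "smooth_near A p (\<lambda>q. ?d j q h)" for j
    by (rule smooth_nearI[OF _ _ smooth_fun_partial[OF c(1) W(1,3)]]) (use o c W chart_open[OF c(1)] in auto)
  have nY: "smooth_near A p (\<lambda>q. Y q (?x j))" for j
    by (rule smooth_vfield_apply_near[OF V(4,1,2) smooth_nearI[OF chart_open[OF c(1)] c(2) smooth_fun_coord[OF c(1)]]])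
  have "X p (\<lambda>q. Y q h) = X p (\<lambda>q. \<Sum>j\<in>UNIV. Y q (?x j) * ?d j q h)"
    by (rule tangent_apply_cong[OF TX o]) (auto intro!: e smooth_vfieldD[OF V(4)])
  also have "\<dots> = (\<Sum>j\<in>UNIV. X p (\<lambda>q. Y q (?x j) * ?d j q h))"
    by (rule tangent_apply_sum[OF TX]) (intro smooth_near_mult nd nY)
  also have "\<dots> = (\<Sum>j\<in>UNIV. X p (\<lambda>q. Y q (?x j)) * ?d j p h + Y p (?x j) * X p (\<lambda>q. ?d j q h))"
    by (intro sum.cong refl tangent_apply_mult[OF TX nY nd])
  also have "\<dots> = (\<Sum>j\<in>UNIV. X p (\<lambda>q. Y q (?x j)) * ?d j p h) +
      (\<Sum>j\<in>UNIV. \<Sum>i\<in>UNIV. X p (?x i) * Y p (?x j) * ?d i p (\<lambda>q. ?d j q h))"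
    by (subst e[OF c(2) TX, of "\<lambda>q. ?d _ q h"]) (simp add: sum.distrib sum_distrib_left mult_ac)
  also have "(\<Sum>j\<in>UNIV. \<Sum>i\<in>UNIV. X p (?x i) * Y p (?x j) * ?d i p (\<lambda>q. ?d j q h)) =
      (\<Sum>i\<in>UNIV. \<Sum>j\<in>UNIV. X p (?x i) * Y p (?x j) * ?d i p (\<lambda>q. ?d j q h))"
    by (rule sum.swap)
  finally show ?thesis .
qed

text \<open>The second derivatives cancel because they commute, so the bracket is again first order.\<close>

lemma lie_bracket_coord:
  assumes c: "(U, \<phi>) \<in> A" "p \<in> U"
    and V: "open V" "p \<in> V" "smooth_vfield A V X" "smooth_vfield A V Y"
  shows "lie_bracket A X Y p =
    coord_vector A (U, \<phi>) p (\<chi> k. X p (\<lambda>q. Y q (\<lambda>r. \<phi> r $ k)) - Y p (\<lambda>q. X q (\<lambda>r. \<phi> r $ k)))"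
    (is "_ = coord_vector A (U, \<phi>) p ?b")
proof
  let ?d = "\<lambda>j q. coord_vector A (U, \<phi>) q (axis j 1)" and ?x = "\<lambda>j r. \<phi> r $ j"
  fix h
  show "lie_bracket A X Y p h = coord_vector A (U, \<phi>) p ?b h"
  proof (cases "smooth_near A p h")
    case True
    have "(\<Sum>i\<in>UNIV. \<Sum>j\<in>UNIV. Y p (?x i) * X p (?x j) * ?d i p (\<lambda>q. ?d j q h)) =
      (\<Sum>j\<in>UNIV. \<Sum>i\<in>UNIV. Y p (?x i) * X p (?x j) * ?d i p (\<lambda>q. ?d j q h))"
      by (rule sum.swap)
    also have "\<dots> = (\<Sum>i\<in>UNIV. \<Sum>j\<in>UNIV. X p (?x i) * Y p (?x j) * ?d i p (\<lambda>q. ?d j q h))"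
      by (intro sum.cong refl) (subst partial_commute[OF c True], simp)
    finally show ?thesis
      unfolding lie_bracket_apply[OF True] iterated_vfield_apply[OF c True V]
        iterated_vfield_apply[OF c True V(1,2,4,3)] coord_vector_expand[OF c, of ?b]
      by (simp add: sum_subtractf left_diff_distrib)
  qed (simp add: lie_bracket_def coord_vector_outside)
qed

lemma smooth_vfield_lie_bracket:
  assumes V: "open V" "smooth_vfield A V X" "smooth_vfield A V Y"
  shows "smooth_vfield A V (lie_bracket A X Y)"
proof (rule smooth_vfield_local)
  fix p assume p: "p \<in> V"
  obtain U \<phi> where c: "(U, \<phi>) \<in> A" "p \<in> U" by (rule chart_covers)
  have o: "open (U \<inter> V)" using V chart_open[OF c(1)] by auto
  have x: "smooth_fun A (U \<inter> V) (\<lambda>r. \<phi> r $ k)" for k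
    by (rule smooth_fun_subset[OF smooth_fun_coord[OF c(1)]]) simp
  have XY: "smooth_vfield A (U \<inter> V) X" "smooth_vfield A (U \<inter> V) Y"
    using V smooth_vfield_subset by auto
  have "smooth_vfield A (U \<inter> V) (lie_bracket A X Y)"
  proof (rule smooth_vfield_coordI[OF c(1) o])
    show "lie_bracket A X Y q = coord_vector A (U, \<phi>) q (\<chi> k. X q (\<lambda>q. Y q (\<lambda>r. \<phi> r $ k)) - Y q (\<lambda>q. X q (\<lambda>r. \<phi> r $ k)))"
      if "q \<in> U \<inter> V" for q using lie_bracket_coord[OF c(1) _ V(1) _ V(2,3)] that by auto
    show "smooth_fun A (U \<inter> V) (\<lambda>q. (\<chi> k. X q (\<lambda>q. Y q (\<lambda>r. \<phi> r $ k)) - Y q (\<lambda>q. X q (\<lambda>r. \<phi> r $ k))) $ k)" for k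
      using smooth_fun_diff[OF o smooth_vfield_apply'[OF XY(1) o smooth_vfield_apply'[OF XY(2) o x]]
          smooth_vfield_apply'[OF XY(2) o smooth_vfield_apply'[OF XY(1) o x]]] by simp
  qed simp
  then show "\<exists>V. open V \<and> p \<in> V \<and> smooth_vfield A V (lie_bracket A X Y)"
    using o c p by blast
qed

lemma lie_bracket_antisym: "lie_bracket A Y X p = - lie_bracket A X Y p"
  by (rule ext) (simp add: lie_bracket_def)

context
  fixes U :: "'m set" and p
  assumes U: "open U" "p \<in> U"
begin

lemma lie_bracket_add_right:
  assumes X: "smooth_vfield A U X" and Y: "smooth_vfield A U Y" and Z: "smooth_vfield A U Z"
  shows "lie_bracket A X (\<lambda>q. Y q + Z q) p = lie_bracket A X Y p + lie_bracket A X Z p"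
proof
  fix h show "lie_bracket A X (\<lambda>q. Y q + Z q) p h = (lie_bracket A X Y p + lie_bracket A X Z p) h"
  proof (cases "smooth_near A p h")
    case True
    show ?thesis
      using tangent_apply_add[OF smooth_vfieldD[OF X U(2)] smooth_vfield_apply_near[OF Y U True] smooth_vfield_apply_near[OF Z U True]]
      by (simp add: lie_bracket_apply[OF True])
  qed (simp add: lie_bracket_def)
qed

lemma lie_bracket_scale_right:
  assumes X: "smooth_vfield A U X" and Y: "smooth_vfield A U Y" and f: "smooth_fun A U f"
  shows "lie_bracket A X (\<lambda>q. f q *\<^sub>R Y q) p = X p f *\<^sub>R Y p + f p *\<^sub>R lie_bracket A X Y p"
proof
  fix h show "lie_bracket A X (\<lambda>q. f q *\<^sub>R Y q) p h = (X p f *\<^sub>R Y p + f p *\<^sub>R lie_bracket A X Y p) h"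
  proof (cases "smooth_near A p h")
    case True
    show ?thesis
      using tangent_apply_mult[OF smooth_vfieldD[OF X U(2)] smooth_nearI[OF U f] smooth_vfield_apply_near[OF Y U True]]
      by (simp add: lie_bracket_apply[OF True] scaleR_fun_def algebra_simps)
  next
    case False
    then show ?thesis using tangent_outside[OF smooth_vfieldD[OF Y U(2)] False]
      by (simp add: lie_bracket_def scaleR_fun_def)
  qed
qed

lemma lie_bracket_cong_right:
  assumes X: "smooth_vfield A U X" and e: "\<And>q. q \<in> U \<Longrightarrow> Y q = Z q"
  shows "lie_bracket A X Y p = lie_bracket A X Z p"
proof
  fix h show "lie_bracket A X Y p h = lie_bracket A X Z p h"
    using tangent_apply_cong[OF smooth_vfieldD[OF X U(2)] U, of "\<lambda>q. Y q h" "\<lambda>q. Z q h"] e[OF U(2)] e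
    by (simp add: lie_bracket_def)
qed

lemma lie_bracket_add_left:
  assumes "smooth_vfield A U X" "smooth_vfield A U Y" "smooth_vfield A U Z"
  shows "lie_bracket A (\<lambda>q. X q + Y q) Z p = lie_bracket A X Z p + lie_bracket A Y Z p"
  using lie_bracket_add_right[OF assms(3,1,2)]
  unfolding lie_bracket_antisym[of _ Z] by simp

lemma lie_bracket_scale_left:
  assumes "smooth_vfield A U X" "smooth_vfield A U Y" "smooth_fun A U f"
  shows "lie_bracket A (\<lambda>q. f q *\<^sub>R X q) Y p = f p *\<^sub>R lie_bracket A X Y p - Y p f *\<^sub>R X p"
  using lie_bracket_scale_right[OF assms(2,1,3)]
  unfolding lie_bracket_antisym[of _ Y] by simp

end

lemma tangent_lie_bracket:
  "open U \<Longrightarrow> p \<in> U \<Longrightarrow> smooth_vfield A U X \<Longrightarrow> smooth_vfield A U Y \<Longrightarrow> lie_bracket A X Y p \<in> tangent_space A p"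
  using smooth_vfieldD[OF smooth_vfield_lie_bracket] by blast

end

section \<open>The Levi-Civita connection\<close>

lemma scaleR_fun_apply: "(c *\<^sub>R f) x = c *\<^sub>R f x"
  by (simp add: scaleR_fun_def)

locale riemannian_manifold = smooth_manifold A for A :: "'m::t2_space chart set" +
  fixes g :: "'m metric"
  assumes metric: "riemannian_metric A g"
begin

lemma metric_sym: "u \<in> tangent_space A p \<Longrightarrow> v \<in> tangent_space A p \<Longrightarrow> g p u v = g p v u"
  using metric unfolding riemannian_metric_def by blast

lemma metric_lin_left:
  "u \<in> tangent_space A p \<Longrightarrow> v \<in> tangent_space A p \<Longrightarrow> w \<in> tangent_space A p \<Longrightarrow>
    g p (a *\<^sub>R u + b *\<^sub>R v) w = a * g p u w + b * g p v w"
  using metric unfolding riemannian_metric_def by blast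

lemma metric_pos: "u \<in> tangent_space A p \<Longrightarrow> u \<noteq> 0 \<Longrightarrow> g p u u > 0"
  using metric unfolding riemannian_metric_def by blast

lemma smooth_fun_metric:
  "open U \<Longrightarrow> smooth_vfield A U X \<Longrightarrow> smooth_vfield A U Y \<Longrightarrow> smooth_fun A U (\<lambda>p. g p (X p) (Y p))"
  using metric unfolding riemannian_metric_def by blast

lemma metric_add_left:
  "u \<in> tangent_space A p \<Longrightarrow> v \<in> tangent_space A p \<Longrightarrow> w \<in> tangent_space A p \<Longrightarrow>
    g p (u + v) w = g p u w + g p v w"
  using metric_lin_left[of u p v w 1 1] by simp

lemma metric_scale_left:
  "u \<in> tangent_space A p \<Longrightarrow> w \<in> tangent_space A p \<Longrightarrow> g p (a *\<^sub>R u) w = a * g p u w"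
  using metric_lin_left[of u p u w a 0] by simp

lemma metric_diff_left:
  "u \<in> tangent_space A p \<Longrightarrow> v \<in> tangent_space A p \<Longrightarrow> w \<in> tangent_space A p \<Longrightarrow>
    g p (u - v) w = g p u w - g p v w"
  using metric_lin_left[of u p v w 1 "-1"] by simp

lemma metric_zero_left: "w \<in> tangent_space A p \<Longrightarrow> g p 0 w = 0"
  using metric_scale_left[of w p w 0] by simp

lemma metric_add_right:
  "u \<in> tangent_space A p \<Longrightarrow> v \<in> tangent_space A p \<Longrightarrow> w \<in> tangent_space A p \<Longrightarrow>
    g p w (u + v) = g p w u + g p w v"
  by (simp only: metric_sym[of w p] tangent_add metric_add_left)

lemma metric_scale_right:
  "u \<in> tangent_space A p \<Longrightarrow> w \<in> tangent_space A p \<Longrightarrow> g p w (a *\<^sub>R u) = a * g p w u"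
  by (simp only: metric_sym[of w p] tangent_scale metric_scale_left)

lemma metric_diff_right:
  "u \<in> tangent_space A p \<Longrightarrow> v \<in> tangent_space A p \<Longrightarrow> w \<in> tangent_space A p \<Longrightarrow>
    g p w (u - v) = g p w u - g p w v"
  by (simp only: metric_sym[of w p] tangent_diff metric_diff_left)

lemma metric_zero_right: "w \<in> tangent_space A p \<Longrightarrow> g p w 0 = 0"
  by (simp only: metric_sym[of w p] tangent_zero metric_zero_left)

lemma metric_sum_left:
  assumes w: "w \<in> tangent_space A p"
  shows "(\<And>i. i \<in> I \<Longrightarrow> u i \<in> tangent_space A p) \<Longrightarrow> g p (\<Sum>i\<in>I. u i) w = (\<Sum>i\<in>I. g p (u i) w)"
proof (induction I rule: infinite_finite_induct)
  case (insert i I)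
  then have "g p (u i + (\<Sum>i\<in>I. u i)) w = g p (u i) w + (\<Sum>i\<in>I. g p (u i) w)"
    by (subst metric_add_left) (auto intro: tangent_sum w)
  then show ?case by (simp only: sum.insert[OF insert.hyps(1,2)])
qed (simp_all only: sum.infinite sum.empty not_False_eq_True metric_zero_left[OF w])

lemmas metric_linear = metric_add_left metric_scale_left metric_diff_left
  metric_add_right metric_scale_right metric_diff_right

text \<open>Of an orthonormal frame only the reconstruction formula is recorded. The Koszul formula
  below yields inner products with the frame vectors, and reconstruction turns these into a
  vector.\<close>

definition parseval_frame :: "'m set \<Rightarrow> (nat \<Rightarrow> 'm vfield) \<Rightarrow> bool" where
  "parseval_frame U e \<longleftrightarrow> open U \<and> (\<forall>k<3. smooth_vfield A U (e k)) \<and>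
     (\<forall>q\<in>U. \<forall>u\<in>tangent_space A q. u = (\<Sum>k<3. g q u (e k q) *\<^sub>R e k q))"

lemma
  assumes "parseval_frame U e"
  shows parseval_frame_open: "open U"
    and parseval_frame_smooth: "k < 3 \<Longrightarrow> smooth_vfield A U (e k)"
    and parseval_frame_expand: "q \<in> U \<Longrightarrow> u \<in> tangent_space A q \<Longrightarrow> u = (\<Sum>k<3. g q u (e k q) *\<^sub>R e k q)"
  using assms unfolding parseval_frame_def by blast+

lemma parseval_frame_eqI:
  assumes e: "parseval_frame U e" "p \<in> U" and u: "u \<in> tangent_space A p" and v: "v \<in> tangent_space A p"
    and eq: "\<And>k. k < 3 \<Longrightarrow> g p u (e k p) = g p v (e k p)"
  shows "u = v"
proof -
  have "u = (\<Sum>k<3. g p u (e k p) *\<^sub>R e k p)" "v = (\<Sum>k<3. g p v (e k p) *\<^sub>R e k p)"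
    by (rule parseval_frame_expand[OF e u], rule parseval_frame_expand[OF e v])
  moreover have "(\<Sum>k<3. g p u (e k p) *\<^sub>R e k p) = (\<Sum>k<3. g p v (e k p) *\<^sub>R e k p)"
    using eq by (intro sum.cong) simp_all
  ultimately show ?thesis by simp
qed

lemma parseval_frame_subset: "parseval_frame U e \<Longrightarrow> open V \<Longrightarrow> V \<subseteq> U \<Longrightarrow> parseval_frame V e"
  unfolding parseval_frame_def using smooth_vfield_subset[of U _ V] by blast

text \<open>This is the right-hand side of Koszul's formula: its value is
  \<open>2 * g p (D X Y p) (Z p)\<close> for a torsion-free connection \<open>D\<close> compatible
  with the metric.\<close>

definition koszul :: "'m vfield \<Rightarrow> 'm vfield \<Rightarrow> 'm vfield \<Rightarrow> 'm \<Rightarrow> real" where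
  "koszul X Y Z p = X p (\<lambda>q. g q (Y q) (Z q)) + Y p (\<lambda>q. g q (X q) (Z q)) - Z p (\<lambda>q. g q (X q) (Y q))
     + g p (lie_bracket A X Y p) (Z p) - g p (lie_bracket A X Z p) (Y p) - g p (lie_bracket A Y Z p) (X p)"

lemma smooth_fun_koszul:
  assumes "open U" "smooth_vfield A U X" "smooth_vfield A U Y" "smooth_vfield A U Z"
  shows "smooth_fun A U (koszul X Y Z)"
proof -
  note m = smooth_fun_metric[OF assms(1)] and b = smooth_vfield_lie_bracket[OF assms(1)]
  show ?thesis
    unfolding koszul_def[abs_def]
    by (rule smooth_fun_diff[OF assms(1) smooth_fun_diff[OF assms(1) smooth_fun_add[OF assms(1)
          smooth_fun_diff[OF assms(1) smooth_fun_add[OF assms(1)]]]]]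
        smooth_vfield_apply'[OF _ assms(1) m] m b assms)+
qed

section \<open>Algebraic identities of the Koszul expression\<close>

context
  fixes U :: "'m set" and p
  assumes U: "open U" "p \<in> U"
begin

text \<open>All contributions except the one of \<open>[X,Y]\<close> are symmetric in
  \<open>X\<close> and \<open>Y\<close>. After halving, this becomes the torsion axiom.\<close>

lemma koszul_torsion:
  assumes X: "smooth_vfield A U X" and Y: "smooth_vfield A U Y" and Z: "smooth_vfield A U Z"
  shows "koszul X Y Z p - koszul Y X Z p = 2 * g p (lie_bracket A X Y p) (Z p)"
proof -
  have "Z p (\<lambda>q. g q (X q) (Y q)) = Z p (\<lambda>q. g q (Y q) (X q))"
    by (rule tangent_apply_cong[OF smooth_vfieldD[OF Z U(2)] U])
      (intro metric_sym smooth_vfieldD[OF X] smooth_vfieldD[OF Y])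
  moreover have "g p (lie_bracket A Y X p) (Z p) = - g p (lie_bracket A X Y p) (Z p)"
    using metric_scale_left[OF tangent_lie_bracket[OF U X Y] smooth_vfieldD[OF Z U(2)], of "-1"]
    by (simp add: lie_bracket_antisym[of Y X])
  ultimately show ?thesis by (simp add: koszul_def)
qed

text \<open>All contributions except the first derivative are antisymmetric in \<open>Y\<close> and
  \<open>Z\<close>. After halving, this becomes compatibility with the metric.\<close>

lemma koszul_metric:
  assumes X: "smooth_vfield A U X" and Y: "smooth_vfield A U Y" and Z: "smooth_vfield A U Z"
  shows "koszul X Y Z p + koszul X Z Y p = 2 * X p (\<lambda>q. g q (Y q) (Z q))"
proof -
  have s: "V p (\<lambda>q. g q (V' q) (V'' q)) = V p (\<lambda>q. g q (V'' q) (V' q))"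
    if "smooth_vfield A U V" "smooth_vfield A U V'" "smooth_vfield A U V''" for V V' V''
    by (rule tangent_apply_cong[OF smooth_vfieldD[OF that(1) U(2)] U])
      (intro metric_sym smooth_vfieldD[OF that(2)] smooth_vfieldD[OF that(3)])
  have b: "g p (lie_bracket A V V' p) (V'' p) = - g p (lie_bracket A V' V p) (V'' p)"
    if "smooth_vfield A U V" "smooth_vfield A U V'" "smooth_vfield A U V''" for V V' V''
    using metric_scale_left[OF tangent_lie_bracket[OF U that(2,1)] smooth_vfieldD[OF that(3) U(2)], of "-1"]
    by (simp add: lie_bracket_antisym[of V V'])
  show ?thesis unfolding koszul_def
    using s[OF X Y Z] s[OF Y X Z] s[OF Z X Y] b[OF Y Z X] by simp
qed

lemma koszul_add_right:
  assumes X: "smooth_vfield A U X" and Y: "smooth_vfield A U Y" and Z: "smooth_vfield A U Z" and W: "smooth_vfield A U W"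
  shows "koszul X Y (\<lambda>q. Z q + W q) p = koszul X Y Z p + koszul X Y W p"
proof -
  note T = smooth_vfieldD[OF X U(2)] smooth_vfieldD[OF Y U(2)] smooth_vfieldD[OF Z U(2)] smooth_vfieldD[OF W U(2)]
  have d: "V p (\<lambda>q. g q (V' q) (Z q + W q)) = V p (\<lambda>q. g q (V' q) (Z q)) + V p (\<lambda>q. g q (V' q) (W q))"
    if V: "smooth_vfield A U V" "smooth_vfield A U V'" for V V'
  proof -
    have "V p (\<lambda>q. g q (V' q) (Z q + W q)) = V p (\<lambda>q. g q (V' q) (Z q) + g q (V' q) (W q))"
      by (rule tangent_apply_cong[OF smooth_vfieldD[OF V(1) U(2)] U])
        (intro metric_add_right smooth_vfieldD[OF V(2)] smooth_vfieldD[OF Z] smooth_vfieldD[OF W])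
    also have "\<dots> = V p (\<lambda>q. g q (V' q) (Z q)) + V p (\<lambda>q. g q (V' q) (W q))"
      by (rule tangent_apply_add[OF smooth_vfieldD[OF V(1) U(2)]])
        (rule smooth_nearI[OF U smooth_fun_metric[OF U(1) V(2)]], fact)+
    finally show ?thesis .
  qed
  show ?thesis
    unfolding koszul_def
    by (simp add: d[OF X Y] d[OF Y X] lie_bracket_add_right[OF U X Z W] lie_bracket_add_right[OF U Y Z W]
        metric_linear T tangent_lie_bracket[OF U] X Y Z W)
qed

text \<open>The terms \<open>X p f\<close> and \<open>Y p f\<close> produced by the first two
  derivatives cancel against those produced by the brackets of \<open>X\<close> and \<open>Y\<close>
  with \<open>f Z\<close>. Tensoriality in this slot is what allows the expression to be represented
  by a vector.\<close>

lemma koszul_scale_right: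
  assumes X: "smooth_vfield A U X" and Y: "smooth_vfield A U Y" and Z: "smooth_vfield A U Z" and f: "smooth_fun A U f"
  shows "koszul X Y (\<lambda>q. f q *\<^sub>R Z q) p = f p * koszul X Y Z p"
proof -
  note T = smooth_vfieldD[OF X U(2)] smooth_vfieldD[OF Y U(2)] smooth_vfieldD[OF Z U(2)]
  have d: "V p (\<lambda>q. g q (V' q) (f q *\<^sub>R Z q)) = V p f * g p (V' p) (Z p) + f p * V p (\<lambda>q. g q (V' q) (Z q))"
    if V: "smooth_vfield A U V" "smooth_vfield A U V'" for V V'
  proof -
    have "V p (\<lambda>q. g q (V' q) (f q *\<^sub>R Z q)) = V p (\<lambda>q. f q * g q (V' q) (Z q))"
      by (rule tangent_apply_cong[OF smooth_vfieldD[OF V(1) U(2)] U])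
        (intro metric_scale_right smooth_vfieldD[OF V(2)] smooth_vfieldD[OF Z])
    also have "\<dots> = V p f * g p (V' p) (Z p) + f p * V p (\<lambda>q. g q (V' q) (Z q))"
      by (rule tangent_apply_mult[OF smooth_vfieldD[OF V(1) U(2)] smooth_nearI[OF U f]
            smooth_nearI[OF U smooth_fun_metric[OF U(1) V(2) Z]]])
    finally show ?thesis .
  qed
  show ?thesis
    unfolding koszul_def
    by (simp add: d[OF X Y] d[OF Y X] lie_bracket_scale_right[OF U X Z f] lie_bracket_scale_right[OF U Y Z f]
        metric_linear T tangent_lie_bracket[OF U] tangent_scale X Y Z scaleR_fun_apply
        metric_sym[OF T(1,2)] metric_sym[OF T(1,3)] metric_sym[OF T(2,3)] algebra_simps)
qed

lemma koszul_scale_left: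
  assumes X: "smooth_vfield A U X" and Y: "smooth_vfield A U Y" and Z: "smooth_vfield A U Z" and f: "smooth_fun A U f"
  shows "koszul (\<lambda>q. f q *\<^sub>R X q) Y Z p = f p * koszul X Y Z p"
proof -
  note T = smooth_vfieldD[OF X U(2)] smooth_vfieldD[OF Y U(2)] smooth_vfieldD[OF Z U(2)]
  have d: "V p (\<lambda>q. g q (f q *\<^sub>R X q) (V' q)) = V p f * g p (X p) (V' p) + f p * V p (\<lambda>q. g q (X q) (V' q))"
    if V: "smooth_vfield A U V" "smooth_vfield A U V'" for V V'
  proof -
    have "V p (\<lambda>q. g q (f q *\<^sub>R X q) (V' q)) = V p (\<lambda>q. f q * g q (X q) (V' q))"
      by (rule tangent_apply_cong[OF smooth_vfieldD[OF V(1) U(2)] U])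
        (intro metric_scale_left smooth_vfieldD[OF V(2)] smooth_vfieldD[OF X])
    also have "\<dots> = V p f * g p (X p) (V' p) + f p * V p (\<lambda>q. g q (X q) (V' q))"
      by (rule tangent_apply_mult[OF smooth_vfieldD[OF V(1) U(2)] smooth_nearI[OF U f]
            smooth_nearI[OF U smooth_fun_metric[OF U(1) X V(2)]]])
    finally show ?thesis .
  qed
  show ?thesis
    unfolding koszul_def
    by (simp add: d[OF Y Z] d[OF Z Y] lie_bracket_scale_left[OF U X Z f] lie_bracket_scale_left[OF U X Y f]
        metric_linear T tangent_lie_bracket[OF U] tangent_scale X Y Z scaleR_fun_apply
        metric_sym[OF T(1,2)] metric_sym[OF T(1,3)] metric_sym[OF T(2,3)] algebra_simps)
qed

lemma koszul_add_left:
  assumes X: "smooth_vfield A U X" and Y: "smooth_vfield A U Y" and Z: "smooth_vfield A U Z" and W: "smooth_vfield A U W"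
  shows "koszul (\<lambda>q. X q + W q) Y Z p = koszul X Y Z p + koszul W Y Z p"
proof -
  note T = smooth_vfieldD[OF X U(2)] smooth_vfieldD[OF Y U(2)] smooth_vfieldD[OF Z U(2)] smooth_vfieldD[OF W U(2)]
  have d: "V p (\<lambda>q. g q (X q + W q) (V' q)) = V p (\<lambda>q. g q (X q) (V' q)) + V p (\<lambda>q. g q (W q) (V' q))"
    if V: "smooth_vfield A U V" "smooth_vfield A U V'" for V V'
  proof -
    have "V p (\<lambda>q. g q (X q + W q) (V' q)) = V p (\<lambda>q. g q (X q) (V' q) + g q (W q) (V' q))"
      by (rule tangent_apply_cong[OF smooth_vfieldD[OF V(1) U(2)] U])
        (intro metric_add_left smooth_vfieldD[OF V(2)] smooth_vfieldD[OF X] smooth_vfieldD[OF W])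
    also have "\<dots> = V p (\<lambda>q. g q (X q) (V' q)) + V p (\<lambda>q. g q (W q) (V' q))"
      by (rule tangent_apply_add[OF smooth_vfieldD[OF V(1) U(2)]])
        (rule smooth_nearI[OF U smooth_fun_metric[OF U(1) _ V(2)]], fact)+
    finally show ?thesis .
  qed
  show ?thesis
    unfolding koszul_def
    by (simp add: d[OF Y Z] d[OF Z Y] lie_bracket_add_left[OF U X W Y] lie_bracket_add_left[OF U X W Z]
        metric_linear T tangent_lie_bracket[OF U] X Y Z W)
qed

lemma koszul_add_middle:
  assumes X: "smooth_vfield A U X" and Y: "smooth_vfield A U Y" and Z: "smooth_vfield A U Z" and W: "smooth_vfield A U W"
  shows "koszul X (\<lambda>q. Y q + W q) Z p = koszul X Y Z p + koszul X W Z p"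
proof -
  note T = smooth_vfieldD[OF X U(2)] smooth_vfieldD[OF Y U(2)] smooth_vfieldD[OF Z U(2)] smooth_vfieldD[OF W U(2)]
  have "koszul X (\<lambda>q. Y q + W q) Z p = koszul (\<lambda>q. Y q + W q) X Z p + 2 * g p (lie_bracket A X (\<lambda>q. Y q + W q) p) (Z p)"
    using koszul_torsion[OF X smooth_vfield_add[OF U(1) Y W] Z] by simp
  also have "\<dots> = koszul Y X Z p + 2 * g p (lie_bracket A X Y p) (Z p) + (koszul W X Z p + 2 * g p (lie_bracket A X W p) (Z p))"
    by (simp add: koszul_add_left[OF Y X Z W] lie_bracket_add_right[OF U X Y W] metric_linear tangent_lie_bracket[OF U] T X Y W)
  also have "\<dots> = koszul X Y Z p + koszul X W Z p"
    using koszul_torsion[OF X Y Z] koszul_torsion[OF X W Z] by simp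
  finally show ?thesis .
qed

text \<open>The torsion identity exchanges the first two slots, so tensoriality in the first one and
  the Leibniz rule of the bracket suffice. The factor 2 disappears when the connection is defined as
  half the expression.\<close>

lemma koszul_scale_middle:
  assumes X: "smooth_vfield A U X" and Y: "smooth_vfield A U Y" and Z: "smooth_vfield A U Z" and f: "smooth_fun A U f"
  shows "koszul X (\<lambda>q. f q *\<^sub>R Y q) Z p = 2 * (X p f * g p (Y p) (Z p)) + f p * koszul X Y Z p"
proof -
  note T = smooth_vfieldD[OF X U(2)] smooth_vfieldD[OF Y U(2)] smooth_vfieldD[OF Z U(2)]
  have "koszul X (\<lambda>q. f q *\<^sub>R Y q) Z p = koszul (\<lambda>q. f q *\<^sub>R Y q) X Z p + 2 * g p (lie_bracket A X (\<lambda>q. f q *\<^sub>R Y q) p) (Z p)"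
    using koszul_torsion[OF X smooth_vfield_scale[OF U(1) f Y] Z] by simp
  also have "\<dots> = 2 * (X p f * g p (Y p) (Z p)) + f p * (koszul Y X Z p + 2 * g p (lie_bracket A X Y p) (Z p))"
    by (simp add: koszul_scale_left[OF Y X Z f] lie_bracket_scale_right[OF U X Y f] metric_linear tangent_lie_bracket[OF U]
        tangent_scale T X Y algebra_simps)
  also have "koszul Y X Z p + 2 * g p (lie_bracket A X Y p) (Z p) = koszul X Y Z p"
    using koszul_torsion[OF X Y Z] by simp
  finally show ?thesis .
qed

lemma koszul_sum_right:
  assumes X: "smooth_vfield A U X" and Y: "smooth_vfield A U Y"
  shows "(\<And>i. i \<in> I \<Longrightarrow> smooth_vfield A U (Z i)) \<Longrightarrow> koszul X Y (\<lambda>q. \<Sum>i\<in>I. Z i q) p = (\<Sum>i\<in>I. koszul X Y (Z i) p)"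
proof -
  have 0: "koszul X Y (\<lambda>q. 0) p = 0"
    using koszul_scale_right[OF X Y X smooth_fun_const[OF U(1), of 0]] by simp
  show "(\<And>i. i \<in> I \<Longrightarrow> smooth_vfield A U (Z i)) \<Longrightarrow> ?thesis"
  proof (induction I rule: infinite_finite_induct)
    case (insert i I)
    then have "koszul X Y (\<lambda>q. Z i q + (\<Sum>i\<in>I. Z i q)) p = koszul X Y (Z i) p + (\<Sum>i\<in>I. koszul X Y (Z i) p)"
      by (subst koszul_add_right[OF X Y]) (auto intro!: smooth_vfield_sum U)
    then show ?case by (simp only: sum.insert[OF insert.hyps(1,2)])
  qed (simp_all only: sum.infinite sum.empty not_False_eq_True 0)
qed

lemma koszul_cong_right:
  assumes X: "smooth_vfield A U X" and Y: "smooth_vfield A U Y" and e: "\<And>q. q \<in> U \<Longrightarrow> Z q = W q"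
  shows "koszul X Y Z p = koszul X Y W p"
proof -
  have d: "V p (\<lambda>q. g q (V' q) (Z q)) = V p (\<lambda>q. g q (V' q) (W q))" if V: "smooth_vfield A U V" for V V'
    by (rule tangent_apply_cong[OF smooth_vfieldD[OF V U(2)] U]) (simp add: e)
  have "lie_bracket A X Z p = lie_bracket A X W p" "lie_bracket A Y Z p = lie_bracket A Y W p"
    by (rule lie_bracket_cong_right[OF U X e] lie_bracket_cong_right[OF U Y e], assumption)+
  then show ?thesis
    unfolding koszul_def e[OF U(2)] d[OF X] d[OF Y] by simp
qed

end

end

text \<open>Local frames are assumed because the metrics of interest bring them along:
  \<open>scaled_orthonormal\<close> discharges the assumption.\<close>

locale framed_riemannian_manifold = riemannian_manifold A g
  for A :: "'m::t2_space chart set" and g :: "'m metric" +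
  assumes frames: "\<And>p. \<exists>U e. p \<in> U \<and> parseval_frame U e"
begin

section \<open>Construction of the connection\<close>

definition frame_at :: "'m \<Rightarrow> nat \<Rightarrow> 'm vfield" where
  "frame_at p = (SOME e. \<exists>U. p \<in> U \<and> parseval_frame U e)"

text \<open>The frame is chosen anew at each point, so the definition makes sense for all pairs of
  fields at once, but neither smoothness nor independence of the choice can be read off; both come
  from \<open>lc_connection_koszul\<close>.\<close>

definition lc_connection :: "'m connection" where
  "lc_connection X Y = (\<lambda>p. \<Sum>k<3. (koszul X Y (frame_at p k) p / 2) *\<^sub>R frame_at p k p)"

lemma frame_at: "\<exists>U. p \<in> U \<and> parseval_frame U (frame_at p)"
proof -
  have "\<exists>e U. p \<in> U \<and> parseval_frame U e" using frames[of p] by blast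
  from someI_ex[OF this] show ?thesis unfolding frame_at_def .
qed

lemma lc_connection_tangent: "lc_connection X Y p \<in> tangent_space A p"
proof -
  obtain U where U: "p \<in> U" "parseval_frame U (frame_at p)" using frame_at[of p] by blast
  show ?thesis unfolding lc_connection_def
    by (rule tangent_sum, rule tangent_scale, rule smooth_vfieldD[OF parseval_frame_smooth[OF U(2)] U(1)]) simp
qed

text \<open>Expand \<open>Z\<close> in the chosen frame and use tensoriality of the Koszul
  expression in \<open>Z\<close>. The result no longer mentions the frame and determines the
  vector.\<close>

lemma lc_connection_koszul:
  assumes U: "open U" "p \<in> U" and X: "smooth_vfield A U X" and Y: "smooth_vfield A U Y" and Z: "smooth_vfield A U Z"
  shows "g p (lc_connection X Y p) (Z p) = koszul X Y Z p / 2"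
proof -
  let ?e = "frame_at p"
  obtain V where V: "p \<in> V" "parseval_frame V ?e" using frame_at[of p] by blast
  define W where "W = U \<inter> V"
  have W: "open W" "p \<in> W" "W \<subseteq> U" using U V parseval_frame_open[OF V(2)] by (auto simp: W_def)
  have e: "parseval_frame W ?e"
    by (rule parseval_frame_subset[OF V(2) W(1)]) (simp add: W_def)
  note s = smooth_vfield_subset[OF X W(3)] smooth_vfield_subset[OF Y W(3)] smooth_vfield_subset[OF Z W(3)]
  have es: "smooth_vfield A W (?e k)" if "k < 3" for k by (rule parseval_frame_smooth[OF e that])
  have "koszul X Y Z p = koszul X Y (\<lambda>q. \<Sum>k<3. g q (Z q) (?e k q) *\<^sub>R ?e k q) p"
    by (rule koszul_cong_right[OF W(1,2) s(1,2)])
      (rule parseval_frame_expand[OF e _ smooth_vfieldD[OF s(3)]])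
  also have "\<dots> = (\<Sum>k<3. koszul X Y (\<lambda>q. g q (Z q) (?e k q) *\<^sub>R ?e k q) p)"
    by (rule koszul_sum_right[OF W(1,2) s(1,2)])
      (rule smooth_vfield_scale[OF W(1) smooth_fun_metric[OF W(1) s(3) es] es]; simp)
  also have "\<dots> = (\<Sum>k<3. g p (Z p) (?e k p) * koszul X Y (?e k) p)"
    by (intro sum.cong refl, rule koszul_scale_right[OF W(1,2) s(1,2) es smooth_fun_metric[OF W(1) s(3) es]]; simp)
  finally have K: "koszul X Y Z p = (\<Sum>k<3. g p (Z p) (?e k p) * koszul X Y (?e k) p)" .
  have T: "Z p \<in> tangent_space A p" "\<And>k. k < 3 \<Longrightarrow> ?e k p \<in> tangent_space A p"
    using smooth_vfieldD[OF s(3) W(2)] smooth_vfieldD[OF es W(2)] by auto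
  have "g p (lc_connection X Y p) (Z p) = (\<Sum>k<3. g p ((koszul X Y (?e k) p / 2) *\<^sub>R ?e k p) (Z p))"
    unfolding lc_connection_def by (rule metric_sum_left[OF T(1)]) (auto intro!: tangent_scale T)
  also have "\<dots> = (\<Sum>k<3. g p (Z p) (?e k p) * koszul X Y (?e k) p / 2)"
    by (intro sum.cong refl) (simp add: metric_scale_left T metric_sym[OF T(1)])
  also have "\<dots> = koszul X Y Z p / 2" by (simp add: K sum_divide_distrib)
  finally show ?thesis .
qed

lemma local_frame:
  assumes "open U" "p \<in> U"
  obtains V e where "V \<subseteq> U" "p \<in> V" "open V" "parseval_frame V e"
proof -
  obtain V e where V: "p \<in> V" "parseval_frame V e" using frames[of p] by blast
  have o: "open (U \<inter> V)" using assms(1) parseval_frame_open[OF V(2)] by blast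
  show ?thesis
    by (rule that[OF _ _ o parseval_frame_subset[OF V(2) o]]) (use assms V in auto)
qed

text \<open>By \<open>lc_connection_koszul\<close> the pointwise chosen frames can be replaced, near
  a given point, by one fixed smooth frame in which the coefficients are visibly smooth.\<close>

lemma smooth_vfield_lc_connection:
  assumes U: "open U" and X: "smooth_vfield A U X" and Y: "smooth_vfield A U Y"
  shows "smooth_vfield A U (lc_connection X Y)"
proof (rule smooth_vfield_local)
  fix p assume "p \<in> U"
  then obtain V e where V: "V \<subseteq> U" "p \<in> V" "open V" "parseval_frame V e" using local_frame[OF U] by metis
  note s = smooth_vfield_subset[OF X V(1)] smooth_vfield_subset[OF Y V(1)]
  have es: "smooth_vfield A V (e k)" if "k < 3" for k by (rule parseval_frame_smooth[OF V(4) that])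
  have "smooth_vfield A V (\<lambda>q. \<Sum>k<3. (1/2 * koszul X Y (e k) q) *\<^sub>R e k q)"
    by (rule smooth_vfield_sum[OF V(3)],
        rule smooth_vfield_scale[OF V(3) smooth_fun_cmult[OF V(3) smooth_fun_koszul[OF V(3) s es]] es]; simp)
  then have "smooth_vfield A V (lc_connection X Y)"
  proof (rule smooth_vfield_cong[OF V(3), rotated])
    fix q assume q: "q \<in> V"
    have "lc_connection X Y q = (\<Sum>k<3. g q (lc_connection X Y q) (e k q) *\<^sub>R e k q)"
      by (rule parseval_frame_expand[OF V(4) q lc_connection_tangent])
    also have "\<dots> = (\<Sum>k<3. (1/2 * koszul X Y (e k) q) *\<^sub>R e k q)"
      by (intro sum.cong refl) (simp add: lc_connection_koszul[OF V(3) q s es])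
    finally show "(\<Sum>k<3. (1/2 * koszul X Y (e k) q) *\<^sub>R e k q) = lc_connection X Y q" by simp
  qed
  then show "\<exists>V. open V \<and> p \<in> V \<and> smooth_vfield A V (lc_connection X Y)" using V by blast
qed

text \<open>The test fields live on smaller open sets because the frame fields that separate tangent
  vectors exist only near \<open>p\<close>.\<close>

lemma lc_connection_eqI:
  assumes U: "open U" "p \<in> U" and uv: "u \<in> tangent_space A p" "v \<in> tangent_space A p"
    and eq: "\<And>V Z. open V \<Longrightarrow> p \<in> V \<Longrightarrow> V \<subseteq> U \<Longrightarrow> smooth_vfield A V Z \<Longrightarrow> g p u (Z p) = g p v (Z p)"
  shows "u = v"
proof -
  obtain V e where V: "V \<subseteq> U" "p \<in> V" "open V" "parseval_frame V e" using local_frame[OF U] by metis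
  show ?thesis
    by (rule parseval_frame_eqI[OF V(4,2) uv]) (rule eq[OF V(3,2,1) parseval_frame_smooth[OF V(4)]])
qed

lemma
  assumes U: "open U" and p: "p \<in> U"
    and X: "smooth_vfield A U X" and Y: "smooth_vfield A U Y" and Z: "smooth_vfield A U Z"
  shows lc_connection_add_left: "lc_connection (X + Y) Z p = lc_connection X Z p + lc_connection Y Z p"
    and lc_connection_add_right: "lc_connection X (Y + Z) p = lc_connection X Y p + lc_connection X Z p"
    and lc_connection_torsion: "lc_connection X Y p - lc_connection Y X p = lie_bracket A X Y p"
    and lc_connection_metric:
      "X p (\<lambda>q. g q (Y q) (Z q)) = g p (lc_connection X Y p) (Z p) + g p (Y p) (lc_connection X Z p)"
    and lc_connection_scale_left: "smooth_fun A U h \<Longrightarrow>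
      lc_connection (\<lambda>q. h q *\<^sub>R X q) Y p = h p *\<^sub>R lc_connection X Y p"
    and lc_connection_scale_right: "smooth_fun A U h \<Longrightarrow>
      lc_connection X (\<lambda>q. h q *\<^sub>R Y q) p = X p h *\<^sub>R Y p + h p *\<^sub>R lc_connection X Y p"
proof -
  note T = smooth_vfieldD[OF X p] smooth_vfieldD[OF Y p] smooth_vfieldD[OF Z p] lc_connection_tangent
  have K: "g p (lc_connection X' Y' p) (W p) = koszul X' Y' W p / 2"
    if "open V" "p \<in> V" "V \<subseteq> U" "smooth_vfield A V W" "smooth_vfield A U X'" "smooth_vfield A U Y'" for V W X' Y'
    by (rule lc_connection_koszul[OF that(1,2)]) (use that smooth_vfield_subset in blast)+
  note sub = smooth_vfield_subset
  show "lc_connection (X + Y) Z p = lc_connection X Z p + lc_connection Y Z p"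
  proof (rule lc_connection_eqI[OF U p])
    fix V W assume V: "open V" "p \<in> V" "V \<subseteq> U" "smooth_vfield A V W"
    note TW = smooth_vfieldD[OF V(4,2)]
    show "g p (lc_connection (X + Y) Z p) (W p) = g p (lc_connection X Z p + lc_connection Y Z p) (W p)"
      unfolding metric_add_left[OF T(4) T(4) TW] plus_fun_def[of X Y]
        K[OF V smooth_vfield_add[OF U X Y] Z] K[OF V X Z] K[OF V Y Z]
        koszul_add_left[OF V(1,2) sub[OF X V(3)] sub[OF Z V(3)] V(4) sub[OF Y V(3)]] by simp
  qed (intro T tangent_add)+
  show "lc_connection X (Y + Z) p = lc_connection X Y p + lc_connection X Z p"
  proof (rule lc_connection_eqI[OF U p])
    fix V W assume V: "open V" "p \<in> V" "V \<subseteq> U" "smooth_vfield A V W"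
    note TW = smooth_vfieldD[OF V(4,2)]
    show "g p (lc_connection X (Y + Z) p) (W p) = g p (lc_connection X Y p + lc_connection X Z p) (W p)"
      unfolding metric_add_left[OF T(4) T(4) TW] plus_fun_def[of Y Z]
        K[OF V X smooth_vfield_add[OF U Y Z]] K[OF V X Y] K[OF V X Z]
        koszul_add_middle[OF V(1,2) sub[OF X V(3)] sub[OF Y V(3)] V(4) sub[OF Z V(3)]] by simp
  qed (intro T tangent_add)+
  show "lc_connection X Y p - lc_connection Y X p = lie_bracket A X Y p"
  proof (rule lc_connection_eqI[OF U p])
    fix V W assume V: "open V" "p \<in> V" "V \<subseteq> U" "smooth_vfield A V W"
    note TW = smooth_vfieldD[OF V(4,2)]
    show "g p (lc_connection X Y p - lc_connection Y X p) (W p) = g p (lie_bracket A X Y p) (W p)"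
      unfolding metric_diff_left[OF T(4) T(4) TW] K[OF V X Y] K[OF V Y X]
      using koszul_torsion[OF V(1,2) sub[OF X V(3)] sub[OF Y V(3)] V(4)] by simp
  qed (intro T tangent_diff tangent_lie_bracket[OF U p X Y])+
  show "X p (\<lambda>q. g q (Y q) (Z q)) = g p (lc_connection X Y p) (Z p) + g p (Y p) (lc_connection X Z p)"
    using koszul_metric[OF U p X Y Z] metric_sym[OF T(2) T(4), of X Z] K[OF U p _ Z X Y] K[OF U p _ Y X Z] by simp
  {
    assume h: "smooth_fun A U h"
    show "lc_connection (\<lambda>q. h q *\<^sub>R X q) Y p = h p *\<^sub>R lc_connection X Y p"
    proof (rule lc_connection_eqI[OF U p])
      fix V W assume V: "open V" "p \<in> V" "V \<subseteq> U" "smooth_vfield A V W"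
      note TW = smooth_vfieldD[OF V(4,2)]
      show "g p (lc_connection (\<lambda>q. h q *\<^sub>R X q) Y p) (W p) = g p (h p *\<^sub>R lc_connection X Y p) (W p)"
        unfolding metric_scale_left[OF T(4) TW] K[OF V smooth_vfield_scale[OF U h X] Y] K[OF V X Y]
          koszul_scale_left[OF V(1,2) sub[OF X V(3)] sub[OF Y V(3)] V(4) smooth_fun_subset[OF h V(3)]] by simp
    qed (intro T tangent_scale)+
    show "lc_connection X (\<lambda>q. h q *\<^sub>R Y q) p = X p h *\<^sub>R Y p + h p *\<^sub>R lc_connection X Y p"
    proof (rule lc_connection_eqI[OF U p])
      fix V W assume V: "open V" "p \<in> V" "V \<subseteq> U" "smooth_vfield A V W"
      note TW = smooth_vfieldD[OF V(4,2)]
      show "g p (lc_connection X (\<lambda>q. h q *\<^sub>R Y q) p) (W p) = g p (X p h *\<^sub>R Y p + h p *\<^sub>R lc_connection X Y p) (W p)"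
        unfolding metric_lin_left[OF T(2) T(4) TW] K[OF V X smooth_vfield_scale[OF U h Y]] K[OF V X Y]
          koszul_scale_middle[OF V(1,2) sub[OF X V(3)] sub[OF Y V(3)] V(4) smooth_fun_subset[OF h V(3)]] by simp
    qed (intro T tangent_scale tangent_add)+
  }
qed

text \<open>This is the existence half of the fundamental theorem of Riemannian geometry. The
  curvature computations that follow start from an arbitrary connection satisfying the axioms; this
  supplies one.\<close>

lemma levi_civita_lc_connection: "levi_civita A g lc_connection"
proof -
  have "affine_connection A lc_connection"
    unfolding affine_connection_def
    by (intro allI impI conjI ballI; elim conjE)
      (rule smooth_vfield_lc_connection lc_connection_add_left lc_connection_add_right
        lc_connection_scale_left lc_connection_scale_right; assumption)+
  then show ?thesis
    unfolding levi_civita_def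
    by (intro conjI allI impI ballI; (elim conjE)?)
      (assumption | (rule lc_connection_torsion lc_connection_metric; assumption))+
qed

end

section \<open>The curvature tensor\<close>

locale levi_civita_manifold = riemannian_manifold A g
  for A :: "'m::t2_space chart set" and g :: "'m metric" +
  fixes D :: "'m connection"
  assumes lc: "levi_civita A g D"
begin

abbreviation Rm :: "'m vfield \<Rightarrow> 'm vfield \<Rightarrow> 'm vfield \<Rightarrow> 'm vfield" where
  "Rm \<equiv> curvature A D"

lemma curvature_apply:
  "Rm X Y Z p = D X (D Y Z) p - D Y (D X Z) p - D (lie_bracket A X Y) Z p"
  by (simp add: curvature_def)

lemma smooth_vfield_connection:
  assumes "open U" "smooth_vfield A U X" "smooth_vfield A U Y"
  shows "smooth_vfield A U (D X Y)"
  using lc assms smooth_fun_const[OF assms(1), of 0] unfolding levi_civita_def affine_connection_def by blast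

context
  fixes U :: "'m set" and p
  assumes U: "open U" "p \<in> U"
begin

lemma connection_affine:
  assumes "smooth_vfield A U X" "smooth_vfield A U Y" "smooth_vfield A U Z" "smooth_fun A U h"
  shows "D (X + Y) Z p = D X Z p + D Y Z p \<and>
           D (\<lambda>q. h q *\<^sub>R X q) Y p = h p *\<^sub>R D X Y p \<and>
           D X (Y + Z) p = D X Y p + D X Z p \<and>
           D X (\<lambda>q. h q *\<^sub>R Y q) p = X p h *\<^sub>R Y p + h p *\<^sub>R D X Y p"
  using lc assms U unfolding levi_civita_def affine_connection_def by blast

lemma connection_add_left:
  assumes "smooth_vfield A U X" "smooth_vfield A U Y" "smooth_vfield A U Z"
  shows "D (\<lambda>q. X q + Y q) Z p = D X Z p + D Y Z p"
  using connection_affine[OF assms smooth_fun_const[OF U(1), of 0]] by (simp add: plus_fun_def[of X Y])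

lemma connection_add_right:
  assumes "smooth_vfield A U X" "smooth_vfield A U Y" "smooth_vfield A U Z"
  shows "D X (\<lambda>q. Y q + Z q) p = D X Y p + D X Z p"
  using connection_affine[OF assms smooth_fun_const[OF U(1), of 0]] by (simp add: plus_fun_def[of Y Z])

lemma connection_scale_left:
  assumes "smooth_vfield A U X" "smooth_vfield A U Y" "smooth_fun A U h"
  shows "D (\<lambda>q. h q *\<^sub>R X q) Y p = h p *\<^sub>R D X Y p"
  using connection_affine[OF assms(1,2,2,3)] by blast

lemma connection_scale_right:
  assumes "smooth_vfield A U X" "smooth_vfield A U Y" "smooth_fun A U h"
  shows "D X (\<lambda>q. h q *\<^sub>R Y q) p = X p h *\<^sub>R Y p + h p *\<^sub>R D X Y p"
  using connection_affine[OF assms(1,2,2,3)] by blast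

lemma connection_torsion:
  assumes "smooth_vfield A U X" "smooth_vfield A U Y"
  shows "lie_bracket A X Y p = D X Y p - D Y X p"
  using lc U assms unfolding levi_civita_def by metis

lemma connection_metric:
  assumes "smooth_vfield A U X" "smooth_vfield A U Y" "smooth_vfield A U Z"
  shows "X p (\<lambda>q. g q (Y q) (Z q)) = g p (D X Y p) (Z p) + g p (Y p) (D X Z p)"
  using lc U assms unfolding levi_civita_def by blast

lemma connection_tangent:
  "smooth_vfield A U X \<Longrightarrow> smooth_vfield A U Y \<Longrightarrow> D X Y p \<in> tangent_space A p"
  by (rule smooth_vfieldD[OF smooth_vfield_connection[OF U(1)] U(2)])

text \<open>The indicator function of \<open>U\<close> is smooth on \<open>U\<close>; multiplying by it makes the fields globally equal.\<close>

lemma connection_cong_left: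
  assumes X: "smooth_vfield A U X" and Y: "smooth_vfield A U Y" and e: "\<And>q. q \<in> U \<Longrightarrow> X q = X' q"
  shows "D X Y p = D X' Y p"
proof -
  let ?h = "indicator U :: 'm \<Rightarrow> real"
  have h: "smooth_fun A U ?h"
    by (rule smooth_fun_cong[OF U(1) _ smooth_fun_const[OF U(1), of 1]]) simp
  have X': "smooth_vfield A U X'" by (rule smooth_vfield_cong[OF U(1) e X])
  have "(\<lambda>q. ?h q *\<^sub>R X q) = (\<lambda>q. ?h q *\<^sub>R X' q)" using e by (auto simp: indicator_def fun_eq_iff scaleR_fun_def)
  then show ?thesis
    using connection_scale_left[OF X Y h] connection_scale_left[OF X' Y h] U by simp
qed

lemma connection_cong_right:
  assumes X: "smooth_vfield A U X" and Y: "smooth_vfield A U Y" and e: "\<And>q. q \<in> U \<Longrightarrow> Y q = Y' q"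
  shows "D X Y p = D X Y' p"
proof -
  let ?h = "indicator U :: 'm \<Rightarrow> real"
  have h: "smooth_fun A U ?h"
    by (rule smooth_fun_cong[OF U(1) _ smooth_fun_const[OF U(1), of 1]]) simp
  have Y': "smooth_vfield A U Y'" by (rule smooth_vfield_cong[OF U(1) e Y])
  have "(\<lambda>q. ?h q *\<^sub>R Y q) = (\<lambda>q. ?h q *\<^sub>R Y' q)" using e by (auto simp: indicator_def fun_eq_iff scaleR_fun_def)
  \<comment> \<open>The indicator is constant 1 near \<open>p\<close>, so the derivative term of the
    Leibniz rule vanishes.\<close>
  moreover have "X p ?h = X p (\<lambda>q. 1)"
    by (rule tangent_apply_cong[OF smooth_vfieldD[OF X U(2)] U]) simp
  ultimately show ?thesis
    using connection_scale_right[OF X Y h] connection_scale_right[OF X Y' h] U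
      tangent_apply_const[OF smooth_vfieldD[OF X U(2)], of 1] by simp
qed

lemma curvature_tangent:
  assumes "smooth_vfield A U X" "smooth_vfield A U Y" "smooth_vfield A U Z"
  shows "Rm X Y Z p \<in> tangent_space A p"
  unfolding curvature_apply
  by (intro tangent_diff connection_tangent smooth_vfield_connection smooth_vfield_lie_bracket assms U)

lemma curvature_antisym:
  assumes X: "smooth_vfield A U X" and Y: "smooth_vfield A U Y" and Z: "smooth_vfield A U Z"
  shows "Rm Y X Z p = - Rm X Y Z p"
proof -
  have "lie_bracket A Y X = (\<lambda>q. (-1) *\<^sub>R lie_bracket A X Y q)"
    by (rule ext) (simp add: lie_bracket_antisym[of Y])
  then have "D (lie_bracket A Y X) Z p = - D (lie_bracket A X Y) Z p"
    using connection_scale_left[OF smooth_vfield_lie_bracket[OF U(1) X Y] Z smooth_fun_const[OF U(1), of "-1"]] by simp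
  then show ?thesis by (simp add: curvature_apply)
qed

end

context
  fixes U :: "'m set" and p
  assumes U: "open U" "p \<in> U"
begin

lemma curvature_add_left:
  assumes X: "smooth_vfield A U X" and Y: "smooth_vfield A U Y" and Z: "smooth_vfield A U Z" and W: "smooth_vfield A U W"
  shows "Rm (\<lambda>q. X q + W q) Y Z p = Rm X Y Z p + Rm W Y Z p"
proof -
  note s = smooth_vfield_connection[OF U(1)] and a = smooth_vfield_add[OF U(1)] and b = smooth_vfield_lie_bracket[OF U(1)]
  have 1: "D (\<lambda>q. X q + W q) (D Y Z) p = D X (D Y Z) p + D W (D Y Z) p"
    by (rule connection_add_left[OF U X W s[OF Y Z]])
  have "D Y (D (\<lambda>q. X q + W q) Z) p = D Y (\<lambda>q. D X Z q + D W Z q) p"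
    by (rule connection_cong_right[OF U Y s[OF a[OF X W] Z]]) (rule connection_add_left[OF U(1) _ X W Z])
  also have "\<dots> = D Y (D X Z) p + D Y (D W Z) p"
    by (rule connection_add_right[OF U Y s[OF X Z] s[OF W Z]])
  finally have 2: "D Y (D (\<lambda>q. X q + W q) Z) p = D Y (D X Z) p + D Y (D W Z) p" .
  have "D (lie_bracket A (\<lambda>q. X q + W q) Y) Z p = D (\<lambda>q. lie_bracket A X Y q + lie_bracket A W Y q) Z p"
    by (rule connection_cong_left[OF U b[OF a[OF X W] Y] Z]) (rule lie_bracket_add_left[OF U(1) _ X W Y])
  also have "\<dots> = D (lie_bracket A X Y) Z p + D (lie_bracket A W Y) Z p"
    by (rule connection_add_left[OF U b[OF X Y] b[OF W Y] Z])
  finally have 3: "D (lie_bracket A (\<lambda>q. X q + W q) Y) Z p = D (lie_bracket A X Y) Z p + D (lie_bracket A W Y) Z p" .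
  show ?thesis unfolding curvature_apply 1 2 3 by simp
qed

text \<open>Differentiating \<open>f\<close> in \<open>D Y (D (f X) Z)\<close> leaves the term
  \<open>Y p f *\<^sub>R D X Z p\<close>. It cancels because the bracket of \<open>f X\<close> with
  \<open>Y\<close> contains \<open>- Y p f *\<^sub>R X p\<close>.\<close>

lemma curvature_scale_left:
  assumes X: "smooth_vfield A U X" and Y: "smooth_vfield A U Y" and Z: "smooth_vfield A U Z" and f: "smooth_fun A U f"
  shows "Rm (\<lambda>q. f q *\<^sub>R X q) Y Z p = f p *\<^sub>R Rm X Y Z p"
proof -
  note s = smooth_vfield_connection[OF U(1)] and a = smooth_vfield_scale[OF U(1)] and b = smooth_vfield_lie_bracket[OF U(1)]
  have Yf: "smooth_fun A U (\<lambda>q. - Y q f)" by (rule smooth_fun_minus[OF U(1) smooth_vfield_apply'[OF Y U(1) f]])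
  have 1: "D (\<lambda>q. f q *\<^sub>R X q) (D Y Z) p = f p *\<^sub>R D X (D Y Z) p"
    by (rule connection_scale_left[OF U X s[OF Y Z] f])
  have "D Y (D (\<lambda>q. f q *\<^sub>R X q) Z) p = D Y (\<lambda>q. f q *\<^sub>R D X Z q) p"
    by (rule connection_cong_right[OF U Y s[OF a[OF f X] Z]]) (rule connection_scale_left[OF U(1) _ X Z f])
  also have "\<dots> = Y p f *\<^sub>R D X Z p + f p *\<^sub>R D Y (D X Z) p"
    by (rule connection_scale_right[OF U Y s[OF X Z] f])
  finally have 2: "D Y (D (\<lambda>q. f q *\<^sub>R X q) Z) p = Y p f *\<^sub>R D X Z p + f p *\<^sub>R D Y (D X Z) p" .
  have "D (lie_bracket A (\<lambda>q. f q *\<^sub>R X q) Y) Z p = D (\<lambda>q. f q *\<^sub>R lie_bracket A X Y q + (- Y q f) *\<^sub>R X q) Z p"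
    by (rule connection_cong_left[OF U b[OF a[OF f X] Y] Z]) (simp add: lie_bracket_scale_left[OF U(1) _ X Y f])
  also have "\<dots> = f p *\<^sub>R D (lie_bracket A X Y) Z p + (- Y p f) *\<^sub>R D X Z p"
    unfolding connection_add_left[OF U a[OF f b[OF X Y]] a[OF Yf X] Z]
      connection_scale_left[OF U b[OF X Y] Z f] connection_scale_left[OF U X Z Yf] ..
  finally have 3: "D (lie_bracket A (\<lambda>q. f q *\<^sub>R X q) Y) Z p = f p *\<^sub>R D (lie_bracket A X Y) Z p + (- Y p f) *\<^sub>R D X Z p" .
  show ?thesis unfolding curvature_apply 1 2 3 by (simp add: scaleR_diff_right)
qed

lemma curvature_add_right:
  assumes X: "smooth_vfield A U X" and Y: "smooth_vfield A U Y" and Z: "smooth_vfield A U Z" and W: "smooth_vfield A U W"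
  shows "Rm X Y (\<lambda>q. Z q + W q) p = Rm X Y Z p + Rm X Y W p"
proof -
  note s = smooth_vfield_connection[OF U(1)] and a = smooth_vfield_add[OF U(1)] and b = smooth_vfield_lie_bracket[OF U(1)]
  have 1: "D V (D V' (\<lambda>q. Z q + W q)) p = D V (D V' Z) p + D V (D V' W) p"
    if V: "smooth_vfield A U V" "smooth_vfield A U V'" for V V'
  proof -
    have "D V (D V' (\<lambda>q. Z q + W q)) p = D V (\<lambda>q. D V' Z q + D V' W q) p"
      by (rule connection_cong_right[OF U V(1) s[OF V(2) a[OF Z W]]]) (rule connection_add_right[OF U(1) _ V(2) Z W])
    also have "\<dots> = D V (D V' Z) p + D V (D V' W) p"
      by (rule connection_add_right[OF U V(1) s[OF V(2) Z] s[OF V(2) W]])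
    finally show ?thesis .
  qed
  show ?thesis unfolding curvature_apply 1[OF X Y] 1[OF Y X] connection_add_right[OF U b[OF X Y] Z W] by simp
qed

lemma curvature_cong_left:
  assumes X: "smooth_vfield A U X" and Y: "smooth_vfield A U Y" and Z: "smooth_vfield A U Z"
    and e: "\<And>q. q \<in> U \<Longrightarrow> X q = X' q"
  shows "Rm X Y Z p = Rm X' Y Z p"
proof -
  note s = smooth_vfield_connection[OF U(1)] and b = smooth_vfield_lie_bracket[OF U(1)]
  have 1: "D X (D Y Z) p = D X' (D Y Z) p" by (rule connection_cong_left[OF U X s[OF Y Z] e])
  have 2: "D Y (D X Z) p = D Y (D X' Z) p"
    by (rule connection_cong_right[OF U Y s[OF X Z]]) (rule connection_cong_left[OF U(1) _ X Z e])
  have "lie_bracket A X Y q = lie_bracket A X' Y q" if "q \<in> U" for q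
    using lie_bracket_cong_right[OF U(1) that Y e] unfolding lie_bracket_antisym[of Y] by simp
  then have 3: "D (lie_bracket A X Y) Z p = D (lie_bracket A X' Y) Z p"
    by (rule connection_cong_left[OF U b[OF X Y] Z])
  show ?thesis unfolding curvature_apply 1 2 3 ..
qed

text \<open>Apply \<open>[X,Y]\<close> to the function \<open>g(Z,Z)\<close>, once as a tangent
  vector and once as a commutator of second derivatives. The mixed products of \<open>D X Z\<close>
  and \<open>D Y Z\<close> are symmetric and drop out of the commutator.\<close>

lemma curvature_skew:
  assumes X: "smooth_vfield A U X" and Y: "smooth_vfield A U Y" and Z: "smooth_vfield A U Z"
  shows "g p (Rm X Y Z p) (Z p) = 0"
proof -
  note s = smooth_vfield_connection[OF U(1)] and b = smooth_vfield_lie_bracket[OF U(1)]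
  have Zp: "Z p \<in> tangent_space A p" by (rule smooth_vfieldD[OF Z U(2)])
  have t: "D V W p \<in> tangent_space A p" if "smooth_vfield A U V" "smooth_vfield A U W" for V W
    by (rule connection_tangent[OF U that])
  define N where "N = (\<lambda>q. g q (Z q) (Z q))"
  have d: "V q N = 2 * g q (D V Z q) (Z q)" if "q \<in> U" "smooth_vfield A U V" for V q
    using connection_metric[OF U(1) that Z Z] metric_sym[OF smooth_vfieldD[OF Z that(1)] connection_tangent[OF U(1) that Z]]
    by (simp add: N_def)
  have 1: "V p (\<lambda>q. W q N) = 2 * (g p (D V (D W Z) p) (Z p) + g p (D W Z p) (D V Z p))"
    if V: "smooth_vfield A U V" "smooth_vfield A U W" for V W
  proof -
    have "V p (\<lambda>q. W q N) = V p (\<lambda>q. 2 * g q (D W Z q) (Z q))"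
      by (rule tangent_apply_cong[OF smooth_vfieldD[OF V(1) U(2)] U]) (rule d[OF _ V(2)])
    also have "\<dots> = 2 * V p (\<lambda>q. g q (D W Z q) (Z q))"
      by (rule tangent_apply_cmult[OF smooth_vfieldD[OF V(1) U(2)] smooth_nearI[OF U smooth_fun_metric[OF U(1) s[OF V(2) Z] Z]]])
    also have "V p (\<lambda>q. g q (D W Z q) (Z q)) = g p (D V (D W Z) p) (Z p) + g p (D W Z p) (D V Z p)"
      by (rule connection_metric[OF U V(1) s[OF V(2) Z] Z])
    finally show ?thesis .
  qed
  have n: "smooth_near A p N" unfolding N_def by (rule smooth_nearI[OF U smooth_fun_metric[OF U(1) Z Z]])
  have "2 * g p (D (lie_bracket A X Y) Z p) (Z p) = X p (\<lambda>q. Y q N) - Y p (\<lambda>q. X q N)"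
    unfolding d[OF U(2) b[OF X Y], symmetric] by (rule lie_bracket_apply[OF n])
  also have "\<dots> = 2 * (g p (D X (D Y Z) p) (Z p) - g p (D Y (D X Z) p) (Z p))"
    unfolding 1[OF X Y] 1[OF Y X] using metric_sym[OF t[OF Y Z] t[OF X Z]] by simp
  finally have "g p (D (lie_bracket A X Y) Z p) (Z p) = g p (D X (D Y Z) p) (Z p) - g p (D Y (D X Z) p) (Z p)" by simp
  then show ?thesis
    unfolding curvature_apply
      metric_diff_left[OF tangent_diff[OF t[OF X s[OF Y Z]] t[OF Y s[OF X Z]]] t[OF b[OF X Y] Z] Zp]
      metric_diff_left[OF t[OF X s[OF Y Z]] t[OF Y s[OF X Z]] Zp] by simp
qed

text \<open>Polarisation of \<open>curvature_skew\<close> at \<open>Z + W\<close>.\<close>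

lemma curvature_skew_pair:
  assumes X: "smooth_vfield A U X" and Y: "smooth_vfield A U Y" and Z: "smooth_vfield A U Z" and W: "smooth_vfield A U W"
  shows "g p (Rm X Y Z p) (W p) = - g p (Rm X Y W p) (Z p)"
proof -
  note T = smooth_vfieldD[OF Z U(2)] smooth_vfieldD[OF W U(2)] curvature_tangent[OF U X Y Z] curvature_tangent[OF U X Y W]
  have "0 = g p (Rm X Y (\<lambda>q. Z q + W q) p) (Z p + W p)"
    using curvature_skew[OF X Y smooth_vfield_add[OF U(1) Z W]] by simp
  also have "\<dots> = g p (Rm X Y Z p) (Z p) + g p (Rm X Y Z p) (W p) + (g p (Rm X Y W p) (Z p) + g p (Rm X Y W p) (W p))"
    by (simp add: curvature_add_right[OF X Y Z W] metric_linear T tangent_add)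
  finally show ?thesis using curvature_skew[OF X Y Z] curvature_skew[OF X Y W] by simp
qed

end

end

section \<open>Gaussian curvature in an orthonormal frame\<close>

lemma indep_pair_iff: "indep_pair u v \<longleftrightarrow> (\<forall>a b. a *\<^sub>R u + b *\<^sub>R v = 0 \<longrightarrow> a = 0 \<and> b = 0)"
proof
  assume i: "indep_pair u v"
  then have uv: "u \<notin> span {v}" "independent {v}"
    unfolding indep_pair_def by (auto simp: independent_insert)
  then have v: "v \<noteq> 0" by (metis dependent_zero insertI1)
  show "\<forall>a b. a *\<^sub>R u + b *\<^sub>R v = 0 \<longrightarrow> a = 0 \<and> b = 0"
  proof (intro allI impI)
    fix a b assume z: "a *\<^sub>R u + b *\<^sub>R v = 0"
    have "a = 0"
    proof (rule ccontr)
      assume a: "a \<noteq> 0"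
      have "a *\<^sub>R u = (- b) *\<^sub>R v" using z by (simp add: eq_neg_iff_add_eq_0)
      then have "inverse a *\<^sub>R (a *\<^sub>R u) = inverse a *\<^sub>R ((- b) *\<^sub>R v)" by (rule arg_cong)
      then have "u = (inverse a * - b) *\<^sub>R v" using a by (simp only: scaleR_scaleR left_inverse[OF a] scaleR_one)
      then have "u \<in> span {v}" unfolding span_singleton by (rule range_eqI)
      then show False using uv(1) by contradiction
    qed
    then show "a = 0 \<and> b = 0" using z v by simp
  qed
next
  assume h: "\<forall>a b. a *\<^sub>R u + b *\<^sub>R v = 0 \<longrightarrow> a = 0 \<and> b = 0"
  have "u \<noteq> v" using h[rule_format, of 1 "-1"] by auto
  moreover have "v \<noteq> 0" using h[rule_format, of 0 1] by auto
  moreover have "u \<notin> span {v}"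
  proof
    assume "u \<in> span {v}"
    then obtain k where "u = k *\<^sub>R v" by (auto simp: span_singleton)
    then show False using h[rule_format, of 1 "- k"] by simp
  qed
  ultimately show "indep_pair u v" unfolding indep_pair_def by (simp add: independent_insert)
qed

lemma span_pair: "w \<in> span {u, v} \<longleftrightarrow> (\<exists>a b. w = a *\<^sub>R u + b *\<^sub>R v)"
  by (simp add: span_breakdown_eq algebra_simps span_singleton image_iff)

context riemannian_manifold
begin

text \<open>The last clause expresses completeness of the frame directly, in place of a dimension
  count.\<close>

definition orthonormal_frame :: "'m set \<Rightarrow> 'm vfield \<Rightarrow> 'm vfield \<Rightarrow> 'm vfield \<Rightarrow> bool" where
  "orthonormal_frame U S T n \<longleftrightarrow> open U \<and> smooth_vfield A U S \<and> smooth_vfield A U T \<and> smooth_vfield A U n \<and>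
     (\<forall>q\<in>U. g q (S q) (S q) = 1 \<and> g q (T q) (T q) = 1 \<and> g q (n q) (n q) = 1 \<and>
        g q (S q) (T q) = 0 \<and> g q (S q) (n q) = 0 \<and> g q (T q) (n q) = 0 \<and>
        (\<forall>u\<in>tangent_space A q. u = (g q u (S q) *\<^sub>R S q + g q u (T q) *\<^sub>R T q) + g q u (n q) *\<^sub>R n q))"

end

section \<open>Connection and curvature in an orthonormal frame\<close>

locale curvature_frame = levi_civita_manifold A g D
  for A :: "'m::t2_space chart set" and g :: "'m metric" and D +
  fixes U :: "'m set" and S T n :: "'m vfield"
  assumes frame: "orthonormal_frame U S T n"
begin

lemma frame_open: "open U" and frame_smooth: "smooth_vfield A U S" "smooth_vfield A U T" "smooth_vfield A U n"
  using frame unfolding orthonormal_frame_def by blast+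

lemma frame_inner:
  assumes "q \<in> U"
  shows "g q (S q) (S q) = 1" "g q (T q) (T q) = 1" "g q (n q) (n q) = 1"
    "g q (S q) (T q) = 0" "g q (S q) (n q) = 0" "g q (T q) (n q) = 0"
  using frame assms unfolding orthonormal_frame_def by blast+

lemma frame_tangent:
  "q \<in> U \<Longrightarrow> S q \<in> tangent_space A q" "q \<in> U \<Longrightarrow> T q \<in> tangent_space A q" "q \<in> U \<Longrightarrow> n q \<in> tangent_space A q"
  using frame_smooth smooth_vfieldD by blast+

lemma frame_inner':
  assumes "q \<in> U"
  shows "g q (T q) (S q) = 0" "g q (n q) (S q) = 0" "g q (n q) (T q) = 0"
  using frame_inner[OF assms] metric_sym frame_tangent[OF assms] by simp_all

lemma frame_expand:
  "q \<in> U \<Longrightarrow> u \<in> tangent_space A q \<Longrightarrow> u = (g q u (S q) *\<^sub>R S q + g q u (T q) *\<^sub>R T q) + g q u (n q) *\<^sub>R n q"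
  using frame unfolding orthonormal_frame_def by blast

lemma frame_product:
  assumes q: "q \<in> U" and u: "u \<in> tangent_space A q" and v: "v \<in> tangent_space A q"
  shows "g q u v = g q u (S q) * g q v (S q) + g q u (T q) * g q v (T q) + g q u (n q) * g q v (n q)"
proof -
  have "g q u v = g q ((g q u (S q) *\<^sub>R S q + g q u (T q) *\<^sub>R T q) + g q u (n q) *\<^sub>R n q) v"
    by (rule arg_cong[OF frame_expand[OF q u]])
  also have "\<dots> = g q u (S q) * g q (S q) v + g q u (T q) * g q (T q) v + g q u (n q) * g q (n q) v"
    using frame_tangent[OF q] v by (simp only: metric_linear tangent_add tangent_scale)
  finally show ?thesis
    using metric_sym[OF frame_tangent(1)[OF q] v] metric_sym[OF frame_tangent(2)[OF q] v] metric_sym[OF frame_tangent(3)[OF q] v]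
    by simp
qed

lemma curvature_frame_subset:
  assumes "open V" "V \<subseteq> U"
  shows "curvature_frame A g D V S T n"
proof
  show "orthonormal_frame V S T n"
    unfolding orthonormal_frame_def
  proof (intro conjI ballI)
    fix q assume "q \<in> V"
    then have q: "q \<in> U" using assms by blast
    show "g q (S q) (S q) = 1" "g q (T q) (T q) = 1" "g q (n q) (n q) = 1"
      "g q (S q) (T q) = 0" "g q (S q) (n q) = 0" "g q (T q) (n q) = 0"
      by (rule frame_inner[OF q])+
    show "u = (g q u (S q) *\<^sub>R S q + g q u (T q) *\<^sub>R T q) + g q u (n q) *\<^sub>R n q" if "u \<in> tangent_space A q" for u
      by (rule frame_expand[OF q that])
  qed (rule assms(1) smooth_vfield_subset[OF frame_smooth(1) assms(2)]
      smooth_vfield_subset[OF frame_smooth(2) assms(2)] smooth_vfield_subset[OF frame_smooth(3) assms(2)])+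
qed

text \<open>Differentiate the constant \<open>g(W,W')\<close>. For frame fields this is the skew
  symmetry of the connection forms.\<close>

lemma connection_skew:
  assumes q: "q \<in> U" and V: "smooth_vfield A U V" and W: "smooth_vfield A U W" and W': "smooth_vfield A U W'"
    and c: "\<And>r. r \<in> U \<Longrightarrow> g r (W r) (W' r) = c"
  shows "g q (D V W q) (W' q) = - g q (D V W' q) (W q)"
proof -
  have "V q (\<lambda>r. g r (W r) (W' r)) = V q (\<lambda>r. c)"
    by (rule tangent_apply_cong[OF smooth_vfieldD[OF V q] frame_open q c])
  then have "g q (D V W q) (W' q) + g q (W q) (D V W' q) = 0"
    using connection_metric[OF frame_open q V W W'] tangent_apply_const[OF smooth_vfieldD[OF V q]] by simp
  moreover have "g q (W q) (D V W' q) = g q (D V W' q) (W q)"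
    by (rule metric_sym[OF smooth_vfieldD[OF W q] connection_tangent[OF frame_open q V W']])
  ultimately show ?thesis by simp
qed

lemma frame_connection:
  assumes q: "q \<in> U" and V: "smooth_vfield A U V"
  shows "g q (D V S q) (S q) = 0" "g q (D V T q) (T q) = 0" "g q (D V n q) (n q) = 0"
    "g q (D V T q) (S q) = - g q (D V S q) (T q)"
    "g q (D V n q) (S q) = - g q (D V S q) (n q)"
    "g q (D V n q) (T q) = - g q (D V T q) (n q)"
  using connection_skew[OF q V frame_smooth(1,1) frame_inner(1)] connection_skew[OF q V frame_smooth(2,2) frame_inner(2)]
    connection_skew[OF q V frame_smooth(3,3) frame_inner(3)] connection_skew[OF q V frame_smooth(2,1) frame_inner'(1)]
    connection_skew[OF q V frame_smooth(3,1) frame_inner'(2)] connection_skew[OF q V frame_smooth(3,2) frame_inner'(3)]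
  by simp_all

text \<open>The in-plane components of the connection along \<open>S\<close> and \<open>T\<close>
  are determined by \<open>[S,T]\<close> alone: \<open>a\<close> is the \<open>S\<close> component
  of \<open>D S T\<close> and \<open>b\<close> that of \<open>D T T\<close>. Hence their derivatives
  appear as \<open>T p a\<close> and \<open>S p b\<close>, while the normal components are kept as
  \<open>\<beta>\<close>, to be cancelled later against the extrinsic curvature.\<close>

lemma frame_curvature:
  assumes p: "p \<in> U"
  defines "a \<equiv> \<lambda>q. g q (lie_bracket A S T q) (S q)"
    and "b \<equiv> \<lambda>q. g q (lie_bracket A S T q) (T q)"
    and "c \<equiv> \<lambda>q. g q (lie_bracket A S T q) (n q)"
    and "\<beta> \<equiv> \<lambda>X Y. g p (D X Y p) (n p)"
  shows "g p (Rm S T T p) (S p) = S p b - T p a - \<beta> S S * \<beta> T T + \<beta> S T * \<beta> T S - (a p)\<^sup>2 - (b p)\<^sup>2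
      - c p / 2 * (c p + g p (lie_bracket A n T p) (S p) - g p (lie_bracket A n S p) (T p))"
    and "\<beta> S T - \<beta> T S = c p"
proof -
  note sm = frame_smooth and s = smooth_vfield_connection[OF frame_open] and bs = smooth_vfield_lie_bracket[OF frame_open]
  note t = connection_tangent[OF frame_open p]
  note ft = frame_tangent
  have br: "g q (lie_bracket A X Y q) w = g q (D X Y q) w - g q (D Y X q) w"
    if "q \<in> U" "smooth_vfield A U X" "smooth_vfield A U Y" "w \<in> tangent_space A q" for q X Y w
    unfolding connection_torsion[OF frame_open that(1-3)]
    by (rule metric_diff_left[OF connection_tangent[OF frame_open that(1-3)] connection_tangent[OF frame_open that(1,3,2)] that(4)])
  have e1: "g q (D T T q) (S q) = b q" if q: "q \<in> U" for q
    using br[OF q sm(1,2) ft(2)[OF q]] frame_connection[OF q sm(1)] frame_connection[OF q sm(2)] by (simp add: b_def)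
  have e2: "g q (D S T q) (S q) = a q" if q: "q \<in> U" for q
    using br[OF q sm(1,2) ft(1)[OF q]] frame_connection[OF q sm(1)] frame_connection[OF q sm(2)] by (simp add: a_def)
  have "S p (\<lambda>q. g q (D T T q) (S q)) = S p b"
    by (rule tangent_apply_cong[OF ft(1)[OF p] frame_open p e1])
  moreover have "g p (D T T p) (D S S p) = \<beta> T T * \<beta> S S"
    using frame_product[OF p t[OF sm(2,2)] t[OF sm(1,1)]] frame_connection[OF p sm(1)] frame_connection[OF p sm(2)]
    by (simp add: \<beta>_def)
  ultimately have t1: "g p (D S (D T T) p) (S p) = S p b - \<beta> T T * \<beta> S S"
    using connection_metric[OF frame_open p sm(1) s[OF sm(2,2)] sm(1)] by simp
  have "T p (\<lambda>q. g q (D S T q) (S q)) = T p a"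
    by (rule tangent_apply_cong[OF ft(2)[OF p] frame_open p e2])
  moreover have "g p (D S T p) (D T S p) = \<beta> S T * \<beta> T S"
    using frame_product[OF p t[OF sm(1,2)] t[OF sm(2,1)]] frame_connection[OF p sm(1)] frame_connection[OF p sm(2)]
    by (simp add: \<beta>_def)
  ultimately have t2: "g p (D T (D S T) p) (S p) = T p a - \<beta> S T * \<beta> T S"
    using connection_metric[OF frame_open p sm(2) s[OF sm(1,2)] sm(1)] by simp
  have abc: "smooth_fun A U a" "smooth_fun A U b" "smooth_fun A U c"
    unfolding a_def b_def c_def by (rule smooth_fun_metric[OF frame_open bs[OF sm(1,2)]], rule sm)+
  note sc = smooth_vfield_scale[OF frame_open] and ad = smooth_vfield_add[OF frame_open]
  \<comment> \<open>Expanding the bracket in the frame brings in the only derivative along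
    \<open>n\<close>, with coefficient \<open>c\<close>.\<close>
  have "D (lie_bracket A S T) T p = D (\<lambda>q. (a q *\<^sub>R S q + b q *\<^sub>R T q) + c q *\<^sub>R n q) T p"
    unfolding a_def b_def c_def
    by (rule connection_cong_left[OF frame_open p bs[OF sm(1,2)] sm(2)])
      (rule frame_expand[OF _ tangent_lie_bracket[OF frame_open _ sm(1,2)]])
  also have "\<dots> = (a p *\<^sub>R D S T p + b p *\<^sub>R D T T p) + c p *\<^sub>R D n T p"
    unfolding connection_add_left[OF frame_open p ad[OF sc[OF abc(1) sm(1)] sc[OF abc(2) sm(2)]] sc[OF abc(3) sm(3)] sm(2)]
      connection_add_left[OF frame_open p sc[OF abc(1) sm(1)] sc[OF abc(2) sm(2)] sm(2)]
      connection_scale_left[OF frame_open p sm(1,2) abc(1)] connection_scale_left[OF frame_open p sm(2,2) abc(2)]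
      connection_scale_left[OF frame_open p sm(3,2) abc(3)] ..
  finally have "g p (D (lie_bracket A S T) T p) (S p) = a p * g p (D S T p) (S p) + b p * g p (D T T p) (S p) + c p * g p (D n T p) (S p)"
    by (simp only: metric_linear tangent_add tangent_scale t[OF sm(1,2)] t[OF sm(2,2)] t[OF sm(3,2)] ft(1)[OF p])
  then have t3: "g p (D (lie_bracket A S T) T p) (S p) = (a p)\<^sup>2 + (b p)\<^sup>2 + c p * g p (D n T p) (S p)"
    using e1[OF p] e2[OF p] by (simp add: power2_eq_square)
  show c: "\<beta> S T - \<beta> T S = c p" using br[OF p sm(1,2) ft(3)[OF p]] by (simp add: \<beta>_def c_def)
  \<comment> \<open>Vanishing torsion for \<open>[n,T]\<close> and \<open>[n,S]\<close> recovers the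
    component of \<open>D n T\<close> along \<open>S\<close>; the derivatives of \<open>n\<close>
    along \<open>T\<close> and \<open>S\<close> contribute \<open>\<beta> T S - \<beta> S T\<close>,
    which is \<open>- c p\<close>.\<close>
  have t4: "g p (lie_bracket A n T p) (S p) - g p (lie_bracket A n S p) (T p) = 2 * g p (D n T p) (S p) - c p"
    using br[OF p sm(3,2) ft(1)[OF p]] br[OF p sm(3,1) ft(2)[OF p]] frame_connection[OF p sm(1)] frame_connection[OF p sm(2)]
      frame_connection[OF p sm(3)] c by (simp add: \<beta>_def)
  have "g p (Rm S T T p) (S p) = g p (D S (D T T) p) (S p) - g p (D T (D S T) p) (S p) - g p (D (lie_bracket A S T) T p) (S p)"
    unfolding curvature_apply
    by (simp only: metric_linear tangent_diff t[OF sm(1) s[OF sm(2,2)]] t[OF sm(2) s[OF sm(1,2)]] t[OF bs[OF sm(1,2)] sm(2)] ft(1)[OF p])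
  also have "\<dots> = S p b - \<beta> T T * \<beta> S S - (T p a - \<beta> S T * \<beta> T S) - ((a p)\<^sup>2 + (b p)\<^sup>2 + c p * g p (D n T p) (S p))"
    unfolding t1 t2 t3 ..
  also have "g p (D n T p) (S p) = 1 / 2 * (c p + g p (lie_bracket A n T p) (S p) - g p (lie_bracket A n S p) (T p))"
    using t4 by simp
  finally show "g p (Rm S T T p) (S p) = S p b - T p a - \<beta> S S * \<beta> T T + \<beta> S T * \<beta> T S - (a p)\<^sup>2 - (b p)\<^sup>2
      - c p / 2 * (c p + g p (lie_bracket A n T p) (S p) - g p (lie_bracket A n S p) (T p))"
    by (simp add: algebra_simps)
qed

section \<open>Independence of the curvatures from the chosen fields\<close>

lemma curvature_expand_left:
  assumes p: "p \<in> U" and X: "smooth_vfield A U X" and Y: "smooth_vfield A U Y" and Z: "smooth_vfield A U Z"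
  shows "Rm X Y Z p = (g p (X p) (S p) *\<^sub>R Rm S Y Z p + g p (X p) (T p) *\<^sub>R Rm T Y Z p) + g p (X p) (n p) *\<^sub>R Rm n Y Z p"
proof -
  note sm = frame_smooth and sc = smooth_vfield_scale[OF frame_open] and ad = smooth_vfield_add[OF frame_open]
  note f = smooth_fun_metric[OF frame_open X]
  have "Rm X Y Z p = Rm (\<lambda>q. (g q (X q) (S q) *\<^sub>R S q + g q (X q) (T q) *\<^sub>R T q) + g q (X q) (n q) *\<^sub>R n q) Y Z p"
    by (rule curvature_cong_left[OF frame_open p X Y Z]) (rule frame_expand[OF _ smooth_vfieldD[OF X]])
  also have "\<dots> = (g p (X p) (S p) *\<^sub>R Rm S Y Z p + g p (X p) (T p) *\<^sub>R Rm T Y Z p) + g p (X p) (n p) *\<^sub>R Rm n Y Z p"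
    unfolding curvature_add_left[OF frame_open p ad[OF sc[OF f[OF sm(1)] sm(1)] sc[OF f[OF sm(2)] sm(2)]] Y Z sc[OF f[OF sm(3)] sm(3)]]
      curvature_add_left[OF frame_open p sc[OF f[OF sm(1)] sm(1)] Y Z sc[OF f[OF sm(2)] sm(2)]]
      curvature_scale_left[OF frame_open p sm(1) Y Z f[OF sm(1)]] curvature_scale_left[OF frame_open p sm(2) Y Z f[OF sm(2)]]
      curvature_scale_left[OF frame_open p sm(3) Y Z f[OF sm(3)]] ..
  finally show ?thesis .
qed

lemma curvature_same: 
  assumes p: "p \<in> U" and X: "smooth_vfield A U X" and Z: "smooth_vfield A U Z"
  shows "Rm X X Z p = 0"
proof -
  have "Rm X X Z p = - Rm X X Z p" by (rule curvature_antisym[OF frame_open p X X Z])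
  then have "2 *\<^sub>R Rm X X Z p = 0" by (simp add: scaleR_2 eq_neg_iff_add_eq_0)
  then show ?thesis by simp
qed

lemma normal_iff_span:
  assumes "p \<in> U" "u \<in> tangent_space A p"
  shows "u \<in> span {S p, T p} \<longleftrightarrow> g p u (n p) = 0"
proof
  assume "u \<in> span {S p, T p}"
  then obtain x y where "u = x *\<^sub>R S p + y *\<^sub>R T p" unfolding span_pair by blast
  then show "g p u (n p) = 0"
    using frame_tangent[OF assms(1)] frame_inner[OF assms(1)] by (simp add: metric_linear tangent_scale)
next
  assume "g p u (n p) = 0"
  then show "u \<in> span {S p, T p}" unfolding span_pair using frame_expand[OF assms] by auto
qed

lemma gram_frame:
  assumes p: "p \<in> U" and u: "u \<in> tangent_space A p" "g p u (n p) = 0" and v: "v \<in> tangent_space A p" "g p v (n p) = 0"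
  shows "gram g p u v = (g p u (S p) * g p v (T p) - g p u (T p) * g p v (S p))\<^sup>2"
  unfolding gram_def frame_product[OF p u(1) u(1)] frame_product[OF p u(1) v(1)] frame_product[OF p v(1) v(1)] u(2) v(2)
  by (simp add: power2_eq_square algebra_simps)

text \<open>If the determinant vanished, eliminating \<open>T p\<close> and \<open>S p\<close> in
  turn would give two linear relations between \<open>u\<close> and \<open>v\<close>; independence
  then kills all four components.\<close>

lemma gram_frame_nonzero:
  assumes p: "p \<in> U" and u: "u \<in> tangent_space A p" "g p u (n p) = 0" and v: "v \<in> tangent_space A p" "g p v (n p) = 0"
    and i: "indep_pair u v"
  shows "g p u (S p) * g p v (T p) - g p u (T p) * g p v (S p) \<noteq> 0"
proof
  let ?u1 = "g p u (S p)" and ?u2 = "g p u (T p)" and ?v1 = "g p v (S p)" and ?v2 = "g p v (T p)"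
  assume d: "?u1 * ?v2 - ?u2 * ?v1 = 0"
  have ue: "u = ?u1 *\<^sub>R S p + ?u2 *\<^sub>R T p" and ve: "v = ?v1 *\<^sub>R S p + ?v2 *\<^sub>R T p"
    using frame_expand[OF p u(1)] frame_expand[OF p v(1)] u(2) v(2) by simp_all
  have j: "a = 0 \<and> b = 0" if "a *\<^sub>R u + b *\<^sub>R v = 0" for a b using i that unfolding indep_pair_iff by blast
  have alg: "v2 *\<^sub>R (u1 *\<^sub>R s + u2 *\<^sub>R t) + (- u2) *\<^sub>R (v1 *\<^sub>R s + v2 *\<^sub>R t) = (u1 * v2 - u2 * v1) *\<^sub>R s"
    for u1 u2 v1 v2 and s t :: "'m tvec" by (simp add: algebra_simps)
  have "?v2 *\<^sub>R u + (- ?u2) *\<^sub>R v = (?u1 * ?v2 - ?u2 * ?v1) *\<^sub>R S p"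
    using alg[of ?v2 ?u1 "S p" ?u2 "T p" ?v1] unfolding ue[symmetric] ve[symmetric] .
  then have 1: "?v2 = 0 \<and> ?u2 = 0" using j[of ?v2 "- ?u2"] d by simp
  have "?v1 *\<^sub>R u + (- ?u1) *\<^sub>R v = (?u2 * ?v1 - ?u1 * ?v2) *\<^sub>R T p"
    using alg[of ?v1 ?u2 "T p" ?u1 "S p" ?v2] unfolding add.commute[of "_ *\<^sub>R T p"] ue[symmetric] ve[symmetric] .
  then have 2: "?v1 = 0 \<and> ?u1 = 0" using j[of ?v1 "- ?u1"] d by simp
  have "u = 0" using ue 1 2 by simp
  then show False using j[of 1 0] by simp
qed

lemma frame_indep: "q \<in> U \<Longrightarrow> indep_pair (S q) (T q)"
  unfolding indep_pair_iff
proof (intro allI impI)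
  fix a b assume q: "q \<in> U" and z: "a *\<^sub>R S q + b *\<^sub>R T q = 0"
  have "g q (a *\<^sub>R S q + b *\<^sub>R T q) (S q) = a" "g q (a *\<^sub>R S q + b *\<^sub>R T q) (T q) = b"
    using frame_tangent[OF q] frame_inner[OF q] frame_inner'[OF q] by (simp_all add: metric_linear tangent_scale)
  then show "a = 0 \<and> b = 0" unfolding z using metric_zero_left frame_tangent[OF q] by simp
qed

text \<open>In the first two slots the fields are replaced by frame fields through tensoriality and
  antisymmetry. In the third slot \<open>curvature_skew_pair\<close> moves \<open>Y\<close> to the
  other side of the metric, where it enters only through its value at \<open>p\<close>. So
  \<open>X\<close> and \<open>Y\<close> need to lie in the plane at \<open>p\<close> only, as the
  definition of sectional curvature allows.\<close>

lemma curvature_plane: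
  assumes p: "p \<in> U" and X: "smooth_vfield A U X" "g p (X p) (n p) = 0" and Y: "smooth_vfield A U Y" "g p (Y p) (n p) = 0"
  shows "g p (Rm X Y Y p) (X p) =
    (g p (X p) (S p) * g p (Y p) (T p) - g p (X p) (T p) * g p (Y p) (S p))\<^sup>2 * g p (Rm S T T p) (S p)"
proof -
  note sm = frame_smooth and an = curvature_antisym[OF frame_open p] and ct = curvature_tangent[OF frame_open p]
  note sk = curvature_skew_pair[OF frame_open p] and sk0 = curvature_skew[OF frame_open p]
  let ?x1 = "g p (X p) (S p)" and ?x2 = "g p (X p) (T p)" and ?y1 = "g p (Y p) (S p)" and ?y2 = "g p (Y p) (T p)"
  have Tp: "X p \<in> tangent_space A p" "Y p \<in> tangent_space A p" using X Y p smooth_vfieldD by blast+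
  have 1: "Rm S Y Y p = ?y2 *\<^sub>R Rm S T Y p"
    unfolding an[OF Y(1) sm(1) Y(1)] curvature_expand_left[OF p Y(1) sm(1) Y(1)] Y(2) curvature_same[OF p sm(1) Y(1)]
      an[OF sm(1,2) Y(1)] by simp
  have 2: "Rm T Y Y p = (- ?y1) *\<^sub>R Rm S T Y p"
    unfolding an[OF Y(1) sm(2) Y(1)] curvature_expand_left[OF p Y(1) sm(2) Y(1)] Y(2) curvature_same[OF p sm(2) Y(1)] by simp
  have "Rm X Y Y p = (?x1 * ?y2 - ?x2 * ?y1) *\<^sub>R Rm S T Y p"
    unfolding curvature_expand_left[OF p X(1) Y(1) Y(1)] X(2) 1 2 by (simp add: algebra_simps)
  then have "g p (Rm X Y Y p) (X p) = (?x1 * ?y2 - ?x2 * ?y1) * g p (Rm S T Y p) (X p)"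
    by (simp add: metric_scale_left[OF ct[OF sm(1,2) Y(1)] Tp(1)])
  also have "g p (Rm S T Y p) (X p) = ?x1 * g p (Rm S T Y p) (S p) + ?x2 * g p (Rm S T Y p) (T p)"
    using frame_product[OF p ct[OF sm(1,2) Y(1)] Tp(1)] X(2) by simp
  also have "g p (Rm S T Y p) (S p) = ?y2 * g p (Rm S T T p) (S p)"
    using sk[OF sm(1,2) Y(1) sm(1)] frame_product[OF p ct[OF sm(1,2,1)] Tp(2)] Y(2) sk0[OF sm(1,2,1)] sk[OF sm(1,2,1,2)] by simp
  also have "g p (Rm S T Y p) (T p) = - ?y1 * g p (Rm S T T p) (S p)"
    using sk[OF sm(1,2) Y(1) sm(2)] frame_product[OF p ct[OF sm(1,2,2)] Tp(2)] Y(2) sk0[OF sm(1,2,2)] by simp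
  finally show ?thesis by (simp add: power2_eq_square algebra_simps)
qed

text \<open>The \<open>THE\<close> is well defined because a change of fields multiplies the
  numerator and the Gram determinant by the square of the same determinant.\<close>

lemma sectional_curvature_frame:
  assumes p: "p \<in> U" and \<sigma>: "\<sigma> = span {S p, T p}"
  shows "sectional_curvature A g D p \<sigma> = g p (Rm S T T p) (S p)"
  unfolding sectional_curvature_def
proof (rule the_equality)
  note sm = frame_smooth
  have gr: "gram g p (S p) (T p) = 1"
    unfolding gram_def using frame_inner[OF p] by simp
  show "\<exists>V X Y. open V \<and> p \<in> V \<and> smooth_vfield A V X \<and> smooth_vfield A V Y \<and> indep_pair (X p) (Y p) \<and>
      span {X p, Y p} = \<sigma> \<and> g p (Rm S T T p) (S p) = g p (Rm X Y Y p) (X p) / gram g p (X p) (Y p)"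
    by (intro exI[of _ U] exI[of _ S] exI[of _ T] conjI frame_open p sm frame_indep \<sigma>[symmetric]) (simp add: gr)
  fix k
  assume "\<exists>V X Y. open V \<and> p \<in> V \<and> smooth_vfield A V X \<and> smooth_vfield A V Y \<and> indep_pair (X p) (Y p) \<and>
      span {X p, Y p} = \<sigma> \<and> k = g p (Rm X Y Y p) (X p) / gram g p (X p) (Y p)"
  then obtain V X Y where V: "open V" "p \<in> V" "smooth_vfield A V X" "smooth_vfield A V Y" "indep_pair (X p) (Y p)"
    "span {X p, Y p} = \<sigma>" and k: "k = g p (Rm X Y Y p) (X p) / gram g p (X p) (Y p)" by blast
  have o: "open (U \<inter> V)" "p \<in> U \<inter> V" using V p frame_open by auto
  interpret W: curvature_frame A g D "U \<inter> V" S T n by (rule curvature_frame_subset[OF o(1)]) simp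
  have X: "smooth_vfield A (U \<inter> V) X" and Y: "smooth_vfield A (U \<inter> V) Y" using V smooth_vfield_subset by blast+
  have Tp: "X p \<in> tangent_space A p" "Y p \<in> tangent_space A p" using V smooth_vfieldD by blast+
  have "X p \<in> span {X p, Y p}" "Y p \<in> span {X p, Y p}" by (auto intro: span_base)
  then have n: "g p (X p) (n p) = 0" "g p (Y p) (n p) = 0"
    using normal_iff_span[OF p Tp(1)] normal_iff_span[OF p Tp(2)] unfolding V(6) \<sigma> by simp_all
  show "k = g p (Rm S T T p) (S p)"
    unfolding k W.curvature_plane[OF o(2) X n(1) Y n(2)] gram_frame[OF p Tp(1) n(1) Tp(2) n(2)]
    using gram_frame_nonzero[OF p Tp(1) n(1) Tp(2) n(2) V(5)] by simp
qed

text \<open>Although \<open>D V Y\<close> differentiates \<open>Y\<close>, its normal component does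
  not: \<open>Y\<close> is orthogonal to \<open>n\<close> on all of \<open>U\<close>, so the
  derivative can be shifted to \<open>n\<close>.\<close>

lemma connection_normal_right:
  assumes p: "p \<in> U" and V: "smooth_vfield A U V" and Y: "smooth_vfield A U Y" "\<And>q. q \<in> U \<Longrightarrow> g q (Y q) (n q) = 0"
  shows "g p (D V Y p) (n p) = g p (Y p) (S p) * g p (D V S p) (n p) + g p (Y p) (T p) * g p (D V T p) (n p)"
proof -
  have "g p (D V Y p) (n p) = - g p (D V n p) (Y p)"
    by (rule connection_skew[OF p V Y(1) frame_smooth(3) Y(2)])
  also have "g p (D V n p) (Y p) = g p (D V n p) (S p) * g p (Y p) (S p) + g p (D V n p) (T p) * g p (Y p) (T p)"
    using frame_product[OF p connection_tangent[OF frame_open p V frame_smooth(3)] smooth_vfieldD[OF Y(1) p]] Y(2)[OF p] by simp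
  finally show ?thesis using frame_connection[OF p V] by simp
qed

lemma connection_normal_left:
  assumes p: "p \<in> U" and X: "smooth_vfield A U X" "\<And>q. q \<in> U \<Longrightarrow> g q (X q) (n q) = 0" and Y: "smooth_vfield A U Y"
  shows "g p (D X Y p) (n p) = g p (X p) (S p) * g p (D S Y p) (n p) + g p (X p) (T p) * g p (D T Y p) (n p)"
proof -
  note sm = frame_smooth and sc = smooth_vfield_scale[OF frame_open] and f = smooth_fun_metric[OF frame_open X(1)]
  note t = connection_tangent[OF frame_open p]
  have "D X Y p = D (\<lambda>q. g q (X q) (S q) *\<^sub>R S q + g q (X q) (T q) *\<^sub>R T q) Y p"
  proof (rule connection_cong_left[OF frame_open p X(1) Y])
    fix q assume "q \<in> U"
    from frame_expand[OF this smooth_vfieldD[OF X(1) this]] X(2)[OF this]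
    show "X q = g q (X q) (S q) *\<^sub>R S q + g q (X q) (T q) *\<^sub>R T q" by simp
  qed
  also have "\<dots> = g p (X p) (S p) *\<^sub>R D S Y p + g p (X p) (T p) *\<^sub>R D T Y p"
    unfolding connection_add_left[OF frame_open p sc[OF f[OF sm(1)] sm(1)] sc[OF f[OF sm(2)] sm(2)] Y]
      connection_scale_left[OF frame_open p sm(1) Y f[OF sm(1)]] connection_scale_left[OF frame_open p sm(2) Y f[OF sm(2)]] ..
  finally show ?thesis
    by (simp only: metric_linear tangent_scale t[OF sm(1) Y] t[OF sm(2) Y] frame_tangent[OF p])
qed

text \<open>The admissible choices differ from the frame in two ways. Other sections of the plane
  field multiply the determinant of the form and the Gram determinant by the same square, and
  another unit normal changes the form by a sign, which occurs quadratically.\<close>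

lemma extrinsic_curvature_frame:
  assumes p: "p \<in> U" and \<xi>: "\<And>q. q \<in> U \<Longrightarrow> \<xi> q = span {S q, T q}"
  defines "\<beta> \<equiv> \<lambda>X Y. g p (D X Y p) (n p)"
  shows "extrinsic_curvature A g D \<xi> p = \<beta> S S * \<beta> T T - ((\<beta> S T + \<beta> T S) / 2)\<^sup>2"
  unfolding extrinsic_curvature_def
proof (rule the_equality)
  note sm = frame_smooth
  have gr: "gram g p (S p) (T p) = 1"
    unfolding gram_def using frame_inner[OF p] by simp
  have B: "second_fundamental_form g D m X Y p = (g p (D X Y p) (m p) + g p (D Y X p) (m p)) / 2"
    if "open V" "p \<in> V" "smooth_vfield A V X" "smooth_vfield A V Y" "m p \<in> tangent_space A p" for m X Y V
    unfolding second_fundamental_form_def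
    using connection_tangent[OF that(1-4)] connection_tangent[OF that(1,2,4,3)] that(5) by (simp add: metric_linear)
  note B0 = B[OF frame_open p, of _ _ n, OF _ _ frame_tangent(3)[OF p]]
  have 1: "local_section A \<xi> U S" "local_section A \<xi> U T"
    using sm \<xi> by (auto simp: local_section_def span_base)
  have 2: "unit_normal A g \<xi> U n"
    unfolding unit_normal_def
  proof (intro conjI ballI sm frame_inner)
    fix q v assume q: "q \<in> U" and "v \<in> \<xi> q"
    then have "v \<in> span {S q, T q}" unfolding \<xi>[OF q] by blast
    then obtain x y where v: "v = x *\<^sub>R S q + y *\<^sub>R T q" unfolding span_pair by blast
    then have "v \<in> tangent_space A q" using frame_tangent[OF q] by (simp add: tangent_add tangent_scale)
    then show "g q v (n q) = 0" using normal_iff_span[OF q, of v] \<xi>[OF q] \<open>v \<in> \<xi> q\<close> by simp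
  qed
  have 3: "\<beta> S S * \<beta> T T - ((\<beta> S T + \<beta> T S) / 2)\<^sup>2 = (let B = second_fundamental_form g D n
          in (B S S p * B T T p - (B S T p)\<^sup>2) / gram g p (S p) (T p))"
    unfolding Let_def gr B0[OF sm(1,1)] B0[OF sm(2,2)] B0[OF sm(1,2)] \<beta>_def by simp
  show "\<exists>V X Y m. open V \<and> p \<in> V \<and> local_section A \<xi> V X \<and> local_section A \<xi> V Y \<and> (\<forall>q\<in>V. indep_pair (X q) (Y q)) \<and>
     unit_normal A g \<xi> V m \<and> \<beta> S S * \<beta> T T - ((\<beta> S T + \<beta> T S) / 2)\<^sup>2 = (let B = second_fundamental_form g D m
          in (B X X p * B Y Y p - (B X Y p)\<^sup>2) / gram g p (X p) (Y p))"
    by (intro exI[of _ U] exI[of _ S] exI[of _ T] exI[of _ n] conjI frame_open p 1 2 3 ballI frame_indep)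
  fix k
  assume "\<exists>V X Y m. open V \<and> p \<in> V \<and> local_section A \<xi> V X \<and> local_section A \<xi> V Y \<and> (\<forall>q\<in>V. indep_pair (X q) (Y q)) \<and>
     unit_normal A g \<xi> V m \<and> k = (let B = second_fundamental_form g D m
          in (B X X p * B Y Y p - (B X Y p)\<^sup>2) / gram g p (X p) (Y p))"
  then obtain V X Y m where V: "open V" "p \<in> V" and X: "local_section A \<xi> V X" and Y: "local_section A \<xi> V Y"
    and i: "\<forall>q\<in>V. indep_pair (X q) (Y q)" and m: "unit_normal A g \<xi> V m" and k: "k = (let B = second_fundamental_form g D m
          in (B X X p * B Y Y p - (B X Y p)\<^sup>2) / gram g p (X p) (Y p))" by blast
  have o: "open (U \<inter> V)" "p \<in> U \<inter> V" using V p frame_open by auto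
  interpret W: curvature_frame A g D "U \<inter> V" S T n by (rule curvature_frame_subset[OF o(1)]) simp
  have XV: "smooth_vfield A V X" "smooth_vfield A V Y" using X Y unfolding local_section_def by blast+
  have XW: "smooth_vfield A (U \<inter> V) X" "smooth_vfield A (U \<inter> V) Y" using XV smooth_vfield_subset by blast+
  have perp: "g q (Z q) (n q) = 0" if "local_section A \<xi> V Z" "q \<in> U \<inter> V" for Z q
    using normal_iff_span[of q "Z q"] that \<xi>[of q] smooth_vfieldD[of V Z q] unfolding local_section_def by blast
  have Tp: "X p \<in> tangent_space A p" "Y p \<in> tangent_space A p" "m p \<in> tangent_space A p"
    using XV V smooth_vfieldD m unfolding unit_normal_def by blast+
  have "S p \<in> \<xi> p" "T p \<in> \<xi> p" using 1 p unfolding local_section_def by blast+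
  then have "g p (m p) (S p) = 0" "g p (m p) (T p) = 0" "g p (m p) (m p) = 1"
    using m V(2) metric_sym[OF Tp(3) frame_tangent(1)[OF p]] metric_sym[OF Tp(3) frame_tangent(2)[OF p]]
    unfolding unit_normal_def by auto
  \<comment> \<open>\<open>m p\<close> is orthogonal to the plane, hence a multiple of
    \<open>n p\<close>; the factor is a sign, recorded here as having square 1.\<close>
  then have me: "g p w (m p) = g p (m p) (n p) * g p w (n p)" and e2: "g p (m p) (n p) * g p (m p) (n p) = 1"
    if "w \<in> tangent_space A p" for w
    using frame_product[OF p that Tp(3)] frame_product[OF p Tp(3) Tp(3)] by (simp_all add: mult.commute)
  let ?e = "g p (m p) (n p)"
  let ?x1 = "g p (X p) (S p)" and ?x2 = "g p (X p) (T p)" and ?y1 = "g p (Y p) (S p)" and ?y2 = "g p (Y p) (T p)"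
  have \<beta>2: "g p (D Z Z' p) (n p) = g p (Z p) (S p) * (g p (Z' p) (S p) * \<beta> S S + g p (Z' p) (T p) * \<beta> S T) +
      g p (Z p) (T p) * (g p (Z' p) (S p) * \<beta> T S + g p (Z' p) (T p) * \<beta> T T)"
    if Z: "local_section A \<xi> V Z" "local_section A \<xi> V Z'" for Z Z'
  proof -
    have ZW: "smooth_vfield A (U \<inter> V) Z" "smooth_vfield A (U \<inter> V) Z'"
      using Z smooth_vfield_subset[OF _ Int_lower2] unfolding local_section_def by blast+
    have "g p (D Z Z' p) (n p) = g p (Z p) (S p) * g p (D S Z' p) (n p) + g p (Z p) (T p) * g p (D T Z' p) (n p)"
      by (rule W.connection_normal_left[OF o(2) ZW(1) perp[OF Z(1)] ZW(2)])
    moreover have "g p (D V' Z' p) (n p) = g p (Z' p) (S p) * g p (D V' S p) (n p) + g p (Z' p) (T p) * g p (D V' T p) (n p)"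
      if "smooth_vfield A (U \<inter> V) V'" for V'
      by (rule W.connection_normal_right[OF o(2) that ZW(2) perp[OF Z(2)]])
    ultimately show ?thesis
      unfolding \<beta>_def using W.frame_smooth(1,2) by simp
  qed
  have II: "second_fundamental_form g D m Z Z' p = ?e * ((g p (D Z Z' p) (n p) + g p (D Z' Z p) (n p)) / 2)"
    if Z: "local_section A \<xi> V Z" "local_section A \<xi> V Z'" for Z Z'
  proof -
    have ZV: "smooth_vfield A V Z" "smooth_vfield A V Z'" using Z unfolding local_section_def by blast+
    show ?thesis
      unfolding B[where m=m, OF V ZV Tp(3)] me[OF connection_tangent[OF V ZV]] me[OF connection_tangent[OF V ZV(2,1)]]
      by (simp add: algebra_simps)
  qed
  have d: "?x1 * ?y2 - ?x2 * ?y1 \<noteq> 0"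
    by (rule gram_frame_nonzero[OF p Tp(1) perp[OF X o(2)] Tp(2) perp[OF Y o(2)]]) (use i V in blast)
  let ?\<beta> = "\<beta> S S * \<beta> T T - ((\<beta> S T + \<beta> T S) / 2)\<^sup>2"
  have "k = (?e * ?e * ((?x1 * ?y2 - ?x2 * ?y1)\<^sup>2 * ?\<beta>)) / (?x1 * ?y2 - ?x2 * ?y1)\<^sup>2"
    unfolding k Let_def II[OF X X] II[OF Y Y] II[OF X Y] \<beta>2[OF X X] \<beta>2[OF Y Y] \<beta>2[OF X Y] \<beta>2[OF Y X]
      gram_frame[OF p Tp(1) perp[OF X o(2)] Tp(2) perp[OF Y o(2)]]
    by (rule arg_cong[where f="\<lambda>z. z / _"]) (simp add: power2_eq_square field_simps)
  also have "\<dots> = ?\<beta>" using d e2[OF tangent_zero] by simp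
  finally show "k = ?\<beta>" .
qed

text \<open>In the sum \<open>\<beta> S S * \<beta> T T\<close> cancels, and the mixed terms combine
  to minus the square of half of \<open>\<beta> S T - \<beta> T S\<close>, that is to
  \<open>- (c p)\<^sup>2 / 4\<close>. The part of \<open>[S,T]\<close> along \<open>n\<close>
  contributes a further \<open>- (c p)\<^sup>2 / 2\<close>, whence the coefficient 3/4.\<close>

lemma gaussian_curvature_frame:
  assumes p: "p \<in> U" and \<xi>: "\<And>q. q \<in> U \<Longrightarrow> \<xi> q = span {S q, T q}"
  defines "a \<equiv> \<lambda>q. g q (lie_bracket A S T q) (S q)"
    and "b \<equiv> \<lambda>q. g q (lie_bracket A S T q) (T q)"
    and "c \<equiv> \<lambda>q. g q (lie_bracket A S T q) (n q)"
  shows "gaussian_curvature A g D \<xi> p = S p b - T p a - (a p)\<^sup>2 - (b p)\<^sup>2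
      - c p / 2 * (g p (lie_bracket A n T p) (S p) - g p (lie_bracket A n S p) (T p)) - 3 / 4 * (c p)\<^sup>2"
proof -
  let ?\<beta> = "\<lambda>X Y. g p (D X Y p) (n p)"
  have 1: "?\<beta> S T = c p + ?\<beta> T S" using frame_curvature(2)[OF p] by (simp add: c_def)
  have 2: "extrinsic_curvature A g D \<xi> p = ?\<beta> S S * ?\<beta> T T - ((?\<beta> S T + ?\<beta> T S) / 2)\<^sup>2"
    by (rule extrinsic_curvature_frame[OF p \<xi>])
  have 3: "g p (Rm S T T p) (S p) = S p b - T p a - ?\<beta> S S * ?\<beta> T T + ?\<beta> S T * ?\<beta> T S - (a p)\<^sup>2 - (b p)\<^sup>2
      - c p / 2 * (c p + g p (lie_bracket A n T p) (S p) - g p (lie_bracket A n S p) (T p))"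
    unfolding a_def b_def c_def by (rule frame_curvature(1)[OF p])
  show ?thesis
    unfolding gaussian_curvature_def sectional_curvature_frame[OF p \<xi>[OF p]] 2 3 1
    by (simp add: power2_eq_square field_simps)
qed

end

section \<open>Rescaling the normal of a contact structure\<close>

text \<open>A dependent pair would be spanned by a single one of its members.\<close>

lemma indep_pair_if_dim_2:
  assumes "dim (span {u, v}) = 2"
  shows "indep_pair u v"
  unfolding indep_pair_def
proof
  show ne: "u \<noteq> v"
  proof
    assume "u = v"
    then have "dim (span {u, v}) \<le> card {u}" by (intro real_vector.dim_le_card) auto
    then show False using assms by simp
  qed
  show "independent {u, v}"
  proof
    assume "dependent {u, v}"
    then obtain w where w: "w \<in> {u, v}" "w \<in> span ({u, v} - {w})" unfolding dependent_def by blast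
    have "{u, v} \<subseteq> span ({u, v} - {w})"
    proof
      fix x assume x: "x \<in> {u, v}"
      show "x \<in> span ({u, v} - {w})"
      proof (cases "x = w")
        case True
        then show ?thesis using w(2) by simp
      next
        case False
        then show ?thesis using x by (intro span_base) simp
      qed
    qed
    then have "dim (span {u, v}) \<le> card ({u, v} - {w})"
      by (intro real_vector.dim_le_card) (simp_all add: span_minimal)
    also have "\<dots> = 1" using w(1) ne by auto
    finally show False using assms by simp
  qed
qed

context riemannian_manifold
begin

lemma parseval_frame_if_orthonormal:
  assumes "orthonormal_frame U S T n"
  shows "parseval_frame U (\<lambda>k. if k = 0 then S else if k = 1 then T else n)"
proof -
  have sum3: "(\<Sum>k<3. h k) = (h 0 + h 1) + h 2" for h :: "nat \<Rightarrow> 'm tvec"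
    by (simp add: numeral_3_eq_3 numeral_2_eq_2)
  show ?thesis
    using assms unfolding parseval_frame_def orthonormal_frame_def sum3 by simp
qed

end

locale contact_manifold = smooth_manifold A for A :: "'m::t2_space chart set" +
  fixes \<xi> :: "'m distribution" and \<alpha> :: "'m \<Rightarrow> 'm tvec \<Rightarrow> real"
  assumes contact: "contact_structure A \<xi>"
    and one_form: "one_form A \<alpha>"
    and kernel: "\<And>p. \<xi> p = {v \<in> tangent_space A p. \<alpha> p v = 0}"
begin

lemma form_linear:
  "u \<in> tangent_space A p \<Longrightarrow> v \<in> tangent_space A p \<Longrightarrow> \<alpha> p (a *\<^sub>R u + b *\<^sub>R v) = a * \<alpha> p u + b * \<alpha> p v"
  using one_form unfolding one_form_def by blast

lemma smooth_fun_form: "open U \<Longrightarrow> smooth_vfield A U X \<Longrightarrow> smooth_fun A U (\<lambda>p. \<alpha> p (X p))"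
  using one_form unfolding one_form_def by blast

lemma form_scale: "u \<in> tangent_space A p \<Longrightarrow> \<alpha> p (a *\<^sub>R u) = a * \<alpha> p u"
  using form_linear[of u p u a 0] by simp

lemma distribution_tangent: "u \<in> \<xi> p \<Longrightarrow> u \<in> tangent_space A p"
  by (simp add: kernel)

lemma distribution_dim: "dim (\<xi> p) = 2"
  using contact unfolding contact_structure_def plane_distribution_def by blast

lemma distribution_indep: "\<xi> q = span {u, v} \<Longrightarrow> indep_pair u v"
  using indep_pair_if_dim_2 distribution_dim[of q] by metis

text \<open>This is the contact condition in terms of the form: a tangent vector annihilated by
  \<alpha> lies in \<xi>. Independence of the two fields, which the condition requires, follows from
  the rank.\<close>

lemma form_bracket_nonzero:
  assumes U: "open U" "q \<in> U" and ST: "smooth_vfield A U S" "smooth_vfield A U T"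
    and \<xi>: "\<And>r. r \<in> U \<Longrightarrow> \<xi> r = span {S r, T r}"
  shows "\<alpha> q (lie_bracket A S T q) \<noteq> 0"
proof
  assume "\<alpha> q (lie_bracket A S T q) = 0"
  then have "lie_bracket A S T q \<in> \<xi> q"
    by (simp add: kernel tangent_lie_bracket[OF U ST])
  moreover have "indep_pair (S r) (T r)" if "r \<in> U" for r by (rule distribution_indep[OF \<xi>[OF that]])
  moreover have "local_section A \<xi> U S" "local_section A \<xi> U T"
    unfolding local_section_def using ST \<xi> by (auto simp: span_base)
  ultimately show False using contact U unfolding contact_structure_def by blast
qed

end

section \<open>The family of rescaled metrics\<close>

locale metric_family = contact_manifold A \<xi> \<alpha>
  for A :: "'m::t2_space chart set" and \<xi> \<alpha> +
  fixes R :: "'m vfield" and g0 :: "'m metric"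
  assumes transverse_smooth: "smooth_vfield A UNIV R"
    and transverse: "\<And>p. \<alpha> p (R p) = 1"
    and background: "riemannian_metric A g0"
begin

sublocale g0: riemannian_manifold A g0
  by unfold_locales (rule background)

lemma R_tangent: "R p \<in> tangent_space A p"
  using smooth_vfieldD[OF transverse_smooth] by simp

lemma smooth_R: "smooth_vfield A U R"
  by (rule smooth_vfield_subset[OF transverse_smooth]) simp

definition horizontal :: "'m \<Rightarrow> 'm tvec \<Rightarrow> 'm tvec" where
  "horizontal p u = u - \<alpha> p u *\<^sub>R R p"

lemma horizontal_mem: "u \<in> tangent_space A p \<Longrightarrow> horizontal p u \<in> \<xi> p"
  using form_linear[of u p "R p" 1 "- \<alpha> p u"] R_tangent[of p]
  by (simp add: kernel horizontal_def transverse tangent_diff tangent_scale)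

lemma horizontal_tangent: "u \<in> tangent_space A p \<Longrightarrow> horizontal p u \<in> tangent_space A p"
  by (rule distribution_tangent[OF horizontal_mem])

lemma horizontal_id: "u \<in> \<xi> p \<Longrightarrow> horizontal p u = u"
  by (simp add: kernel horizontal_def)

lemma horizontal_R: "horizontal p (R p) = 0"
  by (simp add: horizontal_def transverse)

lemma horizontal_linear:
  assumes "u \<in> tangent_space A p" "v \<in> tangent_space A p"
  shows "horizontal p (a *\<^sub>R u + b *\<^sub>R v) = a *\<^sub>R horizontal p u + b *\<^sub>R horizontal p v"
  unfolding horizontal_def form_linear[OF assms] by (simp add: algebra_simps)

lemma smooth_vfield_horizontal:
  "open U \<Longrightarrow> smooth_vfield A U X \<Longrightarrow> smooth_vfield A U (\<lambda>p. horizontal p (X p))"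
  unfolding horizontal_def by (intro smooth_vfield_diff smooth_vfield_scale smooth_fun_form smooth_R)

text \<open>The background enters only through its restriction to \<xi>, so \<open>R\<close> becomes
  orthogonal to \<xi> whatever its position relative to \<open>g0\<close>.\<close>

definition scaled_metric :: "real \<Rightarrow> ('m \<Rightarrow> real) \<Rightarrow> 'm metric" where
  "scaled_metric \<mu> h p u v = \<mu>\<^sup>2 * g0 p (horizontal p u) (horizontal p v) + (h p)\<^sup>2 * (\<alpha> p u * \<alpha> p v)"

abbreviation g1 :: "'m metric" where "g1 \<equiv> scaled_metric 1 (\<lambda>_. 1)"

lemma scaled_metric_horizontal:
  "u \<in> tangent_space A p \<Longrightarrow> v \<in> \<xi> p \<Longrightarrow> scaled_metric \<mu> h p u v = \<mu>\<^sup>2 * g1 p u v"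
  by (simp add: scaled_metric_def kernel)

lemma scaled_metric_R: "u \<in> tangent_space A p \<Longrightarrow> scaled_metric \<mu> h p u (R p) = (h p)\<^sup>2 * \<alpha> p u"
  by (simp add: scaled_metric_def horizontal_R transverse g0.metric_zero_right horizontal_tangent)

lemma riemannian_scaled_metric:
  assumes \<mu>: "\<mu> > 0" and h: "smooth_fun A UNIV h" "\<And>p. h p > 0"
  shows "riemannian_metric A (scaled_metric \<mu> h)"
  unfolding riemannian_metric_def
proof (rule conjI; intro allI ballI impI conjI; (elim conjE)?)
  fix p u v w and a b :: real
  assume T: "u \<in> tangent_space A p" "v \<in> tangent_space A p" "w \<in> tangent_space A p"
  note H = horizontal_tangent[OF T(1)] horizontal_tangent[OF T(2)] horizontal_tangent[OF T(3)]
  show "scaled_metric \<mu> h p u v = scaled_metric \<mu> h p v u"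
    unfolding scaled_metric_def g0.metric_sym[OF H(1,2)] by simp
  show "scaled_metric \<mu> h p (a *\<^sub>R u + b *\<^sub>R v) w = a * scaled_metric \<mu> h p u w + b * scaled_metric \<mu> h p v w"
    unfolding scaled_metric_def horizontal_linear[OF T(1,2)] g0.metric_lin_left[OF H] form_linear[OF T(1,2)]
    by (simp add: algebra_simps)
  show "scaled_metric \<mu> h p u u > 0" if "u \<noteq> 0"
  proof (cases "horizontal p u = 0")
    case True
    then have "u = \<alpha> p u *\<^sub>R R p" by (simp add: horizontal_def)
    with that have "\<alpha> p u \<noteq> 0" by (metis scaleR_zero_left)
    then have "\<alpha> p u * \<alpha> p u > 0" using not_real_square_gt_zero by blast
    then have "(h p)\<^sup>2 * (\<alpha> p u * \<alpha> p u) > 0" using h(2)[of p] by simp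
    then show ?thesis by (simp add: scaled_metric_def True g0.metric_zero_right tangent_zero)
  next
    case False
    then have "g0 p (horizontal p u) (horizontal p u) > 0" by (rule g0.metric_pos[OF H(1)])
    then show ?thesis using \<mu> by (simp add: scaled_metric_def add_pos_nonneg)
  qed
next
  fix U X Y assume U: "open U" and X: "smooth_vfield A U X" and Y: "smooth_vfield A U Y"
  show "smooth_fun A U (\<lambda>p. scaled_metric \<mu> h p (X p) (Y p))"
    unfolding scaled_metric_def power2_eq_square
    by (rule smooth_fun_add[OF U] smooth_fun_mult[OF U] smooth_fun_const[OF U] g0.smooth_fun_metric[OF U]
        smooth_vfield_horizontal[OF U] smooth_fun_form[OF U] X Y smooth_fun_subset[OF h(1) subset_UNIV])+
qed

sublocale g1: riemannian_manifold A g1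
  by unfold_locales (rule riemannian_scaled_metric, simp_all add: smooth_fun_const)

definition adapted_frame :: "'m set \<Rightarrow> 'm vfield \<Rightarrow> 'm vfield \<Rightarrow> bool" where
  "adapted_frame U S T \<longleftrightarrow> open U \<and> smooth_vfield A U S \<and> smooth_vfield A U T \<and>
    (\<forall>q\<in>U. \<xi> q = span {S q, T q} \<and> g1 q (S q) (S q) = 1 \<and> g1 q (T q) (T q) = 1 \<and> g1 q (S q) (T q) = 0)"

text \<open>Gram-Schmidt is applied to local fields spanning \<xi>. The rank makes them independent,
  so the functions under the square roots are positive and the normalised fields stay
  smooth.\<close>

lemma adapted_frame_exists: "\<exists>U S T. p \<in> U \<and> adapted_frame U S T"
proof -
  have pd: "plane_distribution A \<xi>" using contact unfolding contact_structure_def by blast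
  then obtain U S T where U: "open U" "p \<in> U" and ST: "smooth_vfield A U S" "smooth_vfield A U T"
    and \<xi>: "\<forall>q\<in>U. \<xi> q = span {S q, T q}" unfolding plane_distribution_def by metis
  have i: "indep_pair (S q) (T q)" if "q \<in> U" for q
    by (rule distribution_indep) (use \<xi> that in blast)
  note t = smooth_vfieldD[OF ST(1)] smooth_vfieldD[OF ST(2)]
  define N where "N = (\<lambda>q. inverse (sqrt (g1 q (S q) (S q))))"
  define S' where "S' = (\<lambda>q. N q *\<^sub>R S q)"
  have Sp: "g1 q (S q) (S q) > 0" if "q \<in> U" for q
  proof (rule g1.metric_pos[OF t(1)[OF that]])
    show "S q \<noteq> 0" using i[OF that, unfolded indep_pair_iff, rule_format, of 1 0] by auto
  qed
  have N: "smooth_fun A U N" unfolding N_def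
    by (rule smooth_fun_inverse[OF U(1) smooth_fun_sqrt[OF U(1) g1.smooth_fun_metric[OF U(1) ST(1,1)]]])
      (auto dest: Sp)
  have Np: "N q > 0" if "q \<in> U" for q using Sp[OF that] by (simp add: N_def)
  have S': "smooth_vfield A U S'" unfolding S'_def by (rule smooth_vfield_scale[OF U(1) N ST(1)])
  note t' = smooth_vfieldD[OF S']
  have S1: "g1 q (S' q) (S' q) = 1" if "q \<in> U" for q
    using Sp[OF that] t(1)[OF that]
    by (simp add: S'_def g1.metric_linear tangent_scale N_def field_simps)
  define V where "V = (\<lambda>q. T q - g1 q (T q) (S' q) *\<^sub>R S' q)"
  have V: "smooth_vfield A U V" unfolding V_def
    by (rule smooth_vfield_diff[OF U(1) ST(2) smooth_vfield_scale[OF U(1) g1.smooth_fun_metric[OF U(1) ST(2) S'] S']])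
  have V0: "V q \<noteq> 0" if q: "q \<in> U" for q
  proof
    assume "V q = 0"
    then have "(- g1 q (T q) (S' q) * N q) *\<^sub>R S q + 1 *\<^sub>R T q = 0" by (simp add: V_def S'_def)
    then show False using i[OF q] unfolding indep_pair_iff by (metis zero_neq_one)
  qed
  have VS: "g1 q (S' q) (V q) = 0" if q: "q \<in> U" for q
    using S1[OF q] t(2)[OF q] t'[OF q] g1.metric_sym[OF t(2)[OF q] t'[OF q]]
    by (simp add: V_def g1.metric_linear tangent_scale)
  have Vp: "g1 q (V q) (V q) > 0" if "q \<in> U" for q
    by (rule g1.metric_pos[OF smooth_vfieldD[OF V that] V0[OF that]])
  define M where "M = (\<lambda>q. inverse (sqrt (g1 q (V q) (V q))))"
  define T' where "T' = (\<lambda>q. M q *\<^sub>R V q)"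
  have M: "smooth_fun A U M" unfolding M_def
    by (rule smooth_fun_inverse[OF U(1) smooth_fun_sqrt[OF U(1) g1.smooth_fun_metric[OF U(1) V V]]])
      (auto dest: Vp)
  have Mp: "M q > 0" if "q \<in> U" for q using Vp[OF that] by (simp add: M_def)
  have T': "smooth_vfield A U T'" unfolding T'_def by (rule smooth_vfield_scale[OF U(1) M V])
  have T1: "g1 q (T' q) (T' q) = 1" if "q \<in> U" for q
    using Vp[OF that] smooth_vfieldD[OF V that]
    by (simp add: T'_def g1.metric_linear tangent_scale M_def field_simps)
  have ST': "g1 q (S' q) (T' q) = 0" if "q \<in> U" for q
    using VS[OF that] smooth_vfieldD[OF V that] t'[OF that] by (simp add: T'_def g1.metric_linear)
  have "span {S q, T q} = span {S' q, T' q}" if q: "q \<in> U" for q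
  proof (rule subset_antisym; rule span_minimal[OF _ subspace_span]; safe)
    let ?k = "g1 q (T q) (S' q)"
    have "S' q = N q *\<^sub>R S q + 0 *\<^sub>R T q" by (simp add: S'_def)
    then show "S' q \<in> span {S q, T q}" unfolding span_pair by blast
    have "T' q = (- M q * ?k * N q) *\<^sub>R S q + M q *\<^sub>R T q"
      by (simp add: T'_def V_def scaleR_diff_right) (simp add: S'_def)
    then show "T' q \<in> span {S q, T q}" unfolding span_pair by blast
    have "S q = inverse (N q) *\<^sub>R S' q + 0 *\<^sub>R T' q" using Np[OF q] by (simp add: S'_def)
    then show "S q \<in> span {S' q, T' q}" unfolding span_pair by blast
    have "V q = inverse (M q) *\<^sub>R T' q" using Mp[OF q] by (simp add: T'_def)
    then have "T q = ?k *\<^sub>R S' q + inverse (M q) *\<^sub>R T' q" by (simp add: V_def algebra_simps)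
    then show "T q \<in> span {S' q, T' q}" unfolding span_pair by blast
  qed
  then have "adapted_frame U S' T'"
    unfolding adapted_frame_def using U(1) S' T' \<xi> S1 T1 ST' by simp
  with U(2) show ?thesis by blast
qed

text \<open>This is the function \<open>F\<close> of the overview, computed in one frame. That other
  adapted frames give the same value is not visible here; it results from comparing the Gaussian
  curvatures of two metrics in the family.\<close>

definition frame_invariant :: "'m vfield \<Rightarrow> 'm vfield \<Rightarrow> 'm \<Rightarrow> real" where
  "frame_invariant S T = (\<lambda>p. S p (\<lambda>q. g1 q (lie_bracket A S T q) (T q)) - T p (\<lambda>q. g1 q (lie_bracket A S T q) (S q))
    - (g1 p (lie_bracket A S T p) (S p))\<^sup>2 - (g1 p (lie_bracket A S T p) (T p))\<^sup>2
    - \<alpha> p (lie_bracket A S T p) / 2 * (g1 p (lie_bracket A R T p) (S p) - g1 p (lie_bracket A R S p) (T p)))"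

context
  fixes U S T
  assumes af: "adapted_frame U S T"
begin

lemma af_open: "open U" and af_smooth: "smooth_vfield A U S" "smooth_vfield A U T"
  and af_span: "q \<in> U \<Longrightarrow> \<xi> q = span {S q, T q}"
  and af_inner: "q \<in> U \<Longrightarrow> g1 q (S q) (S q) = 1" "q \<in> U \<Longrightarrow> g1 q (T q) (T q) = 1" "q \<in> U \<Longrightarrow> g1 q (S q) (T q) = 0"
  using af unfolding adapted_frame_def by blast+

lemma af_mem: "q \<in> U \<Longrightarrow> S q \<in> \<xi> q" "q \<in> U \<Longrightarrow> T q \<in> \<xi> q"
  by (simp_all add: af_span span_base)

lemma af_tangent: "q \<in> U \<Longrightarrow> S q \<in> tangent_space A q" "q \<in> U \<Longrightarrow> T q \<in> tangent_space A q"
  using af_mem distribution_tangent by blast+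

lemma af_inner': "q \<in> U \<Longrightarrow> g1 q (T q) (S q) = 0"
  using af_inner(3) g1.metric_sym[OF af_tangent] by simp

lemma af_expand:
  assumes q: "q \<in> U" and u: "u \<in> tangent_space A q"
  shows "u = (g1 q u (S q) *\<^sub>R S q + g1 q u (T q) *\<^sub>R T q) + \<alpha> q u *\<^sub>R R q"
proof -
  note t = af_tangent[OF q] and m = af_mem[OF q]
  have "horizontal q u \<in> span {S q, T q}" using horizontal_mem[OF u] af_span[OF q] by simp
  then obtain a b where ab: "horizontal q u = a *\<^sub>R S q + b *\<^sub>R T q" unfolding span_pair by blast
  have g: "g1 q u v = g1 q (horizontal q u) v" if "v \<in> \<xi> q" for v
    using horizontal_id[OF horizontal_mem[OF u]] that horizontal_mem[OF u] by (simp add: scaled_metric_def kernel)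
  have "g1 q u (S q) = a" "g1 q u (T q) = b"
    unfolding g[OF m(1)] g[OF m(2)] ab using t af_inner[OF q] af_inner'[OF q]
    by (simp_all add: g1.metric_linear tangent_scale)
  then show ?thesis using ab by (simp add: horizontal_def algebra_simps)
qed

context
  fixes \<mu> :: real and h :: "'m \<Rightarrow> real"
  assumes \<mu>: "\<mu> > 0" and h: "smooth_fun A UNIV h" "\<And>p. h p > 0"
begin

interpretation m: riemannian_manifold A "scaled_metric \<mu> h"
  by unfold_locales (rule riemannian_scaled_metric[OF \<mu> h])

abbreviation "S\<^sub>\<mu> \<equiv> \<lambda>q. (1 / \<mu>) *\<^sub>R S q"
abbreviation "T\<^sub>\<mu> \<equiv> \<lambda>q. (1 / \<mu>) *\<^sub>R T q"
abbreviation "R\<^sub>h \<equiv> \<lambda>q. (1 / h q) *\<^sub>R R q"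

lemma smooth_inverse_h: "open V \<Longrightarrow> smooth_fun A V (\<lambda>q. 1 / h q)"
  by (rule smooth_fun_divide[OF _ smooth_fun_const smooth_fun_subset[OF h(1)]]) (simp_all add: h(2)[THEN less_imp_neq, symmetric])

lemma scaled_smooth: "smooth_vfield A U S\<^sub>\<mu>" "smooth_vfield A U T\<^sub>\<mu>" "smooth_vfield A U R\<^sub>h"
  by (rule smooth_vfield_scale[OF af_open smooth_fun_const[OF af_open] af_smooth(1)]
      smooth_vfield_scale[OF af_open smooth_fun_const[OF af_open] af_smooth(2)]
      smooth_vfield_scale[OF af_open smooth_inverse_h[OF af_open] smooth_R])+

lemma scaled_metric_frame:
  assumes q: "q \<in> U" and u: "u \<in> tangent_space A q"
  shows "scaled_metric \<mu> h q u (S\<^sub>\<mu> q) = \<mu> * g1 q u (S q)" "scaled_metric \<mu> h q u (T\<^sub>\<mu> q) = \<mu> * g1 q u (T q)"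
    "scaled_metric \<mu> h q u (R\<^sub>h q) = h q * \<alpha> q u"
  using \<mu> h(2)[of q]
  by (simp_all add: m.metric_scale_right u af_tangent[OF q] R_tangent scaled_metric_horizontal[OF u af_mem(1)[OF q], of \<mu> h]
      scaled_metric_horizontal[OF u af_mem(2)[OF q], of \<mu> h] scaled_metric_R power2_eq_square)

lemma scaled_orthonormal: "m.orthonormal_frame U S\<^sub>\<mu> T\<^sub>\<mu> R\<^sub>h"
  unfolding m.orthonormal_frame_def
proof (intro conjI ballI af_open scaled_smooth)
  fix q assume q: "q \<in> U"
  note t = af_tangent[OF q] and ts = tangent_scale[OF af_tangent(1)[OF q]] tangent_scale[OF af_tangent(2)[OF q]] tangent_scale[OF R_tangent[of q]]
  have z: "\<alpha> q (S q) = 0" "\<alpha> q (T q) = 0" using af_mem[OF q] by (simp_all add: kernel)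
  show "scaled_metric \<mu> h q (S\<^sub>\<mu> q) (S\<^sub>\<mu> q) = 1" "scaled_metric \<mu> h q (T\<^sub>\<mu> q) (T\<^sub>\<mu> q) = 1"
    "scaled_metric \<mu> h q (R\<^sub>h q) (R\<^sub>h q) = 1" "scaled_metric \<mu> h q (S\<^sub>\<mu> q) (T\<^sub>\<mu> q) = 0"
    "scaled_metric \<mu> h q (S\<^sub>\<mu> q) (R\<^sub>h q) = 0" "scaled_metric \<mu> h q (T\<^sub>\<mu> q) (R\<^sub>h q) = 0"
    using \<mu> h(2)[of q]
    by (simp_all add: scaled_metric_frame[OF q] ts g1.metric_scale_left t af_inner[OF q] form_scale z R_tangent transverse)
  fix u assume u: "u \<in> tangent_space A q"
  show "u = (scaled_metric \<mu> h q u (S\<^sub>\<mu> q) *\<^sub>R S\<^sub>\<mu> q + scaled_metric \<mu> h q u (T\<^sub>\<mu> q) *\<^sub>R T\<^sub>\<mu> q) + scaled_metric \<mu> h q u (R\<^sub>h q) *\<^sub>R R\<^sub>h q"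
  proof -
    have "(\<mu> * x) *\<^sub>R (1 / \<mu>) *\<^sub>R w = x *\<^sub>R w" "(h q * x) *\<^sub>R (1 / h q) *\<^sub>R w = x *\<^sub>R w"
      for x and w :: "'m tvec" using \<mu> h(2)[of q] by simp_all
    then show ?thesis unfolding scaled_metric_frame[OF q u] by (simp only:) (rule af_expand[OF q u])
  qed
qed

lemma scaled_bracket:
  assumes q: "q \<in> U"
  shows "lie_bracket A S\<^sub>\<mu> T\<^sub>\<mu> q = (1 / \<mu>\<^sup>2) *\<^sub>R lie_bracket A S T q"
proof -
  note k = smooth_fun_const[OF af_open, of "1 / \<mu>"]
  have "lie_bracket A S\<^sub>\<mu> T\<^sub>\<mu> q = (1 / \<mu>) *\<^sub>R lie_bracket A S\<^sub>\<mu> T q"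
    using lie_bracket_scale_right[OF af_open q scaled_smooth(1) af_smooth(2) k]
      tangent_apply_const[OF smooth_vfieldD[OF scaled_smooth(1) q]] by simp
  also have "lie_bracket A S\<^sub>\<mu> T q = (1 / \<mu>) *\<^sub>R lie_bracket A S T q"
    using lie_bracket_scale_left[OF af_open q af_smooth(1,2) k]
      tangent_apply_const[OF smooth_vfieldD[OF af_smooth(2) q]] by simp
  finally show ?thesis by (simp add: power2_eq_square)
qed

text \<open>The Leibniz term of the bracket is a multiple of \<open>R\<close> and thus orthogonal to
  \<open>v\<close>. Of the metric factor \<open>\<mu>\<^sup>2\<close> one power is used up by the
  rescaled field.\<close>

lemma scaled_bracket_transverse:
  assumes q: "q \<in> U" and X: "smooth_vfield A U X" and v: "v \<in> \<xi> q"
  shows "scaled_metric \<mu> h q (lie_bracket A R\<^sub>h (\<lambda>q. (1 / \<mu>) *\<^sub>R X q) q) v = \<mu> / h q * g1 q (lie_bracket A R X q) v"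
proof -
  note k = smooth_fun_const[OF af_open, of "1 / \<mu>"]
  have vt: "v \<in> tangent_space A q" by (rule distribution_tangent[OF v])
  have b: "lie_bracket A R X q \<in> tangent_space A q" by (rule tangent_lie_bracket[OF af_open q smooth_R X])
  have "lie_bracket A R\<^sub>h (\<lambda>q. (1 / \<mu>) *\<^sub>R X q) q = (1 / \<mu>) *\<^sub>R lie_bracket A R\<^sub>h X q"
    using lie_bracket_scale_right[OF af_open q scaled_smooth(3) X k]
      tangent_apply_const[OF smooth_vfieldD[OF scaled_smooth(3) q]] by simp
  also have "lie_bracket A R\<^sub>h X q = (1 / h q) *\<^sub>R lie_bracket A R X q - X q (\<lambda>q. 1 / h q) *\<^sub>R R q"
    by (rule lie_bracket_scale_left[OF af_open q smooth_R X smooth_inverse_h[OF af_open]])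
  finally have e: "lie_bracket A R\<^sub>h (\<lambda>q. (1 / \<mu>) *\<^sub>R X q) q =
      (1 / \<mu>) *\<^sub>R ((1 / h q) *\<^sub>R lie_bracket A R X q - X q (\<lambda>q. 1 / h q) *\<^sub>R R q)" .
  have "g1 q (R q) v = 0"
    using v by (simp add: scaled_metric_def horizontal_R kernel g0.metric_zero_left horizontal_tangent)
  then show ?thesis
    unfolding e scaled_metric_horizontal[OF tangent_scale[OF tangent_diff[OF tangent_scale[OF b] tangent_scale[OF R_tangent]]] v, of \<mu> h]
    using \<mu> by (simp add: g1.metric_linear tangent_diff tangent_scale b R_tangent vt power2_eq_square)
qed

text \<open>No derivative of \<open>h\<close> occurs: it could only come from \<open>[R/h, X]\<close>, where it multiplies \<open>R\<close>.\<close>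

lemma scaled_gaussian_curvature:
  assumes p: "p \<in> U" and D: "levi_civita A (scaled_metric \<mu> h) D"
  shows "gaussian_curvature A (scaled_metric \<mu> h) D \<xi> p =
    frame_invariant S T p / \<mu>\<^sup>2 - 3 / 4 * (h p)\<^sup>2 * (\<alpha> p (lie_bracket A S T p))\<^sup>2 / \<mu>^4"
proof -
  interpret c: curvature_frame A "scaled_metric \<mu> h" D U "S\<^sub>\<mu>" "T\<^sub>\<mu>" "R\<^sub>h"
    by unfold_locales (rule D scaled_orthonormal)+
  note bt = tangent_lie_bracket[OF af_open _ af_smooth]
  have span: "\<xi> q = span {S\<^sub>\<mu> q, T\<^sub>\<mu> q}" if q: "q \<in> U" for q
  proof -
    have "\<xi> q = {u \<in> tangent_space A q. u \<in> span {S\<^sub>\<mu> q, T\<^sub>\<mu> q}}"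
      using c.normal_iff_span[OF q] scaled_metric_frame(3)[OF q] h(2)[of q] by (auto simp: kernel)
    moreover have "span {S\<^sub>\<mu> q, T\<^sub>\<mu> q} \<subseteq> tangent_space A q"
      by (rule span_minimal[OF _ subspace_tangent_space]) (use c.frame_tangent[OF q] in blast)
    ultimately show ?thesis by blast
  qed
  have b: "scaled_metric \<mu> h q (lie_bracket A S\<^sub>\<mu> T\<^sub>\<mu> q) (S\<^sub>\<mu> q) = 1 / \<mu> * g1 q (lie_bracket A S T q) (S q)"
    "scaled_metric \<mu> h q (lie_bracket A S\<^sub>\<mu> T\<^sub>\<mu> q) (T\<^sub>\<mu> q) = 1 / \<mu> * g1 q (lie_bracket A S T q) (T q)"
    "scaled_metric \<mu> h q (lie_bracket A S\<^sub>\<mu> T\<^sub>\<mu> q) (R\<^sub>h q) = h q / \<mu>\<^sup>2 * \<alpha> q (lie_bracket A S T q)"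
    if q: "q \<in> U" for q
    unfolding scaled_bracket[OF q] scaled_metric_frame[OF q tangent_scale[OF bt[OF q]]]
    using \<mu> af_tangent[OF q] by (simp_all add: g1.metric_scale_left form_scale bt[OF q] power2_eq_square)
  have d: "((1 / \<mu>) *\<^sub>R X p) (\<lambda>q. scaled_metric \<mu> h q (lie_bracket A S\<^sub>\<mu> T\<^sub>\<mu> q) (Z' q)) = 1 / \<mu>\<^sup>2 * X p (\<lambda>q. g1 q (lie_bracket A S T q) (Z q))"
    if X: "smooth_vfield A U X" and Z: "smooth_vfield A U Z"
      and e: "\<And>q. q \<in> U \<Longrightarrow> scaled_metric \<mu> h q (lie_bracket A S\<^sub>\<mu> T\<^sub>\<mu> q) (Z' q) = 1 / \<mu> * g1 q (lie_bracket A S T q) (Z q)"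
    for X Z Z'
  proof -
    have Xp: "X p \<in> tangent_space A p" by (rule smooth_vfieldD[OF X p])
    have "X p (\<lambda>q. scaled_metric \<mu> h q (lie_bracket A S\<^sub>\<mu> T\<^sub>\<mu> q) (Z' q)) = X p (\<lambda>q. 1 / \<mu> * g1 q (lie_bracket A S T q) (Z q))"
      by (rule tangent_apply_cong[OF Xp af_open p e])
    also have "\<dots> = 1 / \<mu> * X p (\<lambda>q. g1 q (lie_bracket A S T q) (Z q))"
      by (rule tangent_apply_cmult[OF Xp smooth_nearI[OF af_open p g1.smooth_fun_metric[OF af_open smooth_vfield_lie_bracket[OF af_open af_smooth] Z]]])
    finally show ?thesis by (simp add: scaleR_fun_apply power2_eq_square)
  qed
  have t: "scaled_metric \<mu> h p (lie_bracket A R\<^sub>h T\<^sub>\<mu> p) (S\<^sub>\<mu> p) = 1 / h p * g1 p (lie_bracket A R T p) (S p)"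
    "scaled_metric \<mu> h p (lie_bracket A R\<^sub>h S\<^sub>\<mu> p) (T\<^sub>\<mu> p) = 1 / h p * g1 p (lie_bracket A R S p) (T p)"
    using scaled_bracket_transverse[OF p af_smooth(2) af_mem(1)[OF p]] scaled_bracket_transverse[OF p af_smooth(1) af_mem(2)[OF p]]
      tangent_lie_bracket[OF af_open p scaled_smooth(3,2)] tangent_lie_bracket[OF af_open p scaled_smooth(3,1)]
      af_tangent[OF p] \<mu> by (simp_all add: m.metric_scale_right)
  \<comment> \<open>\<open>k\<close> stands for \<open>h p\<close>. It appears as \<open>k\<close>
    in the normal part of \<open>[S,T]\<close> and as \<open>1 / k\<close> in the transverse
    brackets, so it survives only in the last square.\<close>
  have alg: "1 / \<mu>\<^sup>2 * x - 1 / \<mu>\<^sup>2 * y - (1 / \<mu> * a)\<^sup>2 - (1 / \<mu> * b)\<^sup>2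
      - (k / \<mu>\<^sup>2 * c) / 2 * (1 / k * r - 1 / k * s) - 3 / 4 * (k / \<mu>\<^sup>2 * c)\<^sup>2
     = (x - y - a\<^sup>2 - b\<^sup>2 - c / 2 * (r - s)) / \<mu>\<^sup>2 - 3 / 4 * k\<^sup>2 * c\<^sup>2 / \<mu>^4" if "k > 0" for x y a b c r s k
    using \<mu> that by (simp add: field_simps power2_eq_square eval_nat_numeral)
  have dS: "((1 / \<mu>) *\<^sub>R S p) (\<lambda>q. scaled_metric \<mu> h q (lie_bracket A S\<^sub>\<mu> T\<^sub>\<mu> q) (T\<^sub>\<mu> q)) =
      1 / \<mu>\<^sup>2 * S p (\<lambda>q. g1 q (lie_bracket A S T q) (T q))"
    by (rule d[OF af_smooth b(2)])
  have dT: "((1 / \<mu>) *\<^sub>R T p) (\<lambda>q. scaled_metric \<mu> h q (lie_bracket A S\<^sub>\<mu> T\<^sub>\<mu> q) (S\<^sub>\<mu> q)) =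
      1 / \<mu>\<^sup>2 * T p (\<lambda>q. g1 q (lie_bracket A S T q) (S q))"
    by (rule d[OF af_smooth(2,1) b(1)])
  note c.gaussian_curvature_frame[OF p, of \<xi>, OF span, unfolded b[OF p] t dS dT]
  then show ?thesis unfolding frame_invariant_def alg[OF h(2)[of p]] .
qed

end

lemma smooth_frame_invariant: "smooth_fun A U (frame_invariant S T)"
  unfolding frame_invariant_def power2_eq_square
  by (rule af_open af_smooth smooth_R smooth_fun_diff smooth_fun_mult g1.smooth_fun_metric smooth_vfield_lie_bracket
      smooth_fun_form smooth_fun_divide smooth_fun_const smooth_vfield_apply'[OF af_smooth(1) af_open]
      smooth_vfield_apply'[OF af_smooth(2) af_open] | simp)+

end

text \<open>The frames required by the Koszul construction are the adapted frames, rescaled and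
  completed by \<open>R / h\<close>.\<close>

lemma levi_civita_exists:
  assumes \<mu>: "\<mu> > 0" and h: "smooth_fun A UNIV h" "\<And>p. h p > 0"
  shows "\<exists>D. levi_civita A (scaled_metric \<mu> h) D"
proof -
  interpret m: riemannian_manifold A "scaled_metric \<mu> h"
    by unfold_locales (rule riemannian_scaled_metric[OF \<mu> h])
  interpret m: framed_riemannian_manifold A "scaled_metric \<mu> h"
  proof
    fix p
    obtain U S T where "p \<in> U" "adapted_frame U S T" using adapted_frame_exists by blast
    then show "\<exists>U e. p \<in> U \<and> m.parseval_frame U e"
      using m.parseval_frame_if_orthonormal[OF scaled_orthonormal[OF _ \<mu> h]] by blast
  qed
  show ?thesis using m.levi_civita_lc_connection by blast
qed

end

section \<open>Cutoff functions and the background data\<close>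

lemma smooth_on_bump:
  fixes a :: "'a::euclidean_space"
  assumes S: "open S"
  shows "smooth_on S (\<lambda>x. flat_exp 0 (c + (-1) * ((x - a) \<bullet> (x - a))))"
proof (rule smooth_on_compose[OF S open_UNIV _ _ smooth_flat_exp])
  have d: "smooth_on S (\<lambda>x. x - a)"
    using smooth_on_add[OF S smooth_on_id[OF S] smooth_on_const[OF S, of "- a"]] by simp
  then have "smooth_on S (\<lambda>x. (x - a) \<bullet> (x - a))"
    unfolding smooth_on_def using times_diff_bilinear[OF bounded_bilinear_inner S] by blast
  then show "smooth_on S (\<lambda>x. c + (-1) * ((x - a) \<bullet> (x - a)))"
    by (intro smooth_on_add smooth_on_mult smooth_on_const S)
qed simp

context smooth_manifold
begin

text \<open>The closed set \<open>K\<close> makes \<open>U\<close> and \<open>- K\<close> an open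
  cover of the manifold. Products of \<open>b\<close> with objects smooth on \<open>U\<close> are
  smooth on both, hence everywhere, whatever the values of these objects outside
  \<open>U\<close>.\<close>

definition cutoff :: "'m set \<Rightarrow> ('m \<Rightarrow> real) \<Rightarrow> bool" where
  "cutoff U b \<longleftrightarrow> smooth_fun A UNIV b \<and> (\<exists>K\<subseteq>U. closed K \<and> (\<forall>q. q \<notin> K \<longrightarrow> b q = 0))"

text \<open>The chart pulls back a radial bump that is positive inside a ball contained in the chart
  image and zero outside.\<close>

lemma cutoff_exists:
  assumes c: "(U, \<phi>) \<in> A" "p \<in> U"
  obtains b where "cutoff U b" "b p > 0"
proof -
  obtain r where r: "r > 0" "cball (\<phi> p) r \<subseteq> \<phi> ` U"
    using chart_open_image[OF c(1)] c(2) by (meson imageI open_contains_cball)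
  define K where "K = inv_into U \<phi> ` cball (\<phi> p) r"
  define b where "b = (\<lambda>q. if q \<in> U then flat_exp 0 (r\<^sup>2 + (-1) * ((\<phi> q - \<phi> p) \<bullet> (\<phi> q - \<phi> p))) else 0)"
  have KU: "K \<subseteq> U" unfolding K_def using r(2) inv_into_into[of _ \<phi> U] by blast
  have "compact K" unfolding K_def
    by (rule compact_continuous_image[OF continuous_on_subset[OF homeomorphism_cont2[OF chart_homeomorphism[OF c(1)]] r(2)] compact_cball])
  \<comment> \<open>The Hausdorff property enters here: the set has to be closed in the whole
    manifold, not just in \<open>U\<close>.\<close>
  then have K: "closed K" by (rule compact_imp_closed)
  have b0: "b q = 0" if "q \<notin> K" for q
  proof (cases "q \<in> U")
    case True
    have "\<phi> q \<notin> cball (\<phi> p) r"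
    proof
      assume "\<phi> q \<in> cball (\<phi> p) r"
      then have "inv_into U \<phi> (\<phi> q) \<in> K" unfolding K_def by (rule imageI)
      then show False using that chart_inv[OF c(1) True] by simp
    qed
    then have "r < norm (\<phi> q - \<phi> p)" by (simp add: dist_norm norm_minus_commute)
    then have "r\<^sup>2 < (norm (\<phi> q - \<phi> p))\<^sup>2" using r(1) by (intro power_strict_mono) auto
    then show ?thesis by (simp add: b_def flat_exp_def power2_norm_eq_inner)
  qed (simp add: b_def)
  have "smooth_fun A U b"
  proof (rule smooth_fun_chartI[OF c(1) chart_open[OF c(1)]])
    have "smooth_on (\<phi> ` U) (\<lambda>x. flat_exp 0 (r\<^sup>2 + (-1) * ((x - \<phi> p) \<bullet> (x - \<phi> p))))"
      by (rule smooth_on_bump[OF chart_open_image[OF c(1)]])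
    then show "smooth_on (\<phi> ` U) (b \<circ> inv_into U \<phi>)"
      by (rule iffD1[OF smooth_on_cong[OF chart_open_image[OF c(1)]], rotated]) (auto simp: b_def chart_inv[OF c(1)])
  qed simp
  moreover have "smooth_fun A (- K) b"
    by (rule smooth_fun_cong[OF _ _ smooth_fun_const[of _ 0]]) (use K b0 in auto)
  ultimately have "smooth_fun A UNIV b"
    by (intro smooth_fun_local) (metis ComplI K KU chart_open[OF c(1)] open_Compl subsetD)
  then have "cutoff U b" unfolding cutoff_def using KU K b0 by blast
  moreover have "b p > 0" using c(2) r(1) by (simp add: b_def flat_exp_def)
  ultimately show ?thesis by (rule that)
qed

lemma smooth_fun_cutoff_mult:
  assumes b: "cutoff U b" and U: "open U" and f: "smooth_fun A U f"
  shows "smooth_fun A UNIV (\<lambda>q. b q * f q)"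
proof (rule smooth_fun_local)
  fix p :: 'm
  obtain K where K: "K \<subseteq> U" "closed K" "\<And>q. q \<notin> K \<Longrightarrow> b q = 0" using b unfolding cutoff_def by blast
  have bU: "smooth_fun A U b" using b smooth_fun_subset unfolding cutoff_def by blast
  have 1: "smooth_fun A U (\<lambda>q. b q * f q)" by (rule smooth_fun_mult[OF U bU f])
  have "smooth_fun A (- K) (\<lambda>q. b q * f q)"
    by (rule smooth_fun_cong[OF _ _ smooth_fun_const[of _ 0]]) (use K in auto)
  with 1 show "\<exists>V. open V \<and> p \<in> V \<and> smooth_fun A V (\<lambda>q. b q * f q)"
    using K(1) U open_Compl[OF K(2)] by blast
qed

lemma smooth_vfield_cutoff_scale:
  assumes b: "cutoff U b" and U: "open U" and X: "smooth_vfield A U X"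
  shows "smooth_vfield A UNIV (\<lambda>q. b q *\<^sub>R X q)"
proof (rule smooth_vfield_local)
  fix p :: 'm
  obtain K where K: "K \<subseteq> U" "closed K" "\<And>q. q \<notin> K \<Longrightarrow> b q = 0" using b unfolding cutoff_def by blast
  have bU: "smooth_fun A U b" using b smooth_fun_subset unfolding cutoff_def by blast
  have 1: "smooth_vfield A U (\<lambda>q. b q *\<^sub>R X q)" by (rule smooth_vfield_scale[OF U bU X])
  have "smooth_vfield A (- K) (\<lambda>q. b q *\<^sub>R X q)"
    by (rule smooth_vfield_cong[OF _ _ smooth_vfield_zero]) (use K in auto)
  with 1 show "\<exists>V. open V \<and> p \<in> V \<and> smooth_vfield A V (\<lambda>q. b q *\<^sub>R X q)"
    using K(1) U open_Compl[OF K(2)] by blast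
qed

lemma smooth_vfield_coord_vector:
  assumes c: "(U, \<phi>) \<in> A"
  shows "smooth_vfield A U (\<lambda>q. coord_vector A (U, \<phi>) q v)"
  by (rule smooth_vfield_coordI[OF c chart_open[OF c], where v="\<lambda>q. v"])
    (simp_all add: smooth_fun_const chart_open[OF c])

text \<open>This takes the place of a partition of unity. The functions are not normalised; the
  constructions below draw on finiteness and on the fact that some function is positive at each
  point. Charts and functions are indexed by all points, and only the positivity sets are reduced to
  a finite subcover.\<close>

lemma finite_cutoffs:
  assumes "compact (UNIV :: 'm set)"
  obtains I :: "'m set" and U \<phi> b where "finite I" "\<And>i. (U i, \<phi> i) \<in> A" "\<And>i. cutoff (U i) (b i)"
    "\<And>q. \<exists>i\<in>I. b i q > 0"
proof -
  have "\<exists>x. (fst x, fst (snd x)) \<in> A \<and> cutoff (fst x) (snd (snd x)) \<and> snd (snd x) p > 0" for p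
  proof -
    obtain U \<phi> where c: "(U, \<phi>) \<in> A" "p \<in> U" by (rule chart_covers)
    obtain b where "cutoff U b" "b p > 0" by (rule cutoff_exists[OF c])
    with c show ?thesis by (intro exI[of _ "(U, \<phi>, b)"]) simp
  qed
  then obtain x where "\<And>p. (fst (x p), fst (snd (x p))) \<in> A \<and> cutoff (fst (x p)) (snd (snd (x p))) \<and> snd (snd (x p)) p > 0"
    using choice[of "\<lambda>p x. (fst x, fst (snd x)) \<in> A \<and> cutoff (fst x) (snd (snd x)) \<and> snd (snd x) p > 0"] by blast
  moreover define U \<phi> b where "U = fst \<circ> x" and "\<phi> = fst \<circ> snd \<circ> x" and "b = snd \<circ> snd \<circ> x"
  ultimately have c: "\<And>p. (U p, \<phi> p) \<in> A" "\<And>p. cutoff (U p) (b p)" "\<And>p. b p p > 0" by auto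
  have o: "open {q. b p q > 0}" for p
  proof (rule open_Collect_less)
    show "continuous_on UNIV (b p)"
      using smooth_fun_continuous_on[OF open_UNIV, of "b p"] c(2)[of p] unfolding cutoff_def by blast
  qed (rule continuous_on_const)
  have "UNIV \<subseteq> (\<Union>i\<in>UNIV. {q. b i q > 0})" using c(3) by blast
  then obtain I where I: "finite I" "UNIV \<subseteq> (\<Union>i\<in>I. {q. b i q > 0})"
    by (rule compactE_image[OF assms o])
  show ?thesis
  proof (rule that[OF I(1) c(1,2)])
    show "\<exists>i\<in>I. b i q > 0" for q using I(2) UNIV_I[of q] by blast
  qed
qed

text \<open>The metric is the pullback of the Euclidean one along the map with components \<open>b i\<close> and
  \<open>b i * \<phi> i $ k\<close>, an immersion because the \<open>b i\<close> have no common zero.\<close>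

lemma riemannian_metric_exists:
  assumes "compact (UNIV :: 'm set)"
  shows "\<exists>g. riemannian_metric A g"
proof -
  obtain I :: "'m set" and U \<phi> b where I: "finite I" and c: "\<And>i. (U i, \<phi> i) \<in> A" and b: "\<And>i. cutoff (U i) (b i)"
    and cov: "\<And>q. \<exists>i\<in>I. b i q > 0" by (rule finite_cutoffs[OF assms]) blast
  define F where "F = (\<lambda>i k q. b i q * \<phi> i q $ k)"
  define g :: "'m metric" where "g = (\<lambda>p u v. \<Sum>i\<in>I. u (b i) * v (b i) + (\<Sum>k\<in>UNIV. u (F i k) * v (F i k)))"
  have sb: "smooth_fun A UNIV (b i)" for i using b unfolding cutoff_def by blast
  have sF: "smooth_fun A UNIV (F i k)" for i k
    unfolding F_def by (rule smooth_fun_cutoff_mult[OF b chart_open[OF c] smooth_fun_coord[OF c]])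
  have "riemannian_metric A g"
    unfolding riemannian_metric_def
  proof (rule conjI; intro allI ballI impI conjI; (elim conjE)?)
    fix p :: 'm and u v w :: "'m tvec" and x y :: real
    assume u: "u \<in> tangent_space A p"
    show "g p u v = g p v u" by (simp add: g_def mult.commute)
    show "g p (x *\<^sub>R u + y *\<^sub>R v) w = x * g p u w + y * g p v w"
      by (simp add: g_def scaleR_fun_apply sum.distrib sum_distrib_left algebra_simps)
    have nn: "u (b i) * u (b i) + (\<Sum>k\<in>UNIV. u (F i k) * u (F i k)) \<ge> 0" for i
      by (intro add_nonneg_nonneg sum_nonneg) simp_all
    show "g p u u > 0" if "u \<noteq> 0"
    proof (rule ccontr)
      assume "\<not> g p u u > 0"
      then have "g p u u = 0" using sum_nonneg[of I, OF nn] unfolding g_def by (simp add: not_less antisym)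
      then have z: "u (b i) * u (b i) + (\<Sum>k\<in>UNIV. u (F i k) * u (F i k)) = 0" if "i \<in> I" for i
        unfolding g_def using sum_nonneg_eq_0_iff[OF I, of "\<lambda>i. u (b i) * u (b i) + (\<Sum>k\<in>UNIV. u (F i k) * u (F i k))"] nn that by blast
      obtain i where i: "i \<in> I" "b i p > 0" using cov by blast
      have pU: "p \<in> U i" using b[of i] i(2) unfolding cutoff_def by fastforce
      have "(\<Sum>k\<in>UNIV. u (F i k) * u (F i k)) \<ge> 0" by (intro sum_nonneg) simp
      then have ub: "u (b i) = 0" and s0: "(\<Sum>k\<in>UNIV. u (F i k) * u (F i k)) = 0"
        using z[OF i(1)] zero_le_square[of "u (b i)"] by (simp_all add: add_nonneg_eq_0_iff)
      have uF: "u (F i k) = 0" for k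
        using s0 sum_nonneg_eq_0_iff[of UNIV "\<lambda>k. u (F i k) * u (F i k)"] by simp
      have "u (\<lambda>q. \<phi> i q $ k) = 0" for k
      proof -
        \<comment> \<open>With \<open>u (b i) = 0\<close> only the second term remains, and
          \<open>b i p > 0\<close> isolates the derivative of the coordinate. This is why the map
          has the components \<open>b i\<close> besides the products.\<close>
        have "u (F i k) = u (b i) * \<phi> i p $ k + b i p * u (\<lambda>q. \<phi> i q $ k)"
          unfolding F_def
          by (rule tangent_apply_mult[OF u smooth_nearI[OF open_UNIV UNIV_I sb]
                smooth_nearI[OF chart_open[OF c] pU smooth_fun_coord[OF c]]])
        then show ?thesis using uF ub i(2) by simp
      qed
      then have "u = coord_vector A (U i, \<phi> i) p (\<chi> k. 0)" using tangent_coords[OF c pU u] by simp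
      also have "(\<chi> k. 0) = 0 *\<^sub>R 0 + 0 *\<^sub>R (0 :: real^3)" by (simp add: vec_eq_iff)
      also have "coord_vector A (U i, \<phi> i) p (0 *\<^sub>R 0 + 0 *\<^sub>R 0) = 0"
        unfolding coord_vector_linear[OF c pU] by simp
      finally show False using that by blast
    qed
  next
    fix V X Y assume V: "open V" and X: "smooth_vfield A V X" and Y: "smooth_vfield A V Y"
    note s = smooth_vfield_apply'[OF X V smooth_fun_subset[OF _ subset_UNIV]] smooth_vfield_apply'[OF Y V smooth_fun_subset[OF _ subset_UNIV]]
    show "smooth_fun A V (\<lambda>p. g p (X p) (Y p))"
      unfolding g_def
      by (rule smooth_fun_sum[OF V] smooth_fun_add[OF V] smooth_fun_mult[OF V] s(1)[OF sb] s(1)[OF sF] s(2)[OF sb] s(2)[OF sF])+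
  qed
  then show ?thesis by blast
qed

end

lemma sum_fun_apply: "(\<Sum>i\<in>I. f i) x = (\<Sum>i\<in>I. f i x)"
  by (induction I rule: infinite_finite_induct) simp_all

context contact_manifold
begin

lemma form_sum:
  "(\<And>i. i \<in> I \<Longrightarrow> X i \<in> tangent_space A p) \<Longrightarrow> \<alpha> p (\<Sum>i\<in>I. c i *\<^sub>R X i) = (\<Sum>i\<in>I. c i * \<alpha> p (X i))"
proof (induction I rule: infinite_finite_induct)
  case (insert i I)
  then have "\<alpha> p (c i *\<^sub>R X i + 1 *\<^sub>R (\<Sum>i\<in>I. c i *\<^sub>R X i)) = c i * \<alpha> p (X i) + 1 * (\<Sum>i\<in>I. c i * \<alpha> p (X i))"
    by (subst form_linear) (auto intro!: tangent_sum tangent_scale)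
  then show ?case by (simp only: sum.insert[OF insert.hyps(1,2)] scaleR_one mult_1)
qed (use form_scale[OF tangent_zero, of p 0] in simp_all)

text \<open>The bracket of two fields spanning \<xi> is a witness, by the contact condition.\<close>

lemma form_nonzero: "\<exists>u\<in>tangent_space A p. \<alpha> p u \<noteq> 0"
proof -
  have "plane_distribution A \<xi>" using contact unfolding contact_structure_def by blast
  then obtain U S T where U: "open U" "p \<in> U" and ST: "smooth_vfield A U S" "smooth_vfield A U T"
    and \<xi>: "\<forall>q\<in>U. \<xi> q = span {S q, T q}" unfolding plane_distribution_def by metis
  have "\<alpha> p (lie_bracket A S T p) \<noteq> 0" by (rule form_bracket_nonzero[OF U ST]) (use \<xi> in blast)
  then show ?thesis using tangent_lie_bracket[OF U ST] by blast
qed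

text \<open>The cut-off coordinate fields \<open>N j\<close> span every tangent space and \<alpha>
  vanishes nowhere, so the sum \<open>s\<close> of the squares of \<open>a j = \<alpha>(N j)\<close>
  is positive. Weighting each \<open>N j\<close> by \<open>a j / s\<close> then makes the value of
  \<alpha> equal to \<open>s / s\<close>.\<close>

lemma transverse_vfield_exists:
  assumes "compact (UNIV :: 'm set)"
  shows "\<exists>R. smooth_vfield A UNIV R \<and> (\<forall>p. \<alpha> p (R p) = 1)"
proof -
  obtain I :: "'m set" and U \<phi> b where I: "finite I" and c: "\<And>i. (U i, \<phi> i) \<in> A" and b: "\<And>i. cutoff (U i) (b i)"
    and cov: "\<And>q. \<exists>i\<in>I. b i q > 0" by (rule finite_cutoffs[OF assms]) blast
  define J where "J = I \<times> (UNIV :: 3 set)"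
  define N where "N = (\<lambda>(i, k) q. b i q *\<^sub>R coord_vector A (U i, \<phi> i) q (axis k 1))"
  have N: "smooth_vfield A UNIV (N j)" for j
    unfolding N_def case_prod_beta by (rule smooth_vfield_cutoff_scale[OF b chart_open[OF c] smooth_vfield_coord_vector[OF c]])
  define a where "a = (\<lambda>j q. \<alpha> q (N j q))"
  define s where "s = (\<lambda>q. \<Sum>j\<in>J. a j q * a j q)"
  have a: "smooth_fun A UNIV (a j)" for j unfolding a_def by (rule smooth_fun_form[OF open_UNIV N])
  have fJ: "finite J" using I by (simp add: J_def)
  have s0: "s q \<noteq> 0" for q
  proof
    assume "s q = 0"
    then have a0: "a j q = 0" if "j \<in> J" for j
      using sum_nonneg_eq_0_iff[OF fJ, of "\<lambda>j. a j q * a j q"] that by (simp add: s_def)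
    obtain i where i: "i \<in> I" "b i q > 0" using cov by blast
    have qU: "q \<in> U i" using b[of i] i(2) unfolding cutoff_def by fastforce
    obtain u where u: "u \<in> tangent_space A q" "\<alpha> q u \<noteq> 0" using form_nonzero[of q] by blast
    let ?d = "\<lambda>k. coord_vector A (U i, \<phi> i) q (axis k 1)"
    have d: "?d k \<in> tangent_space A q" for k unfolding tangent_space_chart[OF c qU] by simp
    have "\<alpha> q (?d k) = 0" for k
      using a0[of "(i, k)"] i by (simp add: J_def a_def N_def form_scale[OF d])
    moreover have "u = (\<Sum>k\<in>UNIV. u (\<lambda>r. \<phi> i r $ k) *\<^sub>R ?d k)"
    proof (rule tangent_eqI[OF u(1)])
      show "(\<Sum>k\<in>UNIV. u (\<lambda>r. \<phi> i r $ k) *\<^sub>R ?d k) \<in> tangent_space A q" by (intro tangent_sum tangent_scale d)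
      show "u h = (\<Sum>k\<in>UNIV. u (\<lambda>r. \<phi> i r $ k) *\<^sub>R ?d k) h" for h
        using coord_vector_expand[OF c qU, of "\<chi> k. u (\<lambda>r. \<phi> i r $ k)" h]
        unfolding tangent_coords[OF c qU u(1), symmetric] sum_fun_apply scaleR_fun_apply by simp
    qed
    ultimately have "\<alpha> q u = 0" using form_sum[of UNIV ?d q "\<lambda>k. u (\<lambda>r. \<phi> i r $ k)", OF d] by simp
    with u show False by blast
  qed
  define R where "R = (\<lambda>q. \<Sum>j\<in>J. (a j q / s q) *\<^sub>R N j q)"
  have "smooth_fun A UNIV s" unfolding s_def
    by (rule smooth_fun_sum[OF open_UNIV smooth_fun_mult[OF open_UNIV a a]])
  then have "smooth_vfield A UNIV R"
    unfolding R_def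
    by (intro smooth_vfield_sum[OF open_UNIV])
      (rule smooth_vfield_scale[OF open_UNIV smooth_fun_divide[OF open_UNIV a _ s0] N])
  moreover have "\<alpha> q (R q) = 1" for q
  proof -
    have "\<alpha> q (R q) = (\<Sum>j\<in>J. a j q / s q * a j q)"
      unfolding R_def a_def by (rule form_sum) (rule smooth_vfieldD[OF N UNIV_I])
    also have "\<dots> = (\<Sum>j\<in>J. a j q * a j q) / s q" by (simp add: sum_divide_distrib)
    also have "\<dots> = s q / s q" by (simp only: s_def)
    finally show ?thesis using s0 by simp
  qed
  ultimately show ?thesis by blast
qed

end

context metric_family
begin

lemma prescribed_gaussian_curvature:
  assumes cpt: "compact (UNIV :: 'm set)" and f: "smooth_fun A UNIV f" "\<And>p. f p < 0"
  shows "\<exists>g D. riemannian_metric A g \<and> levi_civita A g D \<and> (\<forall>p. gaussian_curvature A g D \<xi> p = f p)"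
proof -
  \<comment> \<open>Comparing \<open>h = 1\<close> with \<open>h = 2\<close> yields \<open>C\<close> and \<open>F\<close> as globally defined functions.\<close>
  have const: "smooth_fun A UNIV (\<lambda>_. x)" for x by (rule smooth_fun_const[OF open_UNIV])
  obtain D1 where D1: "levi_civita A g1 D1"
    using levi_civita_exists[OF zero_less_one const zero_less_one] by blast
  obtain D2 where D2: "levi_civita A (scaled_metric 1 (\<lambda>_. 2)) D2"
    using levi_civita_exists[OF zero_less_one const zero_less_numeral] by blast
  let ?K1 = "gaussian_curvature A g1 D1 \<xi>" and ?K2 = "gaussian_curvature A (scaled_metric 1 (\<lambda>_. 2)) D2 \<xi>"
  \<comment> \<open>With \<open>\<mu> = 1\<close> the curvature is \<open>F - 3/4 * C\<close> for
    \<open>h = 1\<close> and \<open>F - 3 * C\<close> for \<open>h = 2\<close>; the difference is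
    \<open>9/4 * C\<close>.\<close>
  define C where "C = (\<lambda>p. 4 / 9 * (?K1 p - ?K2 p))"
  define F where "F = (\<lambda>p. ?K1 p + 3 / 4 * C p)"
  \<comment> \<open>The left-hand sides do not mention the frame. This yields invariance under a
    change of adapted frame without any transformation formula, and it lets smoothness be checked
    locally.\<close>
  have K: "C p = (\<alpha> p (lie_bracket A S T p))\<^sup>2" "F p = frame_invariant S T p"
    if af: "adapted_frame U S T" "p \<in> U" for U S T p
    using scaled_gaussian_curvature[OF af(1) zero_less_one const zero_less_one af(2) D1]
      scaled_gaussian_curvature[OF af(1) zero_less_one const zero_less_numeral af(2) D2]
    by (simp_all add: C_def F_def)
  have Cs: "smooth_fun A UNIV C" and Fs: "smooth_fun A UNIV F"
  proof -
    have "\<exists>U. open U \<and> p \<in> U \<and> smooth_fun A U C \<and> smooth_fun A U F" for p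
    proof -
      obtain U S T where U: "p \<in> U" and af: "adapted_frame U S T" using adapted_frame_exists by blast
      note o = af_open[OF af]
      have "smooth_fun A U (\<lambda>q. \<alpha> q (lie_bracket A S T q) * \<alpha> q (lie_bracket A S T q))"
        by (intro smooth_fun_mult smooth_fun_form smooth_vfield_lie_bracket o af_smooth[OF af])
      then have "smooth_fun A U C"
        by (rule smooth_fun_cong[OF o, rotated]) (simp add: K(1)[OF af] power2_eq_square)
      moreover have "smooth_fun A U F"
        by (rule smooth_fun_cong[OF o _ smooth_frame_invariant[OF af]]) (simp add: K(2)[OF af])
      ultimately show ?thesis using o U by blast
    qed
    then show "smooth_fun A UNIV C" "smooth_fun A UNIV F" by (intro smooth_fun_local, blast)+
  qed
  have Cp: "C p > 0" for p
  proof -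
    obtain U S T where U: "p \<in> U" and af: "adapted_frame U S T" using adapted_frame_exists by blast
    have "\<alpha> p (lie_bracket A S T p) \<noteq> 0"
      by (rule form_bracket_nonzero[OF af_open[OF af] U af_smooth[OF af] af_span[OF af]])
    then show ?thesis by (simp add: K(1)[OF af U])
  qed
  obtain x where x: "\<And>p. F x \<le> F p"
    using continuous_attains_inf[OF cpt _ smooth_fun_continuous_on[OF open_UNIV Fs]] by auto
  obtain y where y: "\<And>p. f p \<le> f y"
    using continuous_attains_sup[OF cpt _ smooth_fun_continuous_on[OF open_UNIV f(1)]] by auto
  \<comment> \<open>\<open>F x\<close> is the minimum of \<open>F\<close> and \<open>f y\<close> the
    maximum of \<open>f\<close>. Since \<mu> is at least 1, \<open>\<mu>\<^sup>2 * (- f y)\<close>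
    is at least \<open>\<mu> * (- f y) = - f y + \<bar>F x\<bar>\<close>, which exceeds
    \<open>- F x\<close> because \<open>f y\<close> is negative.\<close>
  define \<mu> where "\<mu> = 1 + \<bar>F x\<bar> / (- f y)"
  have fy: "- f y > 0" using f(2)[of y] by simp
  have \<mu>1: "\<mu> \<ge> 1" using fy by (simp add: \<mu>_def divide_nonneg_neg)
  then have \<mu>: "\<mu> > 0" by simp
  have "\<mu>\<^sup>2 * (- f y) \<ge> \<mu> * (- f y)" using \<mu>1 fy by (intro mult_right_mono) (simp_all add: power2_eq_square)
  moreover have "\<mu> * (- f y) = - f y + \<bar>F x\<bar>" using fy by (simp add: \<mu>_def field_simps)
  ultimately have \<mu>F: "\<mu>\<^sup>2 * f y < F x" using fy by linarith
  have pos: "F p / \<mu>\<^sup>2 - f p > 0" for p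
  proof -
    have "\<mu>\<^sup>2 * f p \<le> \<mu>\<^sup>2 * f y" using y[of p] by (intro mult_left_mono) simp_all
    also have "\<dots> < F p" using \<mu>F x[of p] by linarith
    finally show ?thesis using \<mu> by (simp add: field_simps)
  qed
  \<comment> \<open>This is the solution of
    \<open>F / \<mu>\<^sup>2 - 3/4 * H * C / \<mu>^4 = f\<close> for the square \<open>H\<close> of
    \<open>h\<close>. Positivity is essential twice: for the root to be smooth and for
    \<open>sqrt (H p)\<close> to be a length.\<close>
  define H where "H = (\<lambda>p. 4 / 3 * \<mu>^4 * ((1 / \<mu>\<^sup>2 * F p - f p) / C p))"
  have Hp: "H p > 0" for p using pos[of p] Cp[of p] \<mu> by (simp add: H_def)
  have "smooth_fun A UNIV H"
    unfolding H_def
    by (intro smooth_fun_cmult smooth_fun_divide smooth_fun_diff open_UNIV Fs f Cs Cp[THEN less_imp_neq, symmetric])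
  then have h: "smooth_fun A UNIV (\<lambda>p. sqrt (H p))" using Hp by (rule smooth_fun_sqrt[OF open_UNIV])
  have hp: "sqrt (H p) > 0" for p using Hp by simp
  obtain D where D: "levi_civita A (scaled_metric \<mu> (\<lambda>p. sqrt (H p))) D" using levi_civita_exists[OF \<mu> h hp] by blast
  have "gaussian_curvature A (scaled_metric \<mu> (\<lambda>p. sqrt (H p))) D \<xi> p = f p" for p
  proof -
    obtain U S T where U: "p \<in> U" and af: "adapted_frame U S T" using adapted_frame_exists by blast
    have "gaussian_curvature A (scaled_metric \<mu> (\<lambda>p. sqrt (H p))) D \<xi> p = F p / \<mu>\<^sup>2 - 3 / 4 * H p * C p / \<mu>^4"
      using scaled_gaussian_curvature[OF af \<mu> h hp U D] Hp[of p] by (simp add: K[OF af U])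
    also have "3 / 4 * H p * C p / \<mu>^4 = F p / \<mu>\<^sup>2 - f p"
      using Cp[of p] \<mu> by (simp add: H_def)
    finally show ?thesis by simp
  qed
  then show ?thesis using D riemannian_scaled_metric[OF \<mu> h hp] by blast
qed

end

theorem theorem6p1:
  fixes A :: "'m::{t2_space, second_countable_topology} chart set"
    and \<xi> :: "'m distribution"
    and f :: "'m \<Rightarrow> real"
  assumes "smooth_atlas A"
    and "compact (UNIV :: 'm set)"
    and "orientable A"
    and "contact_structure A \<xi>"
    and "transversally_orientable A \<xi>"
    and "smooth_fun A UNIV f"
    and "\<forall>p. f p < 0"
  shows "\<exists>g D. riemannian_metric A g \<and> levi_civita A g D \<and>
           (\<forall>p. gaussian_curvature A g D \<xi> p = f p)"
proof -
  obtain \<alpha> where \<alpha>: "one_form A \<alpha>" "\<And>p. \<xi> p = {v \<in> tangent_space A p. \<alpha> p v = 0}"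
    using assms(5) unfolding transversally_orientable_def by blast
  interpret contact_manifold A \<xi> \<alpha>
    by unfold_locales (rule assms(1) assms(4) \<alpha>)+
  obtain R where R: "smooth_vfield A UNIV R" "\<And>p. \<alpha> p (R p) = 1"
    using transverse_vfield_exists[OF assms(2)] by blast
  obtain g0 where g0: "riemannian_metric A g0" using riemannian_metric_exists[OF assms(2)] by blast
  interpret metric_family A \<xi> \<alpha> R g0
    by unfold_locales (rule R g0)+
  show ?thesis
    by (rule prescribed_gaussian_curvature[OF assms(2,6)]) (use assms(7) in blast)
qed

end
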